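(* Let $K$ be an algebraic function field in one variable with constant field $\mathbb{F}_q$, $\infty$ a place of $K$ of odd degree, $A$ the ring of elements of $K$ integral outside $\infty$, $G=GL_2(A)$, $\widehat{G}=GL_2(K)$, $Z(K)$ the scalar matrices in $\widehat{G}$ and $Quinn(G)=N_{\widehat{G}}(G)/Z(K)\cdot G$. Then $Quinn(G)$ acts freely and transitively on $$\mathrm{Ell}(G)^{=}=\{G\omega:\omega\in E(G),\ G\omega=G\overline{\omega}\}.$$
   Context: $N_{\widehat{G}}(G)$ is the normalizer of $G$ in $\widehat{G}$. With $K_\infty$ the completion of $K$ at $\infty$, $C_\infty$ the completion of an algebraic closure of $K_\infty$, $\Omega=C_\infty\setminus K_\infty$, $GL_2(K_\infty)$ acts on $\Omega$ by Möbius transformations. $E(G)$ is the set of $\omega\in\Omega$ fixed by some non-scalar element of $G$ (elliptic elements); these lie in $\widetilde{K}=K\cdot\mathbb{F}_{q^2}$, and $\overline{\omega}$ denotes the image of $\omega$ under the nontrivial automorphism of $\widetilde{K}/K$. $Quinn(G)$ acts on orbits by $G\omega\mapsto Gg(\omega)$, $g\in N_{\widehat{G}}(G)$; this preserves $\mathrm{Ell}(G)^{=}$. *)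

theory Defs
  imports
    "HOL-Analysis.Analysis"
    "HOL-Algebra.Group_Action"
    "HOL-Computational_Algebra.Polynomial"
begin

subsection \<open>Field extensions inside a field type\<close>

definition is_subfield :: "'a::field set \<Rightarrow> bool" where
  "is_subfield S \<longleftrightarrow> 0 \<in> S \<and> 1 \<in> S \<and>
     (\<forall>x\<in>S. \<forall>y\<in>S. x + y \<in> S \<and> x - y \<in> S \<and> x * y \<in> S) \<and> (\<forall>x\<in>S. inverse x \<in> S)"

definition field_gen :: "'a::field set \<Rightarrow> 'a set" where
  "field_gen S = \<Inter>{L. is_subfield L \<and> S \<subseteq> L}"

definition algebraic_over :: "'a::field set \<Rightarrow> 'a \<Rightarrow> bool" where
  "algebraic_over S x \<longleftrightarrow> (\<exists>p. p \<noteq> 0 \<and> (\<forall>i. coeff p i \<in> S) \<and> poly p x = 0)"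

definition finite_over :: "'a::field set \<Rightarrow> bool" where
  "finite_over S \<longleftrightarrow> (\<exists>B. finite B \<and> (\<forall>x. \<exists>c. (\<forall>b\<in>B. c b \<in> S) \<and> x = (\<Sum>b\<in>B. c b * b)))"

text \<open>The field is the whole type \<^typ>\<open>'k\<close>; \<open>F\<close> is its full (finite) field of constants,
  so the number usually called \<open>q\<close> is \<open>card F\<close>.\<close>

definition function_field :: "'k::field set \<Rightarrow> bool" where
  "function_field F \<longleftrightarrow> is_subfield F \<and> finite F \<and>
     (\<exists>t. \<not> algebraic_over F t \<and> finite_over (field_gen (insert t F))) \<and>
     (\<forall>x. algebraic_over F x \<longrightarrow> x \<in> F)"

subsection \<open>Places\<close>

text \<open>A place is represented by its valuation ring, which determines and is determined by
  its maximal ideal.\<close>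

definition is_place :: "'k::field set \<Rightarrow> 'k set \<Rightarrow> bool" where
  "is_place F V \<longleftrightarrow> F \<subset> V \<and> V \<subset> UNIV \<and>
     (\<forall>x\<in>V. \<forall>y\<in>V. x + y \<in> V \<and> x - y \<in> V \<and> x * y \<in> V) \<and>
     (\<forall>x. x \<in> V \<or> inverse x \<in> V)"

definition vr_units :: "'k::field set \<Rightarrow> 'k set" where
  "vr_units V = {x \<in> V. x \<noteq> 0 \<and> inverse x \<in> V}"

definition vr_ideal :: "'k::field set \<Rightarrow> 'k set" where
  "vr_ideal V = V - vr_units V"

text \<open>The dimension over \<open>F\<close> of the residue field \<open>V / vr_ideal V\<close>: the \<open>b i\<close> are lifts of
  a basis.\<close>

definition place_degree :: "'k::field set \<Rightarrow> 'k set \<Rightarrow> nat" where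
  "place_degree F V = (THE d. \<exists>b. (\<forall>i<d. b i \<in> V) \<and>
     (\<forall>x\<in>V. \<exists>!c. c \<in> {..<d} \<rightarrow>\<^sub>E F \<and> x - (\<Sum>i<d. c i * b i) \<in> vr_ideal V))"

definition place_val :: "'k::field set \<Rightarrow> 'k \<Rightarrow> int" where
  "place_val V z = (THE n. \<exists>t u. vr_ideal V = (\<lambda>x. t * x) ` V \<and> u \<in> vr_units V \<and>
     z = t powi n * u)"

definition place_abs :: "'k::field set \<Rightarrow> 'k set \<Rightarrow> 'k \<Rightarrow> real" where
  "place_abs F V z =
     (if z = 0 then 0 else (real (card F) ^ place_degree F V) powi (- place_val V z))"

definition ring_outside :: "'k::field set \<Rightarrow> 'k set \<Rightarrow> 'k set" where
  "ring_outside F V = \<Inter>{W. is_place F W \<and> W \<noteq> V}"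

subsection \<open>The complete field and the upper half plane\<close>

text \<open>The image of the function field under \<open>\<iota>\<close> lies in a complete field, so its topological
  closure is its completion.\<close>

definition K_inf :: "('k::field \<Rightarrow> 'c::{field,complete_space}) \<Rightarrow> 'c set" where
  "K_inf \<iota> = closure (range \<iota>)"

definition K_inf_bar :: "('k::field \<Rightarrow> 'c::{field,complete_space}) \<Rightarrow> 'c set" where
  "K_inf_bar \<iota> = {x. algebraic_over (K_inf \<iota>) x}"

text \<open>The type \<^typ>\<open>'c\<close>, with absolute value \<open>\<lambda>x. dist x 0\<close> and embedding \<open>\<iota>\<close> of the function
  field, is a completion of an algebraic closure of the completion at \<open>V\<close>. These conditions
  determine it up to isometric isomorphism. (The class \<open>real_normed_field\<close> is unusable here,
  as it forces characteristic zero.) The ultrametric inequality is not listed because it follows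
  from the values on the prime field.\<close>

definition is_C_inf ::
  "'k::field set \<Rightarrow> 'k set \<Rightarrow> ('k \<Rightarrow> 'c::{field,complete_space}) \<Rightarrow> bool" where
  "is_C_inf F V \<iota> \<longleftrightarrow>
     \<iota> 1 = 1 \<and> (\<forall>x y. \<iota> (x + y) = \<iota> x + \<iota> y) \<and> (\<forall>x y. \<iota> (x * y) = \<iota> x * \<iota> y) \<and>
     (\<forall>x y :: 'c. dist x y = dist (x - y) 0) \<and>
     (\<forall>x y :: 'c. dist (x * y) 0 = dist x 0 * dist y 0) \<and>
     (\<forall>x. dist (\<iota> x) 0 = place_abs F V x) \<and>
     (\<forall>p. degree p > 0 \<and> (\<forall>i. coeff p i \<in> K_inf_bar \<iota>) \<longrightarrow> (\<exists>x\<in>K_inf_bar \<iota>. poly p x = 0)) \<and>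
     closure (K_inf_bar \<iota>) = UNIV"

definition Omega :: "('k::field \<Rightarrow> 'c::{field,complete_space}) \<Rightarrow> 'c set" where
  "Omega \<iota> = - K_inf \<iota>"

subsection \<open>Groups\<close>

definition GL2 :: "'k::field set \<Rightarrow> ('k^2^2) monoid" where
  "GL2 R = units_of \<lparr>carrier = {M. \<forall>i j. M $ i $ j \<in> R}, monoid.mult = (**), one = mat 1\<rparr>"

definition scalars :: "('k::field^2^2) set" where
  "scalars = {mat c | c. c \<noteq> 0}"

definition moebius_act :: "('k::field \<Rightarrow> 'c::field) \<Rightarrow> 'k^2^2 \<Rightarrow> 'c \<Rightarrow> 'c" where
  "moebius_act \<iota> M w = (\<iota> (M$1$1) * w + \<iota> (M$1$2)) / (\<iota> (M$2$1) * w + \<iota> (M$2$2))"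

text \<open>From here on \<open>A\<close> is the subring of \<^typ>\<open>'k\<close> over which \<open>G = GL2 A\<close> is formed;
  \<open>GL2 UNIV\<close> is the general linear group of the whole field.\<close>

abbreviation normGL2 :: "'k::field set \<Rightarrow> ('k^2^2) set" where
  "normGL2 A \<equiv> normalizer (GL2 UNIV) (carrier (GL2 A))"

abbreviation ZG :: "'k::field set \<Rightarrow> ('k^2^2) set" where
  "ZG A \<equiv> scalars <#>\<^bsub>GL2 UNIV\<^esub> carrier (GL2 A)"

definition Quinn :: "'k::field set \<Rightarrow> ('k^2^2) set monoid" where
  "Quinn A = (GL2 UNIV)\<lparr>carrier := normGL2 A\<rparr> Mod ZG A"

subsection \<open>Elliptic points\<close>

definition elliptic_points ::
  "'k::field set \<Rightarrow> ('k \<Rightarrow> 'c::{field,complete_space}) \<Rightarrow> 'c set" where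
  "elliptic_points A \<iota> =
     {w \<in> Omega \<iota>. \<exists>M \<in> carrier (GL2 A). M \<notin> scalars \<and> moebius_act \<iota> M w = w}"

abbreviation G_orbit :: "'k::field set \<Rightarrow> ('k \<Rightarrow> 'c::field) \<Rightarrow> 'c \<Rightarrow> 'c set" where
  "G_orbit A \<iota> w \<equiv> orbit (GL2 A) (moebius_act \<iota>) w"

text \<open>The compositum of the function field with the field of \<open>(card F)\<^sup>2\<close> elements, the latter
  being the set of roots of \<open>X^((card F)\<^sup>2) - X\<close>.\<close>

definition K_tilde :: "'k::field set \<Rightarrow> ('k \<Rightarrow> 'c::field) \<Rightarrow> 'c set" where
  "K_tilde F \<iota> = field_gen (range \<iota> \<union> {x. x ^ ((card F)\<^sup>2) = x})"

definition nontrivial_aut ::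
  "'k::field set \<Rightarrow> ('k \<Rightarrow> 'c::field) \<Rightarrow> ('c \<Rightarrow> 'c) \<Rightarrow> bool" where
  "nontrivial_aut F \<iota> \<sigma> \<longleftrightarrow> bij_betw \<sigma> (K_tilde F \<iota>) (K_tilde F \<iota>) \<and>
     (\<forall>x\<in>K_tilde F \<iota>. \<forall>y\<in>K_tilde F \<iota>. \<sigma> (x + y) = \<sigma> x + \<sigma> y \<and> \<sigma> (x * y) = \<sigma> x * \<sigma> y) \<and>
     (\<forall>x. \<sigma> (\<iota> x) = \<iota> x) \<and> (\<exists>x\<in>K_tilde F \<iota>. \<sigma> x \<noteq> x)"

definition Ell_eq ::
  "'k::field set \<Rightarrow> ('k \<Rightarrow> 'c::{field,complete_space}) \<Rightarrow> ('c \<Rightarrow> 'c) \<Rightarrow> 'c set set" where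
  "Ell_eq A \<iota> \<sigma> =
     {G_orbit A \<iota> w | w. w \<in> elliptic_points A \<iota> \<and> G_orbit A \<iota> w = G_orbit A \<iota> (\<sigma> w)}"

text \<open>For \<open>C\<close> the class of \<open>g\<close> and \<open>X\<close> the orbit of \<open>w\<close>, the union below is the orbit of
  \<open>g(w)\<close>. The restriction to \<open>Ell_eq\<close> is required by the extensionality convention of
  \<^const>\<open>BijGroup\<close>.\<close>

definition Quinn_act ::
  "'k::field set \<Rightarrow> ('k \<Rightarrow> 'c::{field,complete_space}) \<Rightarrow> ('c \<Rightarrow> 'c) \<Rightarrow>
    ('k^2^2) set \<Rightarrow> 'c set \<Rightarrow> 'c set" where
  "Quinn_act A \<iota> \<sigma> C = (\<lambda>X \<in> Ell_eq A \<iota> \<sigma>. \<Union>g\<in>C. moebius_act \<iota> g ` X)"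

end

theory Submission
  imports Defs "HOL-Computational_Algebra.Primes"
begin

text \<open>
  A matrix \<open>M \<in> GL2 A\<close> fixing \<open>w \<in> \<Omega>\<close> has constant trace, since otherwise its eigenvalues lie in the
  completion; hence \<open>F[M]\<close> is the field of \<open>q\<^sup>2\<close> elements. A matrix \<open>g\<close> over the function field
  normalizes \<open>GL2 A\<close> iff all products of two entries of \<open>g\<close> divided by \<open>det g\<close> lie in \<open>A\<close>.

  Freeness: if such a \<open>g\<close> fixes \<open>w\<close>, then \<open>h = g\<^sup>2 / det g\<close> lies in \<open>GL2 A\<close> and fixes \<open>w\<close>, so
  \<open>h + 1 = (tr g / det g) g\<close> has constant determinant, and \<open>g\<close> is a scalar multiple of an element
  of \<open>GL2 A\<close> (if \<open>tr g = 0\<close>, of the trace zero element of \<open>F[M]\<close>).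

  Transitivity: if \<open>h \<in> GL2 A\<close> maps \<open>w\<close> to its conjugate, then \<open>h M h\<^sup>-\<^sup>1 = tr M - M\<close>, so \<open>M\<close> and \<open>h\<close>
  generate a quaternion algebra over the finite field \<open>F\<close>. It is split, and a matrix conjugating
  it to the algebra of two by two matrices over \<open>F\<close> normalizes \<open>GL2 A\<close> and moves \<open>w\<close> to a constant.

  Non-emptiness: by the odd degree, a quadratic polynomial irreducible over \<open>F\<close> has no root in the
  residue field at the place, hence none in the completion.
\<close>

subsection \<open>Finite subfields\<close>

text \<open>Two things shape the proof. First, the notions of place, valuation and degree are bare:
  a place is any proper valuation ring over \<open>F\<close>, and \<open>place_val\<close> and
  \<open>place_degree\<close> are definite descriptions. So the existence of enough places, the
  discreteness of the valuation and the finiteness of the residue field have to be derived before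
  \<open>place_abs\<close> says anything. Because \<open>F\<close> is finite, dimension arguments
  can be replaced by counting elements of finite sets. Second, for a point w outside the image of
  the function field, w and 1 are linearly independent over that field. Hence a matrix is determined
  by its value on the vector (w, 1), and a matrix fixing w has this vector as an eigenvector. For an
  elliptic point the eigenvalue generates the constant quadratic extension, so conjugation sends it
  to the trace minus itself; this is how a condition on orbits turns into an equation between
  matrices. The normalizer criterion is homogeneous of degree zero in the entries, so it does not
  see scalars.\<close>

lemma is_subfield_add: "is_subfield S \<Longrightarrow> x \<in> S \<Longrightarrow> y \<in> S \<Longrightarrow> x + y \<in> S"
  and is_subfield_diff: "is_subfield S \<Longrightarrow> x \<in> S \<Longrightarrow> y \<in> S \<Longrightarrow> x - y \<in> S"
  and is_subfield_mult: "is_subfield S \<Longrightarrow> x \<in> S \<Longrightarrow> y \<in> S \<Longrightarrow> x * y \<in> S"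
  and is_subfield_inverse: "is_subfield S \<Longrightarrow> x \<in> S \<Longrightarrow> inverse x \<in> S"
  and is_subfield_0: "is_subfield S \<Longrightarrow> 0 \<in> S"
  and is_subfield_1: "is_subfield S \<Longrightarrow> 1 \<in> S"
  by (auto simp: is_subfield_def)

lemma is_subfield_uminus: "is_subfield S \<Longrightarrow> x \<in> S \<Longrightarrow> - x \<in> S"
  using is_subfield_diff[of S 0 x] is_subfield_0 by auto

lemma is_subfield_divide: "is_subfield S \<Longrightarrow> x \<in> S \<Longrightarrow> y \<in> S \<Longrightarrow> x / y \<in> S"
  by (simp add: divide_inverse is_subfield_mult is_subfield_inverse)

lemma is_subfield_of_nat: "is_subfield S \<Longrightarrow> of_nat n \<in> S"
  by (induction n) (auto intro: is_subfield_add is_subfield_0 is_subfield_1)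

lemma is_subfield_numeral: "is_subfield S \<Longrightarrow> numeral n \<in> S"
  using is_subfield_of_nat[of S "numeral n"] by simp

lemma is_subfield_power: "is_subfield S \<Longrightarrow> x \<in> S \<Longrightarrow> x ^ n \<in> S"
  by (induction n) (auto intro: is_subfield_mult is_subfield_1)

lemma is_subfield_sum: "is_subfield S \<Longrightarrow> (\<And>i. i \<in> I \<Longrightarrow> f i \<in> S) \<Longrightarrow> sum f I \<in> S"
  by (induction I rule: infinite_finite_induct) (auto intro: is_subfield_add is_subfield_0)

lemmas is_subfield_intros =
  is_subfield_add is_subfield_diff is_subfield_mult is_subfield_inverse is_subfield_0 is_subfield_1
  is_subfield_uminus is_subfield_divide is_subfield_of_nat is_subfield_numeral is_subfield_power
  is_subfield_sum

text \<open>\<open>R\<close> picks one representative from each class of \<open>S\<close> modulo the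
  prime ideal \<open>m\<close>, so this is Fermat's theorem for the residue ring without forming a
  quotient: multiplication by a nonzero class permutes the nonzero classes, and their product can be
  cancelled. The ideal {0} gives finite subfields, the ideal of a place gives residue
  fields.\<close>

lemma fermat_transversal:
  fixes S m R :: "'a::comm_ring_1 set"
  assumes fin: "finite R" and RS: "R \<subseteq> S"
    and S1: "1 \<in> S" and Smult: "\<And>x y. x \<in> S \<Longrightarrow> y \<in> S \<Longrightarrow> x * y \<in> S"
    and m0: "0 \<in> m" and mS: "m \<subseteq> S"
    and madd: "\<And>x y. x \<in> m \<Longrightarrow> y \<in> m \<Longrightarrow> x + y \<in> m"
    and mdiff: "\<And>x y. x \<in> m \<Longrightarrow> y \<in> m \<Longrightarrow> x - y \<in> m"
    and mmult: "\<And>x y. x \<in> S \<Longrightarrow> y \<in> m \<Longrightarrow> x * y \<in> m"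
    and prime: "\<And>x y. x \<in> S \<Longrightarrow> y \<in> S \<Longrightarrow> x * y \<in> m \<Longrightarrow> x \<in> m \<or> y \<in> m"
    and one: "1 \<notin> m"
    and rep: "\<And>x. x \<in> S \<Longrightarrow> \<exists>!r. r \<in> R \<and> x - r \<in> m"
    and diffS: "\<And>x y. x \<in> S \<Longrightarrow> y \<in> S \<Longrightarrow> x - y \<in> S"
    and x: "x \<in> S"
  shows "x ^ card R - x \<in> m"
proof -
  obtain z where z: "z \<in> R" "0 - z \<in> m"
    using rep[of 0] m0 mS by auto
  have zm: "z \<in> m" using mdiff[OF m0 z(2)] by simp
  have Rm: "r = z" if "r \<in> R" "r \<in> m" for r
    using rep[of 0] that z mdiff[OF m0 that(2)] m0 mS by auto
  define R' where "R' = R - {z}"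
  have fin': "finite R'" using fin by (simp add: R'_def)
  have card: "card R = Suc (card R')"
    unfolding R'_def using fin z(1) by (metis card.remove)
  have powS: "x ^ n \<in> S" for n by (induction n) (auto intro: S1 Smult x)
  show ?thesis
  proof (cases "x \<in> m")
    case True
    have "x ^ card R = x ^ card R' * x" by (simp add: card mult.commute)
    thus ?thesis using True powS by (auto intro: mdiff mmult)
  next
    case False
    define f where "f y = (THE r. r \<in> R \<and> x * y - r \<in> m)" for y
    have f: "f y \<in> R" "x * y - f y \<in> m" if "y \<in> S" for y
      using theI'[OF rep[OF Smult[OF x that]]] by (auto simp: f_def)
    have fR': "f y \<in> R'" if "y \<in> R'" for y
    proof -
      have yS: "y \<in> S" and yR: "y \<in> R" "y \<noteq> z" using that RS by (auto simp: R'_def)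
      have "f y \<noteq> z"
      proof
        assume "f y = z"
        hence "x * y \<in> m" using f(2)[OF yS] zm madd[of "x*y - z" z] by simp
        hence "y \<in> m" using prime[OF x yS] False by auto
        thus False using Rm yR by auto
      qed
      thus ?thesis using f(1)[OF yS] by (auto simp: R'_def)
    qed
    have inj: "inj_on f R'"
    proof (rule inj_onI)
      fix a b assume ab: "a \<in> R'" "b \<in> R'" "f a = f b"
      have S: "a \<in> S" "b \<in> S" "a \<in> R" "b \<in> R" using ab RS by (auto simp: R'_def)
      have "(x * a - f a) - (x * b - f b) \<in> m" using f S by (blast intro: mdiff)
      hence "x * (a - b) \<in> m" using ab by (simp add: algebra_simps)
      hence "a - b \<in> m" using prime[OF x diffS[OF S(1,2)]] False by auto
      thus "a = b" using rep[OF S(1)] S m0 by (metis diff_self)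
    qed
    have bij: "bij_betw f R' R'"
      using inj fR' fin' by (simp add: bij_betw_def endo_inj_surj image_subsetI)
    have prodS: "prod g I \<in> S" if "\<And>i. i \<in> I \<Longrightarrow> g i \<in> S" for g :: "'a \<Rightarrow> 'a" and I
      using that by (induction I rule: infinite_finite_induct) (auto intro: S1 Smult)
    have prodm: "prod g I \<notin> m" if "finite I" "\<And>i. i \<in> I \<Longrightarrow> g i \<in> S - m" for g :: "'a \<Rightarrow> 'a" and I
      using that
    proof (induction I rule: finite_induct)
      case (insert i I)
      thus ?case using prime[of "g i" "prod g I"] prodS[of I g] by auto
    qed (simp add: one)
    \<comment> \<open>Replacing the factors x * y by their representatives one at a time changes the
      product only by elements of \<open>m\<close>.\<close>
    have cong: "prod (\<lambda>y. x * y) I - prod f I \<in> m" if "finite I" "I \<subseteq> R'" for I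
      using that
    proof (induction I rule: finite_induct)
      case empty thus ?case using m0 by simp
    next
      case (insert i I)
      have iS: "i \<in> S" using insert RS by (auto simp: R'_def)
      have fS: "f j \<in> S" if "j \<in> insert i I" for j
        using that f(1)[of j] insert RS by (auto simp: R'_def)
      have 1: "prod (\<lambda>y. x * y) I \<in> S" using insert RS by (intro prodS Smult x) (auto simp: R'_def)
      have "prod (\<lambda>y. x * y) I * (x * i - f i) + f i * (prod (\<lambda>y. x * y) I - prod f I) \<in> m"
        using insert fS 1 f(2)[OF iS] by (intro madd mmult) auto
      also have "prod (\<lambda>y. x * y) I * (x * i - f i) + f i * (prod (\<lambda>y. x * y) I - prod f I)
         = prod (\<lambda>y. x * y) (insert i I) - prod f (insert i I)"
        using insert by (simp add: algebra_simps)
      finally show ?case .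
    qed
    have "prod f R' = \<Prod>R'" using prod.reindex_bij_betw[OF bij, of "\<lambda>x. x"] by simp
    moreover have "prod (\<lambda>y. x * y) R' = x ^ card R' * \<Prod>R'" by (simp add: prod.distrib)
    ultimately have "x ^ card R' * \<Prod>R' - \<Prod>R' \<in> m" using cong[OF fin'] by auto
    hence "\<Prod>R' * (x ^ card R' - 1) \<in> m" by (simp add: algebra_simps)
    moreover have "\<Prod>R' \<notin> m" using RS Rm by (intro prodm fin') (auto simp: R'_def)
    moreover have "\<Prod>R' \<in> S" using RS by (intro prodS) (auto simp: R'_def)
    moreover have "x ^ card R' - 1 \<in> S" by (rule diffS[OF powS S1])
    ultimately have "x ^ card R' - 1 \<in> m" using prime by blast
    from mmult[OF x this] show ?thesis by (simp add: card algebra_simps)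
  qed
qed

lemma finite_subfield_fermat:
  assumes "is_subfield S" "finite S" "x \<in> S"
  shows "x ^ card S = x"
proof -
  have "x ^ card S - x \<in> {0}"
    by (rule fermat_transversal[where S = S]) (use assms in \<open>auto intro: is_subfield_intros\<close>)
  thus ?thesis by simp
qed

lemma card_roots_power_le:
  assumes "n \<ge> 2"
  shows "finite {x::'a::idom. x ^ n = x}" "card {x::'a::idom. x ^ n = x} \<le> n"
proof -
  define p :: "'a poly" where "p = monom 1 n - [:0,1:]"
  have "coeff p n = 1" using assms by (auto simp: p_def coeff_pCons split: nat.splits)
  hence p0: "p \<noteq> 0" by auto
  have eq: "{x. x ^ n = x} = {x. poly p x = 0}" by (auto simp: p_def poly_monom)
  have "degree p \<le> n"
    using assms unfolding p_def by (intro degree_diff_le) (auto intro: degree_monom_le)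
  thus "finite {x::'a::idom. x ^ n = x}" "card {x::'a::idom. x ^ n = x} \<le> n"
    using card_poly_roots_bound[OF p0] poly_roots_finite[OF p0] eq by auto
qed

lemma card_subfield_ge_2:
  assumes "is_subfield S" "finite S"
  shows "card S \<ge> 2"
proof -
  have "card {0, 1::'a} \<le> card S"
    using assms by (intro card_mono) (auto intro: is_subfield_intros)
  thus ?thesis by simp
qed

text \<open>Applied to a subfield with q^2 elements, this identifies the root set occurring in
  \<open>K_tilde\<close>.\<close>

lemma finite_subfield_roots:
  assumes "is_subfield S" "finite S"
  shows "{x. x ^ card S = x} = S"
proof -
  have "S \<subseteq> {x. x ^ card S = x}" using finite_subfield_fermat[OF assms] by auto
  moreover note card_roots_power_le[where 'a = 'a, OF card_subfield_ge_2[OF assms]]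
  ultimately show ?thesis by (metis card_subset_eq card_mono le_antisym)
qed

text \<open>As polynomials in x both sides are monic of degree \<open>card F\<close> and agree on
  \<open>F\<close>, so their difference has more roots than its degree allows. Modulo a prime ideal,
  the formula detects through x^q - x alone whether x is congruent to an element of
  \<open>F\<close>.\<close>

lemma finite_subfield_prod_diff:
  fixes F :: "'a::field set"
  assumes "is_subfield F" "finite F"
  shows "(\<Prod>a\<in>F. x - a) = x ^ card F - x"
proof -
  define n where "n = card F"
  have n: "n \<ge> 2" using card_subfield_ge_2[OF assms] by (simp add: n_def)
  define p :: "'a poly" where "p = (\<Prod>a\<in>F. [:-a, 1:]) - (monom 1 n - [:0,1:])"
  have root: "poly p a = 0" if "a \<in> F" for a
    using that assms finite_subfield_fermat[OF assms that]
    by (auto simp: p_def poly_prod poly_monom prod_zero_iff n_def)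
  have dp: "degree (\<Prod>a\<in>F. [:-a, 1:]) = n" by (subst degree_prod_eq_sum_degree) (auto simp: n_def)
  have "degree p < n \<or> p = 0"
  proof -
    have "coeff p n = 0"
    proof -
      have "coeff (\<Prod>a\<in>F. [:-a, 1:]) n = lead_coeff (\<Prod>a\<in>F. [:-a, 1:])" by (simp add: dp)
      also have "\<dots> = 1" by (subst lead_coeff_prod) auto
      finally show ?thesis using n by (auto simp: p_def coeff_pCons split: nat.splits)
    qed
    moreover have "degree p \<le> n" unfolding p_def using n
      by (intro degree_diff_le) (auto simp: dp intro: degree_monom_le)
    ultimately show ?thesis using n by (metis eq_zero_or_degree_less)
  qed
  moreover have "p = 0" if "degree p < n"
  proof (rule ccontr)
    assume p0: "p \<noteq> 0"
    have "n \<le> card {x. poly p x = 0}" unfolding n_def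
      using root by (intro card_mono poly_roots_finite p0) auto
    also have "\<dots> \<le> degree p" by (rule card_poly_roots_bound[OF p0])
    finally show False using that by simp
  qed
  ultimately have "p = 0" by blast
  hence "poly p x = 0" by simp
  thus ?thesis by (simp add: p_def poly_prod poly_monom n_def)
qed

text \<open>A zero discriminant forces a double root in \<open>F\<close>. It is t/2 if 2 is
  invertible; in characteristic two, t = 0 and -d has a square root, because squaring is injective
  on the finite set \<open>F\<close>.\<close>

lemma finite_subfield_no_root_discriminant:
  fixes F :: "'a::field set"
  assumes F: "is_subfield F" "finite F" and td: "t \<in> F" "d \<in> F"
    and no_root: "\<And>a. a \<in> F \<Longrightarrow> a^2 - t * a + d \<noteq> 0"
  shows "t^2 - 4 * d \<noteq> 0"
proof
  assume D: "t^2 - 4 * d = 0"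
  show False
  proof (cases "(2::'a) = 0")
    case False
    define u where "u = t / 2"
    have t: "t = 2 * u" using False by (simp add: u_def)
    have "2 * 2 * (u^2 - t * u + d) = - (t^2 - 4 * d)"
      by (simp add: t power2_eq_square algebra_simps)
    hence "2 * (2 * (u^2 - t * u + d)) = 0" using D by (metis minus_zero mult.assoc)
    hence "u^2 - t * u + d = 0" using False by (metis mult_eq_0_iff)
    hence "(t/2)^2 - t * (t/2) + d = 0" by (simp add: u_def)
    thus False using no_root[of "t/2"] F td by (auto intro: is_subfield_intros)
  next
    case True
    hence "(4::'a) = 0" by (metis mult_zero_left mult_2 numeral_Bit0)
    hence t: "t = 0" using D by simp
    have "inj_on (\<lambda>a. a^2) F"
    proof (rule inj_onI)
      fix a b :: 'a assume "a\<^sup>2 = b\<^sup>2"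
      hence "(a - b)^2 = 0" using True by (simp add: power2_eq_square algebra_simps)
      thus "a = b" by simp
    qed
    moreover have "(\<lambda>a. a^2) ` F \<subseteq> F" using F by (auto intro: is_subfield_intros)
    ultimately have "(\<lambda>a. a^2) ` F = F" using F by (simp add: endo_inj_surj)
    moreover have "- d \<in> F" using F td by (auto intro: is_subfield_intros)
    ultimately obtain a where "a \<in> F" "a^2 = - d" by (metis imageE)
    thus False using no_root[of a] t by simp
  qed
qed

text \<open>Pigeonhole: the squares, and the values c - s y for y a square, are two subsets of
  \<open>F\<close> each containing more than half of its elements, so they meet.\<close>

lemma finite_subfield_sum_two_squares:
  fixes F :: "'a::field set"
  assumes F: "is_subfield F" "finite F" and s: "s \<in> F" "s \<noteq> 0" and c: "c \<in> F"
  shows "\<exists>a\<in>F. \<exists>b\<in>F. a^2 + s * b^2 = c"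
proof -
  define Q where "Q = (\<lambda>a. a^2) ` F"
  have QF: "Q \<subseteq> F" using F by (auto simp: Q_def intro: is_subfield_intros)
  have Q: "2 * card Q \<ge> card F + 1"
  proof -
    have "card (F - {0}) \<le> card ((Q - {0}) \<times> {True, False})"
    proof -
      \<comment> \<open>A nonzero element is recovered from its square and a bit telling whether it
        is the root selected by choice. This bounds \<open>card F - 1\<close> by twice the number of
        nonzero squares.\<close>
      define g where "g a = (a^2, a = (SOME r. r^2 = a^2))" for a :: 'a
      have "inj_on g (F - {0})"
      proof (rule inj_onI)
        fix a b assume "g a = g b"
        hence ab: "a^2 = b^2" "(a = (SOME r. r^2 = a^2)) = (b = (SOME r. r^2 = b^2))"
          by (auto simp: g_def)
        define r where "r = (SOME r. r^2 = a^2)"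
        have r: "r^2 = a^2" unfolding r_def by (rule someI) simp
        from ab have iff: "(a = r) = (b = r)" by (simp add: r_def)
        have "a = r \<or> a = - r" "b = r \<or> b = - r" using r ab(1) by (auto simp: power2_eq_iff)
        thus "a = b" using iff by auto
      qed
      moreover have "g ` (F - {0}) \<subseteq> (Q - {0}) \<times> {True, False}" by (auto simp: g_def Q_def)
      moreover have "finite ((Q - {0}) \<times> {True, False})" using F by (auto simp: Q_def)
      ultimately show ?thesis by (rule card_inj_on_le)
    qed
    moreover have "0 \<in> F" "0 \<in> Q" using F by (auto simp: Q_def image_iff intro!: is_subfield_intros bexI[of _ 0])
    moreover have "finite Q" using F by (simp add: Q_def)
    ultimately have "card F - 1 \<le> (card Q - 1) * 2" using F by (simp add: card_cartesian_product)
    moreover have "card Q \<ge> 1" using \<open>0 \<in> Q\<close> \<open>finite Q\<close> by (metis One_nat_def Suc_leI card_gt_0_iff empty_iff)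
    ultimately show ?thesis by linarith
  qed
  define T where "T = (\<lambda>y. c - s * y) ` Q"
  have TF: "T \<subseteq> F" using F s c QF by (auto simp: T_def intro!: is_subfield_intros)
  have cT: "card T = card Q" unfolding T_def using s by (intro card_image inj_onI) auto
  have "Q \<inter> T \<noteq> {}"
  proof
    assume "Q \<inter> T = {}"
    hence "card (Q \<union> T) = card Q + card T" using QF TF F by (meson card_Un_disjoint finite_subset)
    moreover have "card (Q \<union> T) \<le> card F" using QF TF F by (intro card_mono) auto
    ultimately show False using Q cT by linarith
  qed
  then obtain a b where "a \<in> F" "b \<in> F" "a^2 = c - s * b^2" by (auto simp: Q_def T_def)
  thus ?thesis by (intro bexI[of _ a] bexI[of _ b]) auto
qed

text \<open>The form is the norm of a + b \<epsilon> for a root \<epsilon> of X^2 - t X + d.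
  Completing the square reduces it to a^2 + s b^2; in characteristic two a sum of two squares is
  itself a square, and the second variable can be taken to be 0.\<close>

lemma finite_subfield_norm_form_surj:
  fixes F :: "'a::field set"
  assumes F: "is_subfield F" "finite F" and td: "t \<in> F" "d \<in> F" "t^2 - 4 * d \<noteq> 0" and c: "c \<in> F"
  shows "\<exists>a\<in>F. \<exists>b\<in>F. a^2 + t * a * b + d * b^2 = c"
proof (cases "(2::'a) = 0")
  case False
  define s where "s = - (t^2 - 4 * d) / 4"
  have 4: "(4::'a) \<noteq> 0" using False by (metis mult_2 mult_eq_0_iff numeral_Bit0)
  have s: "s \<in> F" "s \<noteq> 0" using F td 4 by (auto simp: s_def intro!: is_subfield_intros)
  obtain a b where ab: "a \<in> F" "b \<in> F" "a^2 + s * b^2 = c"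
    using finite_subfield_sum_two_squares[OF F s c] by blast
  define u where "u = t / 2"
  have t: "t = 2 * u" using False by (simp add: u_def)
  have "4 * s = - (t^2 - 4 * d)" unfolding s_def using 4 by simp
  also have "\<dots> = 4 * (d - u^2)" by (simp add: t power2_eq_square algebra_simps)
  finally have "4 * s = 4 * (d - u^2)" .
  hence s_eq: "s = d - u^2" using 4 by (metis mult_left_cancel)
  have "(a - t/2 * b)^2 + t * (a - t/2 * b) * b + d * b^2 = a^2 + s * b^2"
    unfolding u_def[symmetric] s_eq by (simp add: t power2_eq_square algebra_simps)
  moreover have "a - t/2 * b \<in> F" using F td ab by (auto intro!: is_subfield_intros)
  ultimately show ?thesis using ab by (metis)
next
  case True
  obtain a b where ab: "a \<in> F" "b \<in> F" "a^2 + 1 * b^2 = c"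
    using finite_subfield_sum_two_squares[OF F, of 1 c] F c by (auto intro: is_subfield_intros)
  have "(a + b)^2 = a^2 + b^2 + 2 * a * b" by (simp add: power2_eq_square algebra_simps)
  hence "(a + b)^2 + t * (a + b) * 0 + d * 0^2 = c" using ab True by simp
  moreover have "a + b \<in> F" "0 \<in> F" using F ab by (auto intro: is_subfield_intros)
  ultimately show ?thesis by metis
qed

text \<open>The map a to a^2 - a takes the value 0 at 0 and at 1, so it is not surjective on the
  finite set \<open>F\<close>. Unlike X^2 - c, the shape X^2 - X - c gives an irreducible quadratic
  in every characteristic.\<close>

lemma finite_subfield_artin_schreier_no_root:
  fixes F :: "'a::field set"
  assumes F: "is_subfield F" "finite F"
  shows "\<exists>c\<in>F. \<forall>a\<in>F. a^2 - a - c \<noteq> 0"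
proof (rule ccontr)
  assume "\<not> ?thesis"
  hence "F \<subseteq> (\<lambda>a. a^2 - a) ` F" by fastforce
  hence "inj_on (\<lambda>a. a^2 - a) F" using F finite_surj_inj by blast
  moreover have "0 \<in> F" "1 \<in> F" using F by (auto intro: is_subfield_intros)
  ultimately show False unfolding inj_on_def by force
qed

subsection \<open>Places\<close>

definition is_subring :: "'a::comm_ring_1 set \<Rightarrow> bool" where
  "is_subring R \<longleftrightarrow> 1 \<in> R \<and> (\<forall>x\<in>R. \<forall>y\<in>R. x + y \<in> R \<and> x - y \<in> R \<and> x * y \<in> R)"

lemma is_subring_1: "is_subring R \<Longrightarrow> 1 \<in> R"
  and is_subring_add: "is_subring R \<Longrightarrow> x \<in> R \<Longrightarrow> y \<in> R \<Longrightarrow> x + y \<in> R"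
  and is_subring_diff: "is_subring R \<Longrightarrow> x \<in> R \<Longrightarrow> y \<in> R \<Longrightarrow> x - y \<in> R"
  and is_subring_mult: "is_subring R \<Longrightarrow> x \<in> R \<Longrightarrow> y \<in> R \<Longrightarrow> x * y \<in> R"
  by (auto simp: is_subring_def)

lemma is_subring_0: "is_subring R \<Longrightarrow> 0 \<in> R"
  using is_subring_diff[of R 1 1] is_subring_1 by auto

lemma is_subring_uminus: "is_subring R \<Longrightarrow> x \<in> R \<Longrightarrow> - x \<in> R"
  using is_subring_diff[of R 0 x] is_subring_0 by auto

lemma is_subring_power: "is_subring R \<Longrightarrow> x \<in> R \<Longrightarrow> x ^ n \<in> R"
  by (induction n) (auto intro: is_subring_mult is_subring_1)

lemma is_subring_sum: "is_subring R \<Longrightarrow> (\<And>i. i \<in> I \<Longrightarrow> f i \<in> R) \<Longrightarrow> sum f I \<in> R"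
  by (induction I rule: infinite_finite_induct) (auto intro: is_subring_add is_subring_0)

lemmas is_subring_intros =
  is_subring_1 is_subring_add is_subring_diff is_subring_mult is_subring_0 is_subring_uminus
  is_subring_power is_subring_sum

lemma is_subfield_imp_is_subring: "is_subfield S \<Longrightarrow> is_subring S"
  by (auto simp: is_subfield_def is_subring_def)

definition polys_over :: "'a::comm_ring_1 set \<Rightarrow> 'a poly set" where
  "polys_over R = {p. \<forall>i. coeff p i \<in> R}"

lemma is_subring_polys_over:
  assumes "is_subring R"
  shows "is_subring (polys_over R)"
proof -
  have "coeff 1 i \<in> R" for i using assms by (cases i) (auto intro: is_subring_0 is_subring_1)
  hence "1 \<in> polys_over R" by (simp add: polys_over_def)
  moreover have "p + q \<in> polys_over R \<and> p - q \<in> polys_over R \<and> p * q \<in> polys_over R"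
    if "p \<in> polys_over R" "q \<in> polys_over R" for p q
    using that assms unfolding polys_over_def
    by (auto simp: coeff_mult intro!: is_subring_add is_subring_diff is_subring_mult is_subring_sum)
  ultimately show ?thesis unfolding is_subring_def by blast
qed

lemma pCons_in_polys_over: "is_subring R \<Longrightarrow> c \<in> R \<Longrightarrow> p \<in> polys_over R \<Longrightarrow> pCons c p \<in> polys_over R"
  by (auto simp: polys_over_def coeff_pCons split: nat.splits)

lemma poly_in_subring:
  "is_subring R \<Longrightarrow> p \<in> polys_over R \<Longrightarrow> x \<in> R \<Longrightarrow> poly p x \<in> R"
  unfolding poly_altdef polys_over_def
  by (intro is_subring_sum is_subring_mult is_subring_power) auto

lemma const_in_polys_over: "is_subring R \<Longrightarrow> c \<in> R \<Longrightarrow> [:c:] \<in> polys_over R"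
  by (auto simp: polys_over_def coeff_pCons is_subring_0 split: nat.splits)

lemma linear_in_polys_over: "is_subring R \<Longrightarrow> a \<in> R \<Longrightarrow> b \<in> R \<Longrightarrow> [:a, b:] \<in> polys_over R"
  by (intro pCons_in_polys_over const_in_polys_over)

lemma pcompose_in_polys_over:
  assumes R: "is_subring R" and "p \<in> polys_over R" and f: "f \<in> polys_over R"
  shows "pcompose p f \<in> polys_over R"
  using assms(2)
proof (induction p)
  case 0
  show ?case using R by (simp add: polys_over_def is_subring_0)
next
  case (pCons c p)
  have coeffs: "coeff (pCons c p) i \<in> R" for i using pCons.prems by (simp add: polys_over_def)
  have "c \<in> R" using coeffs[of 0] by simp
  moreover have "p \<in> polys_over R"
  proof -
    have "coeff p i \<in> R" for i using coeffs[of "Suc i"] by simp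
    thus ?thesis by (simp add: polys_over_def)
  qed
  moreover note P = is_subring_polys_over[OF R]
  ultimately show ?case unfolding pcompose_pCons
    by (intro is_subring_add[OF P] is_subring_mult[OF P] const_in_polys_over R f pCons.IH)
qed

lemma is_subring_adjoin:
  assumes "is_subring R"
  shows "is_subring ((\<lambda>p. poly p y) ` polys_over R)"
proof -
  note P = is_subring_polys_over[OF assms]
  show ?thesis unfolding is_subring_def
  proof (intro conjI ballI)
    show "1 \<in> (\<lambda>p. poly p y) ` polys_over R"
      using is_subring_1[OF P] by (intro image_eqI[where x = 1]) auto
  next
    fix u v assume "u \<in> (\<lambda>p. poly p y) ` polys_over R" "v \<in> (\<lambda>p. poly p y) ` polys_over R"
    then obtain p q where pq: "p \<in> polys_over R" "q \<in> polys_over R" "u = poly p y" "v = poly q y"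
      by auto
    show "u + v \<in> (\<lambda>p. poly p y) ` polys_over R"
      using is_subring_add[OF P pq(1,2)] pq by (intro image_eqI[where x = "p + q"]) auto
    show "u - v \<in> (\<lambda>p. poly p y) ` polys_over R"
      using is_subring_diff[OF P pq(1,2)] pq by (intro image_eqI[where x = "p - q"]) auto
    show "u * v \<in> (\<lambda>p. poly p y) ` polys_over R"
      using is_subring_mult[OF P pq(1,2)] pq by (intro image_eqI[where x = "p * q"]) auto
  qed
qed

text \<open>A subring that is maximal among those not containing \<open>inverse x\<close> is a valuation ring. The
  reduction step is that two relations \<open>1 \<in> x R[y]\<close> and \<open>1 \<in> x R[inverse y]\<close> can be combined to
  lower the degree of the longer one.\<close>

lemma maximal_subring_valuation:
  fixes x :: "'a::field"
  assumes R: "is_subring R" and x: "x \<in> R" "x \<noteq> 0" "inverse x \<notin> R"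
    and maximal: "\<And>S. is_subring S \<Longrightarrow> R \<subseteq> S \<Longrightarrow> inverse x \<notin> S \<Longrightarrow> S = R"
  shows "y \<in> R \<or> inverse y \<in> R"
proof -
  \<comment> \<open>\<open>rel y n\<close> says that 1 lies in x R[y], witnessed by a polynomial of
    degree at most n.\<close>
  define rel where "rel y n \<longleftrightarrow> (\<exists>c. (\<forall>i. c i \<in> R) \<and> x * (\<Sum>i\<le>n. c i * y ^ i) = 1)" for y and n :: nat
  \<comment> \<open>If y is not in \<open>R\<close>, then R[y] is strictly larger than
    \<open>R\<close>, so by maximality it contains \<open>inverse x\<close>.\<close>
  have ex_rel: "\<exists>n. rel y n" if "y \<notin> R" for y
  proof -
    define S where "S = (\<lambda>p. poly p y) ` polys_over R"
    have S: "is_subring S" unfolding S_def using R by (rule is_subring_adjoin)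
    have RS: "R \<subseteq> S"
    proof
      fix r assume "r \<in> R"
      thus "r \<in> S" unfolding S_def using R
        by (intro image_eqI[where x = "[:r:]"]) (auto intro: const_in_polys_over)
    qed
    have "y \<in> S" unfolding S_def using R
      by (intro image_eqI[where x = "[:0,1:]"]) (auto intro: linear_in_polys_over is_subring_intros)
    hence "inverse x \<in> S" using maximal[OF S RS] that by auto
    then obtain p where p: "p \<in> polys_over R" "inverse x = poly p y" by (auto simp: S_def)
    have "x * (\<Sum>i\<le>degree p. coeff p i * y ^ i) = x * inverse x"
      by (simp add: p(2) poly_altdef)
    hence "x * (\<Sum>i\<le>degree p. coeff p i * y ^ i) = 1"
      using x by simp
    thus ?thesis using p by (auto simp: rel_def polys_over_def)
  qed
  have no_rel_0: "\<not> rel y 0" for y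
    using x by (auto simp: rel_def) (metis inverse_unique)
  \<comment> \<open>If \<open>inverse v\<close> were not in \<open>R\<close>, its relation
    multiplied by v^n would put v^n into x R. But v^n is 1 modulo x R, so 1 would lie in x
    R.\<close>
  have unit: "1 - x * r \<noteq> 0 \<and> inverse (1 - x * r) \<in> R" if r: "r \<in> R" for r
  proof -
    define v where "v = 1 - x * r"
    have v0: "v \<noteq> 0" using x r by (auto simp: v_def) (metis inverse_unique)
    have vR: "v \<in> R" using R x r by (auto simp: v_def intro: is_subring_intros)
    have "inverse v \<in> R"
    proof (rule ccontr)
      assume "inverse v \<notin> R"
      then obtain n c where c: "\<And>i. c i \<in> R" "x * (\<Sum>i\<le>n. c i * inverse v ^ i) = 1"
        using ex_rel[of "inverse v"] by (auto simp: rel_def)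
      define s where "s = (\<Sum>i\<le>n. c i * v ^ (n - i))"
      have sR: "s \<in> R" using R c vR by (auto simp: s_def intro!: is_subring_intros)
      have "v ^ n * (\<Sum>i\<le>n. c i * inverse v ^ i) = s"
        unfolding s_def sum_distrib_left
        by (rule sum.cong) (use v0 in \<open>auto simp: power_diff field_simps\<close>)
      hence vn: "v ^ n = x * s" using c(2) by (metis mult.left_commute mult.right_neutral)
      have "\<exists>r'\<in>R. v ^ k = 1 - x * r'" for k
      proof (induction k)
        case 0 show ?case using is_subring_0[OF R] by auto
      next
        case (Suc k)
        then obtain r' where r': "r' \<in> R" "v ^ k = 1 - x * r'" by auto
        have "v ^ Suc k = (1 - x * r) * (1 - x * r')" by (simp add: r'(2)) (simp add: v_def)
        also have "\<dots> = 1 - x * (r + r' - x * r * r')" by (simp add: algebra_simps)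
        finally have "v ^ Suc k = 1 - x * (r + r' - x * r * r')" .
        thus ?case using R r r' x by (auto intro!: bexI[of _ "r + r' - x * r * r'"] is_subring_intros)
      qed
      then obtain r' where r': "r' \<in> R" "v ^ n = 1 - x * r'" by blast
      hence "x * (s + r') = 1" using vn by (simp add: algebra_simps)
      hence "inverse x = s + r'" by (rule inverse_unique)
      thus False using x R sR r' by (auto intro: is_subring_intros)
    qed
    thus ?thesis using v0 by (simp add: v_def)
  qed
  \<comment> \<open>In the relation for z, x times the terms of positive degree is the unit 1 - x
    d_0. Multiplied by y^n this expresses y^n through lower powers of y, because m \<le> n, and the
    top term of the relation for y can be replaced.\<close>
  have reduce: "rel y (n - 1)" if mn: "1 \<le> m" "m \<le> n" and yz: "y * z = 1"
    and "rel y n" "rel z m" for y z m n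
  proof -
    from that obtain c d where c: "\<And>i. c i \<in> R" "x * (\<Sum>i\<le>n. c i * y ^ i) = 1"
      and d: "\<And>i. d i \<in> R" "x * (\<Sum>i\<le>m. d i * z ^ i) = 1" by (auto simp: rel_def)
    define v where "v = 1 - x * d 0"
    have v: "v \<noteq> 0" "inverse v \<in> R" using unit[OF d(1)] by (auto simp: v_def)
    have "(\<Sum>i\<le>m. d i * z ^ i) = d 0 + (\<Sum>i\<in>{1..m}. d i * z ^ i)"
      by (simp add: sum.atMost_shift sum.atLeast1_atMost_eq)
    hence veq: "v = x * (\<Sum>i\<in>{1..m}. d i * z ^ i)" using d(2) by (simp add: v_def algebra_simps)
    have "y ^ n * z ^ i = y ^ (n - i)" if "i \<le> n" for i
    proof -
      have "y ^ n = y ^ (n - i) * y ^ i" using that by (simp flip: power_add)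
      hence "y ^ n * z ^ i = y ^ (n - i) * (y ^ i * z ^ i)" by (simp add: mult.assoc)
      thus ?thesis by (simp add: yz flip: power_mult_distrib)
    qed
    hence "y ^ n * (\<Sum>i\<in>{1..m}. d i * z ^ i) = (\<Sum>i\<in>{1..m}. d i * y ^ (n - i))"
      unfolding sum_distrib_left using mn by (intro sum.cong) (auto simp: mult.left_commute)
    hence "y ^ n * v = x * (\<Sum>i\<in>{1..m}. d i * y ^ (n - i))"
      by (subst veq) (simp add: mult.left_commute)
    hence yn: "y ^ n = inverse v * x * (\<Sum>i\<in>{1..m}. d i * y ^ (n - i))"
      using v(1) by (simp add: divide_simps)
    also have "(\<Sum>i\<in>{1..m}. d i * y ^ (n - i)) = (\<Sum>i\<in>{n-m..n-1}. d (n - i) * y ^ i)"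
      using mn by (intro sum.reindex_bij_witness[where i = "\<lambda>i. n - i" and j = "\<lambda>i. n - i"]) auto
    also have "\<dots> = (\<Sum>i\<in>{..n-1}. (if n - m \<le> i then d (n - i) else 0) * y ^ i)"
      by (intro sum.mono_neutral_cong_left) auto
    finally have yn': "y ^ n = inverse v * x * (\<Sum>i\<in>{..n-1}. (if n - m \<le> i then d (n - i) else 0) * y ^ i)" .
    define c' where "c' i = c i + c n * (inverse v * x * (if n - m \<le> i then d (n - i) else 0))" for i
    have "c' i \<in> R" for i using R x c(1) d(1) v by (auto simp: c'_def intro!: is_subring_intros)
    moreover have "x * (\<Sum>i\<le>n-1. c' i * y ^ i) = 1"
    proof -
      have "(\<Sum>i\<le>n-1. c' i * y ^ i) = (\<Sum>i\<le>n-1. c i * y ^ i) + c n * y ^ n"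
        by (subst yn') (simp add: c'_def ring_distribs sum.distrib sum_distrib_left mult.assoc)
      also have "\<dots> = (\<Sum>i\<le>n. c i * y ^ i)" using mn by (cases n) auto
      finally show ?thesis using c by simp
    qed
    ultimately show ?thesis by (auto simp: rel_def)
  qed
  have no_rel: "y * z = 1 \<Longrightarrow> rel y n \<Longrightarrow> rel z m \<Longrightarrow> False" for y z m n
  proof (induction "n + m" arbitrary: n m y z rule: less_induct)
    case less
    have nm: "n \<ge> 1" "m \<ge> 1" using less.prems no_rel_0 by (metis less_one not_le)+
    show ?case
    proof (cases "m \<le> n")
      case True
      show ?thesis
        by (rule less.hyps[of "n - 1" m y z]) (use nm less.prems True reduce[of m n y z] in auto)
    next
      case False
      show ?thesis
        by (rule less.hyps[of n "m - 1" y z])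
           (use nm less.prems False reduce[of n m z y] in \<open>auto simp: mult.commute\<close>)
    qed
  qed
  show ?thesis
  proof (rule ccontr)
    assume neg: "\<not> ?thesis"
    then obtain n m where "rel y n" "rel (inverse y) m" using ex_rel by blast
    moreover have "y \<noteq> 0" using neg is_subring_0[OF R] by auto
    ultimately show False using no_rel[of y "inverse y"] by auto
  qed
qed

text \<open>By Zorn's lemma there is a maximal subring that contains \<open>F\<close> and x but not
  \<open>inverse x\<close>. It is a valuation ring in which x is not a unit. Transcendence of x
  keeps \<open>inverse x\<close> out of F[x], so the family of such subrings is nonempty.\<close>

lemma exists_place_zero:
  fixes F :: "'k::field set"
  assumes F: "is_subfield F" and x: "\<not> algebraic_over F x"
  shows "\<exists>W. is_place F W \<and> x \<in> vr_ideal W"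
proof -
  have FR: "is_subring F" using F by (rule is_subfield_imp_is_subring)
  have algI: "algebraic_over F x" if "p \<noteq> 0" "p \<in> polys_over F" "poly p x = 0" for p
    using that by (auto simp: algebraic_over_def polys_over_def)
  have x0: "x \<noteq> 0"
    using algI[of "[:0,1:]"] x linear_in_polys_over[OF FR is_subring_0[OF FR] is_subring_1[OF FR]] by auto
  define \<A> where "\<A> = {R. is_subring R \<and> F \<subseteq> R \<and> x \<in> R \<and> inverse x \<notin> R}"
  define R0 where "R0 = (\<lambda>p. poly p x) ` polys_over F"
  have "F \<subseteq> R0"
  proof
    fix r assume "r \<in> F"
    thus "r \<in> R0" unfolding R0_def using FR
      by (intro image_eqI[where x = "[:r:]"]) (auto intro: const_in_polys_over)
  qed
  moreover have "x \<in> R0" unfolding R0_def using FR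
      by (intro image_eqI[where x = "[:0,1:]"]) (auto intro: linear_in_polys_over is_subring_intros)
  moreover have "inverse x \<notin> R0"
  proof
    assume "inverse x \<in> R0"
    then obtain p where p: "p \<in> polys_over F" "inverse x = poly p x" by (auto simp: R0_def)
    have "poly (pCons (-1) p) x = 0" using p x0 by (simp flip: p(2))
    moreover have "pCons (-1) p \<in> polys_over F"
      using FR p by (intro pCons_in_polys_over is_subring_uminus is_subring_1)
    ultimately show False using algI x by (metis neg_equal_0_iff_equal one_neq_zero pCons_eq_0_iff)
  qed
  ultimately have "R0 \<in> \<A>" using is_subring_adjoin[OF FR] by (auto simp: \<A>_def R0_def)
  moreover have "\<Union>C \<in> \<A>" if C: "C \<noteq> {}" "subset.chain \<A> C" for C
  proof -
    have CA: "\<And>R. R \<in> C \<Longrightarrow> R \<in> \<A>" using C by (auto simp: subset.chain_def)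
    have two: "\<exists>R\<in>C. a \<in> R \<and> b \<in> R" if ab: "a \<in> \<Union>C" "b \<in> \<Union>C" for a b
    proof -
      from ab obtain R S where RS: "R \<in> C" "a \<in> R" "S \<in> C" "b \<in> S" by auto
      hence "R \<subseteq> S \<or> S \<subseteq> R" using C(2) unfolding subset.chain_def by blast
      thus ?thesis using RS by blast
    qed
    have "is_subring (\<Union>C)" unfolding is_subring_def
    proof (intro conjI ballI)
      show "1 \<in> \<Union>C" using C CA by (auto simp: \<A>_def dest: is_subring_1)
    next
      fix a b assume "a \<in> \<Union>C" "b \<in> \<Union>C"
      then obtain R where "R \<in> C" "a \<in> R" "b \<in> R" using two by blast
      moreover have "is_subring R" using CA \<open>R \<in> C\<close> by (auto simp: \<A>_def)
      ultimately show "a + b \<in> \<Union>C" "a - b \<in> \<Union>C" "a * b \<in> \<Union>C"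
        by (blast intro: is_subring_intros)+
    qed
    thus ?thesis using C CA unfolding \<A>_def by blast
  qed
  ultimately obtain W where W: "W \<in> \<A>" and max: "\<And>S. S \<in> \<A> \<Longrightarrow> W \<subseteq> S \<Longrightarrow> S = W"
    using subset_Zorn_nonempty[of \<A>] by (metis empty_iff)
  have val: "y \<in> W \<or> inverse y \<in> W" for y
    by (rule maximal_subring_valuation[of W x]) (use W x0 max in \<open>auto simp: \<A>_def\<close>)
  have "x \<notin> F"
  proof
    assume "x \<in> F"
    hence "[:-x, 1:] \<in> polys_over F" using FR by (intro linear_in_polys_over is_subring_intros)
    thus False using algI[of "[:-x,1:]"] x by simp
  qed
  hence "is_place F W" using W val unfolding is_place_def \<A>_def is_subring_def by blast
  moreover have "x \<in> vr_ideal W" using W by (auto simp: vr_ideal_def vr_units_def \<A>_def)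
  ultimately show ?thesis by blast
qed

section \<open>The maximal ideal of a place\<close>

locale place =
  fixes F V :: "'k::field set"
  assumes F_subfield: "is_subfield F" and F_finite: "finite F" and V_place: "is_place F V"
begin

abbreviation "m \<equiv> vr_ideal V"

lemma V_subring: "is_subring V"
proof -
  have "1 \<in> V" using V_place is_subfield_1[OF F_subfield] by (auto simp: is_place_def)
  thus ?thesis using V_place by (simp add: is_place_def is_subring_def)
qed

lemma V_cases: "x \<in> V \<or> inverse x \<in> V"
  using V_place by (auto simp: is_place_def)

lemma F_subset_V: "F \<subseteq> V" using V_place by (auto simp: is_place_def)

lemma F_subring: "is_subring F"
  using F_subfield by (rule is_subfield_imp_is_subring)

lemma ideal_iff: "x \<in> m \<longleftrightarrow> x = 0 \<or> inverse x \<notin> V"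
  using V_cases[of x] is_subring_0[OF V_subring] by (auto simp: vr_ideal_def vr_units_def)

lemma ideal_subset: "m \<subseteq> V" by (auto simp: vr_ideal_def)

lemma ideal_0: "0 \<in> m" by (simp add: ideal_iff)

lemma one_notin_ideal: "1 \<notin> m" using is_subring_1[OF V_subring] by (simp add: ideal_iff)

lemma ideal_mult: assumes "x \<in> V" "y \<in> m" shows "x * y \<in> m"
proof (cases "x * y = 0")
  case False
  have "inverse (x * y) \<notin> V"
  proof
    assume "inverse (x * y) \<in> V"
    hence "x * inverse (x * y) \<in> V" using assms V_subring by (blast intro: is_subring_mult)
    moreover have "x * inverse (x * y) = inverse y" using False by (auto simp: mult.assoc[symmetric])
    ultimately have "inverse y \<in> V" by metis
    thus False using assms False by (simp add: ideal_iff)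
  qed
  thus ?thesis by (simp add: ideal_iff)
qed (auto simp: ideal_0)

lemma ideal_mult': "x \<in> m \<Longrightarrow> y \<in> V \<Longrightarrow> x * y \<in> m"
  using ideal_mult[of y x] by (simp add: mult.commute)

lemma ideal_uminus: "x \<in> m \<Longrightarrow> - x \<in> m"
  using ideal_mult[of "-1" x] V_subring by (auto intro: is_subring_intros)

lemma ideal_add: assumes "x \<in> m" "y \<in> m" shows "x + y \<in> m"
proof -
  have *: "x + y \<in> m" if "x \<in> m" "y \<in> m" "y \<noteq> 0" "x / y \<in> V" for x y
  proof -
    have "1 + x / y \<in> V" using that V_subring by (auto intro: is_subring_intros)
    hence "(1 + x / y) * y \<in> m" using that by (intro ideal_mult)
    moreover have "(1 + x / y) * y = x + y" using that by (simp add: distrib_right)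
    ultimately show ?thesis by metis
  qed
  show ?thesis
  proof (cases "x = 0 \<or> y = 0")
    case False
    have "x / y \<in> V \<or> y / x \<in> V" using V_cases[of "x / y"] by simp
    thus ?thesis using *[of x y] *[of y x] False assms by (auto simp: add.commute)
  qed (use assms in auto)
qed

lemma ideal_diff: "x \<in> m \<Longrightarrow> y \<in> m \<Longrightarrow> x - y \<in> m"
  using ideal_add[of x "- y"] ideal_uminus by simp

lemma ideal_sum: "(\<And>i. i \<in> I \<Longrightarrow> f i \<in> m) \<Longrightarrow> sum f I \<in> m"
  by (induction I rule: infinite_finite_induct) (auto intro: ideal_add ideal_0)

lemma ideal_prime: assumes "x \<in> V" "y \<in> V" "x * y \<in> m" shows "x \<in> m \<or> y \<in> m"
proof (rule ccontr)
  assume "\<not> ?thesis"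
  hence xy: "x \<noteq> 0" "y \<noteq> 0" "inverse x \<in> V" "inverse y \<in> V" by (auto simp: ideal_iff)
  hence "inverse (x * y) \<in> V" using is_subring_mult[OF V_subring] by simp
  thus False using assms xy by (simp add: ideal_iff)
qed

lemma ideal_prime_prod:
  assumes "finite I" "\<And>i. i \<in> I \<Longrightarrow> f i \<in> V" "prod f I \<in> m" shows "\<exists>i\<in>I. f i \<in> m"
  using assms
proof (induction I rule: finite_induct)
  case empty thus ?case using one_notin_ideal by simp
next
  case (insert i I)
  have "prod f J \<in> V" if "J \<subseteq> I" for J
    using that insert.prems(1)
    by (induction J rule: infinite_finite_induct) (auto intro: is_subring_1 is_subring_mult V_subring)
  hence "prod f I \<in> V" by blast
  thus ?case using insert ideal_prime[of "f i" "prod f I"] by auto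
qed

lemma F_Int_ideal: assumes "x \<in> F" "x \<in> m" shows "x = 0"
proof -
  have "inverse x \<in> V" using assms F_subfield F_subset_V by (auto intro: is_subfield_intros)
  thus ?thesis using assms by (simp add: ideal_iff)
qed

lemma ideal_nontrivial: "\<exists>z\<in>m. z \<noteq> 0"
proof -
  obtain y where "y \<notin> V" using V_place by (auto simp: is_place_def)
  moreover from this have "y \<noteq> 0" using is_subring_0[OF V_subring] by auto
  ultimately show ?thesis by (intro bexI[of _ "inverse y"]) (auto simp: ideal_iff)
qed

lemma unit_iff: "x \<in> vr_units V \<longleftrightarrow> x \<in> V \<and> x \<notin> m"
  by (auto simp: vr_ideal_def vr_units_def)

lemma poly_in_V: "p \<in> polys_over F \<Longrightarrow> x \<in> V \<Longrightarrow> poly p x \<in> V"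
  by (rule poly_in_subring[OF V_subring]) (use F_subset_V in \<open>auto simp: polys_over_def\<close>)

lemma poly_eq_coeff_0_plus:
  assumes "p \<in> polys_over F" "x \<in> V"
  shows "\<exists>r\<in>V. poly p x = coeff p 0 + x * r"
proof -
  obtain c q where p: "p = pCons c q" by (cases p)
  have "q \<in> polys_over F" unfolding polys_over_def
  proof (intro CollectI allI)
    fix i
    have "coeff p (Suc i) \<in> F" using assms by (auto simp: polys_over_def)
    thus "coeff q i \<in> F" by (simp add: p)
  qed
  hence "poly q x \<in> V" using assms by (intro poly_in_V)
  thus ?thesis by (intro bexI[of _ "poly q x"]) (simp add: p)
qed

lemma poly_diff_coeff_0_in_ideal:
  assumes "p \<in> polys_over F" "x \<in> m"
  shows "poly p x - coeff p 0 \<in> m"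
proof -
  obtain r where "r \<in> V" "poly p x = coeff p 0 + x * r"
    using poly_eq_coeff_0_plus[OF assms(1)] assms(2) ideal_subset by blast
  thus ?thesis using ideal_mult'[OF assms(2)] by simp
qed

end

section \<open>The ring of elements integral outside the place, and its units\<close>

lemma ring_outside_subring:
  assumes "is_subfield F"
  shows "is_subring (ring_outside F V)"
proof -
  have "is_subring W" if "is_place F W" for W
    using that is_subfield_1[OF assms] by (auto simp: is_place_def is_subring_def)
  thus ?thesis unfolding ring_outside_def is_subring_def by simp
qed

lemma F_subset_ring_outside: "F \<subseteq> ring_outside F V"
  by (auto simp: ring_outside_def is_place_def)

text \<open>A function without poles is constant: for a nonconstant x some place W has
  \<open>inverse x\<close> in its ideal, so x has a pole at W. As x lies in \<open>V\<close>, W is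
  different from \<open>V\<close>, which contradicts integrality outside \<open>V\<close>.\<close>

lemma ring_outside_Int_place:
  assumes "function_field F" "is_place F V" "x \<in> ring_outside F V" "x \<in> V"
  shows "x \<in> F"
proof (rule ccontr)
  assume xF: "x \<notin> F"
  have F: "is_subfield F" using assms by (simp add: function_field_def)
  have "\<not> algebraic_over F (inverse x)"
    using assms(1) xF F is_subfield_inverse[of F "inverse x"] by (auto simp: function_field_def)
  then obtain W where W: "is_place F W" "inverse x \<in> vr_ideal W" using exists_place_zero[OF F] by blast
  have x0: "x \<noteq> 0" using xF F is_subfield_0 by auto
  have "x \<notin> W" using W(2) x0 by (auto simp: vr_ideal_def vr_units_def)
  thus False using assms W by (auto simp: ring_outside_def)
qed

text \<open>Either x or its inverse lies in \<open>V\<close> as well and is therefore constant.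
  Consequently the determinants of elements of \<open>GL2 A\<close> are constants.\<close>

lemma ring_outside_unit:
  assumes "function_field F" "is_place F V" "x \<in> ring_outside F V" "inverse x \<in> ring_outside F V"
  shows "x \<in> F"
proof (cases "x \<in> V")
  case True thus ?thesis using assms ring_outside_Int_place by blast
next
  case False
  hence "inverse x \<in> V" using assms(2) by (auto simp: is_place_def)
  hence "inverse x \<in> F" using assms ring_outside_Int_place by blast
  thus ?thesis using assms(1) is_subfield_inverse[of F "inverse x"] by (auto simp: function_field_def)
qed

subsection \<open>Linear dependence over a rational function field\<close>

text \<open>The quotients of polynomials in t form a subfield containing \<open>F\<close> and
  t.\<close>

lemma field_gen_insert_quotient:
  assumes F: "is_subfield F" and x: "x \<in> field_gen (insert t F)"
  shows "\<exists>p\<in>polys_over F. \<exists>s\<in>polys_over F. poly s t \<noteq> 0 \<and> x = poly p t / poly s t"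
proof -
  note FR = is_subfield_imp_is_subring[OF F]
  note P = is_subring_polys_over[OF FR]
  define L where "L = {x. \<exists>p\<in>polys_over F. \<exists>s\<in>polys_over F. poly s t \<noteq> 0 \<and> x = poly p t / poly s t}"
  have LI: "poly p t / poly s t \<in> L" if "p \<in> polys_over F" "s \<in> polys_over F" "poly s t \<noteq> 0" for p s
    using that by (auto simp: L_def)
  have polyL: "poly p t \<in> L" if "p \<in> polys_over F" for p
    using LI[OF that, of 1] is_subring_1[OF P] by simp
  have "is_subfield L"
    unfolding is_subfield_def
  proof (intro conjI ballI)
    show "0 \<in> L" using polyL[of 0] is_subring_0[OF P] by simp
    show "1 \<in> L" using polyL[of 1] is_subring_1[OF P] by simp
  next
    fix x y assume "x \<in> L" "y \<in> L"
    then obtain p s p' s' where *: "p \<in> polys_over F" "s \<in> polys_over F" "poly s t \<noteq> 0" "x = poly p t / poly s t"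
      "p' \<in> polys_over F" "s' \<in> polys_over F" "poly s' t \<noteq> 0" "y = poly p' t / poly s' t"
      by (auto simp: L_def)
    have ss: "s * s' \<in> polys_over F" "poly (s * s') t \<noteq> 0" using * P by (auto intro: is_subring_mult)
    have "x + y = poly (p * s' + p' * s) t / poly (s * s') t"
      using *(3,7) by (simp add: *(4,8) field_simps)
    moreover have "p * s' + p' * s \<in> polys_over F" using * P by (auto intro!: is_subring_mult is_subring_add)
    ultimately show "x + y \<in> L" using LI ss by metis
    have "x - y = poly (p * s' - p' * s) t / poly (s * s') t"
      using *(3,7) by (simp add: *(4,8) field_simps)
    moreover have "p * s' - p' * s \<in> polys_over F" using * P by (auto intro!: is_subring_mult is_subring_diff)
    ultimately show "x - y \<in> L" using LI ss by metis
    have "x * y = poly (p * p') t / poly (s * s') t" using * by simp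
    moreover have "p * p' \<in> polys_over F" using * P by (auto intro!: is_subring_mult)
    ultimately show "x * y \<in> L" using LI ss by metis
  next
    fix x assume "x \<in> L"
    then obtain p s where *: "p \<in> polys_over F" "s \<in> polys_over F" "poly s t \<noteq> 0" "x = poly p t / poly s t"
      by (auto simp: L_def)
    show "inverse x \<in> L"
    proof (cases "poly p t = 0")
      case True thus ?thesis using * polyL[of 0] is_subring_0[OF P] by simp
    next
      case False thus ?thesis using LI[of s p] * by simp
    qed
  qed
  moreover have "insert t F \<subseteq> L"
  proof -
    have "t \<in> L" using polyL[of "[:0,1:]"] linear_in_polys_over[OF FR is_subring_0[OF FR] is_subring_1[OF FR]] by simp
    moreover have "a \<in> L" if "a \<in> F" for a using polyL[of "[:a:]"] const_in_polys_over[OF FR that] by simp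
    ultimately show ?thesis by auto
  qed
  ultimately have "field_gen (insert t F) \<subseteq> L" by (auto simp: field_gen_def)
  thus ?thesis using x by (auto simp: L_def)
qed

lemma common_denominator:
  assumes F: "is_subfield F" and fin: "finite I"
    and c: "\<And>i. i \<in> I \<Longrightarrow> c i \<in> field_gen (insert t F)"
  shows "\<exists>s\<in>polys_over F. \<exists>p. poly s t \<noteq> 0 \<and> (\<forall>i\<in>I. p i \<in> polys_over F \<and> poly s t * c i = poly (p i) t)"
  using fin c
proof (induction I rule: finite_induct)
  case empty
  have "(1 :: 'a poly) \<in> polys_over F"
    using is_subring_1[OF is_subring_polys_over[OF is_subfield_imp_is_subring[OF F]]] .
  thus ?case by (intro bexI[of _ 1]) auto
next
  case (insert j I)
  note P = is_subring_polys_over[OF is_subfield_imp_is_subring[OF F]]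
  from insert obtain s p where s: "s \<in> polys_over F" "poly s t \<noteq> 0"
    and p: "\<And>i. i \<in> I \<Longrightarrow> p i \<in> polys_over F \<and> poly s t * c i = poly (p i) t" by auto
  obtain p' s' where *: "p' \<in> polys_over F" "s' \<in> polys_over F" "poly s' t \<noteq> 0" "c j = poly p' t / poly s' t"
    using field_gen_insert_quotient[OF F insert.prems[of j]] by auto
  define P' where "P' i = (if i = j then s * p' else s' * p i)" for i
  show ?case
  proof (intro bexI[of _ "s * s'"] exI[of _ P'] conjI ballI)
    show "poly (s * s') t \<noteq> 0" "s * s' \<in> polys_over F" using s * P by (auto intro: is_subring_mult)
    fix i assume i: "i \<in> insert j I"
    show "P' i \<in> polys_over F"
      using i s * p P by (auto simp: P'_def intro: is_subring_mult)
    show "poly (s * s') t * c i = poly (P' i) t"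
      using i s * p by (auto simp: P'_def)
  qed
qed

lemma degree_pcompose_mult_le:
  fixes p f r :: "'a::idom poly"
  assumes "degree p < M" "degree r \<le> D"
  shows "degree (pcompose p f * r) < degree f * M + D + 1"
proof -
  have "degree (pcompose p f * r) \<le> degree p * degree f + D"
    using degree_mult_le[of "pcompose p f" r] assms by (simp add: degree_pcompose)
  moreover have "degree p * degree f \<le> degree f * M"
    using assms by (subst mult.commute) (intro mult_left_mono, auto)
  ultimately show ?thesis by linarith
qed

text \<open>The finiteness of \<open>F\<close> allows a pigeonhole argument in place of a dimension count: with
  \<open>M\<close> large, there are more tuples of polynomials of degree less than \<open>M\<close> than values of the
  corresponding linear combinations.\<close>

lemma polynomial_dependence:
  fixes F :: "'k::field set"
  assumes F: "is_subfield F" "finite F" and fin: "finite_over (field_gen (insert t F))"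
  shows "\<exists>n. \<forall>f\<in>polys_over F. \<forall>N > n * degree f. \<forall>y. \<exists>\<phi>. (\<forall>i<N. \<phi> i \<in> polys_over F) \<and>
           (\<exists>i<N. \<phi> i \<noteq> 0) \<and> (\<Sum>i<N. poly (\<phi> i) (poly f t) * y i) = 0"
proof -
  note FR = is_subfield_imp_is_subring[OF F(1)]
  note P = is_subring_polys_over[OF FR]
  obtain B where B: "finite B"
    "\<And>x. \<exists>c. (\<forall>b\<in>B. c b \<in> field_gen (insert t F)) \<and> x = (\<Sum>b\<in>B. c b * b)"
    using fin by (auto simp: finite_over_def)
  show ?thesis
  proof (intro exI[of _ "card B"] ballI allI impI)
    fix f N and y :: "nat \<Rightarrow> 'k"
    assume f: "f \<in> polys_over F" and N: "N > card B * degree f"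
    have "\<exists>c. \<forall>i. (\<forall>b\<in>B. c i b \<in> field_gen (insert t F)) \<and> y i = (\<Sum>b\<in>B. c i b * b)"
      using B(2) by (intro choice allI)
    then obtain c where c: "\<And>i b. b \<in> B \<Longrightarrow> c i b \<in> field_gen (insert t F)"
      and yc: "\<And>i. y i = (\<Sum>b\<in>B. c i b * b)" by blast
    have "\<exists>s\<in>polys_over F. \<exists>p. poly s t \<noteq> 0 \<and> (\<forall>ib\<in>{..<N} \<times> B. p ib \<in> polys_over F \<and>
        poly s t * (case ib of (i, b) \<Rightarrow> c i b) = poly (p ib) t)"
      by (rule common_denominator[OF F(1)]) (use B(1) c in auto)
    then obtain s p where s: "poly s t \<noteq> 0"
      and p': "\<forall>ib\<in>{..<N} \<times> B. p ib \<in> polys_over F \<and> poly s t * (case ib of (i, b) \<Rightarrow> c i b) = poly (p ib) t"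
      by blast
    have p: "\<And>i b. i < N \<Longrightarrow> b \<in> B \<Longrightarrow> p (i, b) \<in> polys_over F \<and> poly s t * c i b = poly (p (i, b)) t"
      using p' by force
    define D where "D = Max (insert 0 ((\<lambda>ib. degree (p ib)) ` ({..<N} \<times> B)))"
    have D: "degree (p (i, b)) \<le> D" if "i < N" "b \<in> B" for i b
      unfolding D_def using that B(1) by (intro Max_ge) auto
    \<comment> \<open>M exceeds card B (D + 1), the part of card B L that does not grow with M. This
      yields N M > card B L: more coefficients to choose than conditions to satisfy.\<close>
    define M where "M = card B * (D + 1) + 1"
    define L where "L = degree f * M + D + 1"
    have NM: "N * M > card B * L"
    proof -
      have "N * M \<ge> (card B * degree f + 1) * M" using N by (intro mult_right_mono) auto
      thus ?thesis by (simp add: L_def M_def algebra_simps)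
    qed
    \<comment> \<open>\<open>a\<close> lists the coefficients of N polynomials of degree below M,
      and \<open>\<Phi> a\<close> those of the coordinates, with respect to \<open>B\<close>, of the
      resulting combination times the common denominator.\<close>
    define \<phi> where "\<phi> a i = (\<Sum>j<M. monom (a (i, j)) j)" for a :: "nat \<times> nat \<Rightarrow> 'k" and i
    define comb where "comb a b = (\<Sum>i<N. pcompose (\<phi> a i) f * p (i, b))" for a b
    define \<Phi> where "\<Phi> a = (\<lambda>(b, l) \<in> B \<times> {..<L}. coeff (comb a b) l)" for a
    define X where "X = ({..<N} \<times> {..<M}) \<rightarrow>\<^sub>E F"
    have \<phi>_coeff: "coeff (\<phi> a i) j = (if j < M then a (i, j) else 0)" for a i j
      by (auto simp: \<phi>_def coeff_sum sum.delta)
    have \<phi>_F: "\<phi> a i \<in> polys_over F" if "a \<in> X" "i < N" for a i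
      using that is_subring_0[OF FR] by (auto simp: polys_over_def \<phi>_coeff X_def)
    have \<phi>_deg: "degree (\<phi> a i) < M" for a i
      using degree_le[of "M - 1" "\<phi> a i"] by (auto simp: \<phi>_coeff M_def)
    have comb_F: "comb a b \<in> polys_over F" if "a \<in> X" "b \<in> B" for a b
      unfolding comb_def using that f p \<phi>_F FR P
      by (intro is_subring_sum is_subring_mult pcompose_in_polys_over) auto
    have comb_deg: "degree (comb a b) < L" if "b \<in> B" for a b
    proof -
      have "degree (pcompose (\<phi> a i) f * p (i, b)) \<le> L - 1" if "i < N" for i
        using degree_pcompose_mult_le[OF \<phi>_deg D[OF that \<open>b \<in> B\<close>], of a i f] by (simp add: L_def)
      hence "degree (comb a b) \<le> L - 1" unfolding comb_def by (intro degree_sum_le) auto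
      thus ?thesis by (simp add: L_def)
    qed
    have "\<Phi> ` X \<subseteq> (B \<times> {..<L}) \<rightarrow>\<^sub>E F"
    proof
      fix g assume "g \<in> \<Phi> ` X"
      then obtain a where a: "a \<in> X" "g = \<Phi> a" by auto
      show "g \<in> (B \<times> {..<L}) \<rightarrow>\<^sub>E F"
        unfolding a(2) \<Phi>_def using comb_F[OF a(1)]
        by (intro restrict_PiE_iff[THEN iffD2]) (auto simp: polys_over_def)
    qed
    moreover have "finite ((B \<times> {..<L}) \<rightarrow>\<^sub>E F)" using B F by (intro finite_PiE) auto
    ultimately have "card (\<Phi> ` X) \<le> card ((B \<times> {..<L}) \<rightarrow>\<^sub>E F)" by (intro card_mono)
    also have "\<dots> = card F ^ (card B * L)" using B by (simp add: card_funcsetE card_cartesian_product)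
    also have "\<dots> < card F ^ (N * M)"
      using NM card_subfield_ge_2[OF F] by (intro power_strict_increasing) auto
    also have "\<dots> = card X" by (simp add: X_def card_funcsetE card_cartesian_product)
    finally have "\<not> inj_on \<Phi> X" by (rule pigeonhole)
    then obtain a a' where a: "a \<in> X" "a' \<in> X" "a \<noteq> a'" "\<Phi> a = \<Phi> a'" by (auto simp: inj_on_def)
    have comb_eq: "comb a b = comb a' b" if b: "b \<in> B" for b
    proof (rule poly_eqI)
      fix l
      show "coeff (comb a b) l = coeff (comb a' b) l"
      proof (cases "l < L")
        case True
        thus ?thesis using fun_cong[OF a(4), of "(b, l)"] b by (simp add: \<Phi>_def)
      next
        case False
        thus ?thesis using comb_deg[OF b, of a] comb_deg[OF b, of a'] by (simp add: coeff_eq_0)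
      qed
    qed
    have sum_comb: "poly s t * (\<Sum>i<N. poly (\<phi> e i) (poly f t) * y i) = (\<Sum>b\<in>B. poly (comb e b) t * b)" for e
    proof -
      have "poly s t * (\<Sum>i<N. poly (\<phi> e i) (poly f t) * y i)
        = (\<Sum>i<N. \<Sum>b\<in>B. poly (\<phi> e i) (poly f t) * (poly s t * c i b) * b)"
        by (simp add: yc sum_distrib_left mult_ac)
      also have "\<dots> = (\<Sum>i<N. \<Sum>b\<in>B. poly (\<phi> e i) (poly f t) * poly (p (i, b)) t * b)"
        using p by (intro sum.cong) auto
      also have "\<dots> = (\<Sum>b\<in>B. \<Sum>i<N. poly (\<phi> e i) (poly f t) * poly (p (i, b)) t * b)"
        by (rule sum.swap)
      also have "\<dots> = (\<Sum>b\<in>B. poly (comb e b) t * b)"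
        by (simp add: comb_def poly_sum poly_pcompose sum_distrib_right)
      finally show ?thesis .
    qed
    have "poly s t * (\<Sum>i<N. poly (\<phi> a i) (poly f t) * y i) = poly s t * (\<Sum>i<N. poly (\<phi> a' i) (poly f t) * y i)"
      unfolding sum_comb using comb_eq by (intro sum.cong) auto
    hence "(\<Sum>i<N. poly (\<phi> a i) (poly f t) * y i) = (\<Sum>i<N. poly (\<phi> a' i) (poly f t) * y i)" using s by simp
    hence "(\<Sum>i<N. poly (\<phi> a i - \<phi> a' i) (poly f t) * y i) = 0"
      by (simp add: left_diff_distrib sum_subtractf)
    moreover have "\<exists>i<N. \<phi> a i - \<phi> a' i \<noteq> 0"
    proof -
      obtain i j where ij: "a (i, j) \<noteq> a' (i, j)" using a(3) by (metis ext surj_pair)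
      have "(i, j) \<in> {..<N} \<times> {..<M}"
      proof (rule ccontr)
        assume "(i, j) \<notin> {..<N} \<times> {..<M}"
        hence "a (i, j) = undefined" "a' (i, j) = undefined" using a by (auto simp: X_def PiE_def extensional_def)
        thus False using ij by simp
      qed
      hence "i < N" "coeff (\<phi> a i - \<phi> a' i) j \<noteq> 0" using ij by (auto simp: \<phi>_coeff)
      thus ?thesis by (metis coeff_0)
    qed
    moreover have "\<forall>i<N. \<phi> a i - \<phi> a' i \<in> polys_over F" using \<phi>_F a P by (auto intro: is_subring_diff)
    ultimately show "\<exists>\<phi>. (\<forall>i<N. \<phi> i \<in> polys_over F) \<and>
           (\<exists>i<N. \<phi> i \<noteq> 0) \<and> (\<Sum>i<N. poly (\<phi> i) (poly f t) * y i) = 0"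
      by (intro exI[of _ "\<lambda>i. \<phi> a i - \<phi> a' i"]) blast
  qed
qed

text \<open>Linear dependence over F(x) of any N elements, with denominators cleared and common
  powers of x cancelled: since some constant coefficient is nonzero, the relation stays nontrivial
  when x is reduced to zero.\<close>

definition dependent_over :: "'k::field set \<Rightarrow> 'k \<Rightarrow> nat \<Rightarrow> bool" where
  "dependent_over F x N \<longleftrightarrow> (\<forall>y. \<exists>\<phi>. (\<forall>i<N. \<phi> i \<in> polys_over F) \<and> (\<exists>i<N. coeff (\<phi> i) 0 \<noteq> 0) \<and>
     (\<Sum>i<N. poly (\<phi> i) x * y i) = 0)"

text \<open>As long as all constant coefficients vanish, the variable can be cancelled from all
  polynomials at once, and the total degree decreases.\<close>

lemma dependence_nonzero_constant_coeff:
  fixes F :: "'k::field set" and N :: nat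
  assumes x: "x \<noteq> 0" and \<phi>: "\<And>i. i < N \<Longrightarrow> \<phi> i \<in> polys_over F" "\<exists>i<N. \<phi> i \<noteq> 0"
    "(\<Sum>i<N. poly (\<phi> i) x * y i) = 0"
  shows "\<exists>\<phi>. (\<forall>i<N. \<phi> i \<in> polys_over F) \<and> (\<exists>i<N. coeff (\<phi> i) 0 \<noteq> 0) \<and>
     (\<Sum>i<N. poly (\<phi> i) x * y i) = 0"
  using \<phi>
proof (induction "\<Sum>i<N. degree (\<phi> i)" arbitrary: \<phi> rule: less_induct)
  case less
  show ?case
  proof (cases "\<exists>i<N. coeff (\<phi> i) 0 \<noteq> 0")
    case True thus ?thesis using less.prems by blast
  next
    case False
    have "\<exists>q. i < N \<longrightarrow> \<phi> i = pCons 0 q" for i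
      using False by (cases "\<phi> i") (auto)
    then obtain \<psi> where \<phi>\<psi>: "\<And>i. i < N \<Longrightarrow> \<phi> i = pCons 0 (\<psi> i)" by metis
    have deg: "degree (\<psi> i) \<le> degree (\<phi> i)" if "i < N" for i
      using \<phi>\<psi>[OF that] by simp
    obtain k where k: "k < N" "\<phi> k \<noteq> 0" using less.prems by blast
    have degk: "degree (\<psi> k) < degree (\<phi> k)" using \<phi>\<psi>[OF k(1)] k(2) by simp
    have "(\<Sum>i<N. degree (\<psi> i)) < (\<Sum>i<N. degree (\<phi> i))"
    proof (rule sum_strict_mono_ex1)
      show "\<exists>i\<in>{..<N}. degree (\<psi> i) < degree (\<phi> i)" using k(1) degk by auto
    qed (use deg in auto)
    moreover have "\<psi> i \<in> polys_over F" if "i < N" for i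
    proof -
      have "coeff (\<psi> i) j \<in> F" for j
      proof -
        have "coeff (\<phi> i) (Suc j) \<in> F" using less.prems(1)[OF that] by (simp add: polys_over_def)
        thus ?thesis using \<phi>\<psi>[OF that] by simp
      qed
      thus ?thesis by (simp add: polys_over_def)
    qed
    moreover have "\<exists>i<N. \<psi> i \<noteq> 0" using k \<phi>\<psi>[OF k(1)] by auto
    moreover have "(\<Sum>i<N. poly (\<psi> i) x * y i) = 0"
    proof -
      have "x * (\<Sum>i<N. poly (\<psi> i) x * y i) = (\<Sum>i<N. poly (\<phi> i) x * y i)"
        unfolding sum_distrib_left by (rule sum.cong) (auto simp: \<phi>\<psi> mult.assoc)
      thus ?thesis using less.prems x by simp
    qed
    ultimately show ?thesis by (rule less.hyps)
  qed
qed

text \<open>Passing from t to its inverse preserves both transcendence and the generated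
  field.\<close>

lemma (in place) exists_generator_in_V:
  assumes "function_field F"
  shows "\<exists>t\<in>V. \<not> algebraic_over F t \<and> finite_over (field_gen (insert t F))"
proof -
  obtain t where t: "\<not> algebraic_over F t" "finite_over (field_gen (insert t F))"
    and cl: "\<And>x. algebraic_over F x \<Longrightarrow> x \<in> F"
    using assms by (auto simp: function_field_def)
  show ?thesis
  proof (cases "t \<in> V")
    case True thus ?thesis using t by auto
  next
    case False
    hence V: "inverse t \<in> V" using V_cases by auto
    have "t \<notin> F" using False F_subset_V by auto
    hence "\<not> algebraic_over F (inverse t)"
      using cl[of "inverse t"] is_subfield_inverse[OF F_subfield, of "inverse t"] by auto
    moreover have "field_gen (insert t F) \<subseteq> field_gen (insert (inverse t) F)"
    proof -
      have "t \<in> L" if "is_subfield L" "inverse t \<in> L" for L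
        using is_subfield_inverse[OF that] by simp
      thus ?thesis unfolding field_gen_def by blast
    qed
    hence "finite_over (field_gen (insert (inverse t) F))"
      using t(2) unfolding finite_over_def by (meson subsetD)
    ultimately show ?thesis using V by auto
  qed
qed

text \<open>\<open>polynomial_dependence\<close> speaks about polynomials in t only, so z is
  replaced by a multiple x of this kind: in an algebraic relation for z with coefficients in F[t],
  the lowest nonzero coefficient is divisible by z.\<close>

lemma (in place) exists_dependent_over:
  assumes ff: "function_field F" and z: "z \<in> m" "z \<noteq> 0"
  shows "\<exists>x\<in>m. x \<noteq> 0 \<and> x / z \<in> V \<and> (\<exists>N. dependent_over F x N)"
proof -
  obtain t where t: "t \<in> V" "\<not> algebraic_over F t" "finite_over (field_gen (insert t F))"
    using exists_generator_in_V[OF ff] by auto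
  obtain n where n: "\<And>f N y. f \<in> polys_over F \<Longrightarrow> n * degree f < N \<Longrightarrow>
      \<exists>\<phi>. (\<forall>i<N. \<phi> i \<in> polys_over F) \<and> (\<exists>i<N. \<phi> i \<noteq> 0) \<and> (\<Sum>i<N. poly (\<phi> i) (poly f t) * y i) = 0"
    using polynomial_dependence[OF F_subfield F_finite t(3)] by blast
  have X: "[:0, 1:] \<in> polys_over F"
    using F_subring by (intro linear_in_polys_over is_subring_0 is_subring_1)
  obtain \<phi> where \<phi>: "\<And>i. i < n + 1 \<Longrightarrow> \<phi> i \<in> polys_over F" "\<exists>i<n + 1. \<phi> i \<noteq> 0"
    "(\<Sum>i<n+1. poly (\<phi> i) t * z ^ i) = 0"
    using n[OF X, of "n + 1" "\<lambda>i. z ^ i"] by auto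
  define j where "j = (LEAST j. \<phi> j \<noteq> 0)"
  have j: "\<phi> j \<noteq> 0" "j < n + 1" "\<And>i. i < j \<Longrightarrow> \<phi> i = 0"
  proof -
    obtain k where k: "k < n + 1" "\<phi> k \<noteq> 0" using \<phi>(2) by blast
    show "\<phi> j \<noteq> 0" unfolding j_def using k(2) by (rule LeastI)
    show "j < n + 1" unfolding j_def using Least_le[of "\<lambda>j. \<phi> j \<noteq> 0", OF k(2)] k(1) by simp
    show "\<phi> i = 0" if "i < j" for i using not_less_Least[OF that[unfolded j_def]] by simp
  qed
  define x where "x = poly (\<phi> j) t"
  have x0: "x \<noteq> 0" using t(2) j \<phi>(1)[of j] by (auto simp: x_def algebraic_over_def polys_over_def)
  \<comment> \<open>After division by z^j the relation reads x + z S = 0.\<close>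
  define S where "S = (\<Sum>i\<in>{Suc j..<n+1}. poly (\<phi> i) t * z ^ (i - Suc j))"
  have "(\<Sum>i<n+1. poly (\<phi> i) t * z ^ i) = (\<Sum>i\<in>{j..<n+1}. poly (\<phi> i) t * z ^ i)"
    using j by (intro sum.mono_neutral_right) auto
  also have "\<dots> = x * z ^ j + (\<Sum>i\<in>{Suc j..<n+1}. poly (\<phi> i) t * z ^ i)"
    using j by (subst sum.atLeast_Suc_lessThan) (auto simp: x_def)
  also have "(\<Sum>i\<in>{Suc j..<n+1}. poly (\<phi> i) t * z ^ i)
      = z ^ j * z * (\<Sum>i\<in>{Suc j..<n+1}. poly (\<phi> i) t * z ^ (i - Suc j))"
    unfolding sum_distrib_left
  proof (rule sum.cong)
    fix i assume i: "i \<in> {Suc j..<n+1}"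
    have "z ^ i = z ^ j * z * z ^ (i - Suc j)"
    proof -
      have "i = Suc j + (i - Suc j)" using i by auto
      hence "z ^ i = z ^ Suc j * z ^ (i - Suc j)" by (metis power_add)
      thus ?thesis by (simp only: power_Suc2)
    qed
    thus "poly (\<phi> i) t * z ^ i = z ^ j * z * (poly (\<phi> i) t * z ^ (i - Suc j))" by (simp add: mult_ac)
  qed simp
  finally have sum: "x * z ^ j + z ^ j * z * S = 0" using \<phi>(3) by (simp only: S_def)
  hence "z ^ j * (x + z * S) = 0" by (simp add: algebra_simps)
  hence "x + S * z = 0" using z by (simp add: mult.commute)
  hence "x / z = - S" using z by (simp add: field_simps eq_neg_iff_add_eq_0)
  moreover have "S \<in> V"
    unfolding S_def using V_subring ideal_subset z t \<phi>(1)
    by (intro is_subring_sum is_subring_mult is_subring_power poly_in_V) auto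
  ultimately have xz: "x / z \<in> V" using V_subring by (simp add: is_subring_uminus)
  hence xm: "x \<in> m" using ideal_mult[OF xz z(1)] z by simp
  have "\<exists>N. dependent_over F x N"
  proof (intro exI[of _ "n * degree (\<phi> j) + 1"])
    show "dependent_over F x (n * degree (\<phi> j) + 1)"
      unfolding dependent_over_def
    proof
      fix y
      obtain \<psi> where "\<forall>i<n * degree (\<phi> j) + 1. \<psi> i \<in> polys_over F" "\<exists>i<n * degree (\<phi> j) + 1. \<psi> i \<noteq> 0"
        "(\<Sum>i<n * degree (\<phi> j) + 1. poly (\<psi> i) x * y i) = 0"
        using n[OF \<phi>(1)[OF j(2)], of "n * degree (\<phi> j) + 1" y] by (auto simp: x_def)
      thus "\<exists>\<phi>'. (\<forall>i<n * degree (\<phi> j) + 1. \<phi>' i \<in> polys_over F) \<and> (\<exists>i<n * degree (\<phi> j) + 1. coeff (\<phi>' i) 0 \<noteq> 0) \<and>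
         (\<Sum>i<n * degree (\<phi> j) + 1. poly (\<phi>' i) x * y i) = 0"
        by (intro dependence_nonzero_constant_coeff x0) auto
    qed
  qed
  thus ?thesis using xm x0 xz by auto
qed

subsection \<open>Discreteness and residue degree of a place\<close>

locale function_field_place = place +
  assumes function_field: "function_field F"
begin

text \<open>Modulo the ideal x becomes zero, and only the constant coefficients of the relation
  survive.\<close>

lemma residues_dependent:
  assumes dep: "dependent_over F x N" and x: "x \<in> m" and y: "\<And>i. i < N \<Longrightarrow> y i \<in> V"
  shows "\<exists>c. (\<forall>i<N. c i \<in> F) \<and> (\<exists>i<N. c i \<noteq> 0) \<and> (\<Sum>i<N. c i * y i) \<in> m"
proof -
  obtain \<phi> where \<phi>: "\<And>i. i < N \<Longrightarrow> \<phi> i \<in> polys_over F" "\<exists>i<N. coeff (\<phi> i) 0 \<noteq> 0"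
    "(\<Sum>i<N. poly (\<phi> i) x * y i) = 0" using dep unfolding dependent_over_def by blast
  have "(\<Sum>i<N. (poly (\<phi> i) x - coeff (\<phi> i) 0) * y i) \<in> m"
    using \<phi>(1) x y by (intro ideal_sum ideal_mult' poly_diff_coeff_0_in_ideal) auto
  hence "- (\<Sum>i<N. (poly (\<phi> i) x - coeff (\<phi> i) 0) * y i) \<in> m" by (rule ideal_uminus)
  also have "- (\<Sum>i<N. (poly (\<phi> i) x - coeff (\<phi> i) 0) * y i) = (\<Sum>i<N. coeff (\<phi> i) 0 * y i)"
    using \<phi>(3) by (simp add: left_diff_distrib sum_subtractf)
  finally show ?thesis using \<phi> by (intro exI[of _ "\<lambda>i. coeff (\<phi> i) 0"]) (auto simp: polys_over_def)
qed

text \<open>In valuation terms, the \<open>y i\<close> descend strictly from x and stay positive.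
  Divide the relation by \<open>y j\<close>, where j is the last index with a nonzero constant
  coefficient. All other terms then lie in the ideal: the earlier ones because
  \<open>y i / y j\<close> does, the later ones because their coefficients are multiples of x and
  hence of \<open>y j\<close>. So the j-th constant coefficient would lie in the ideal too.\<close>

lemma no_long_chain:
  assumes dep: "dependent_over F x N" and y0: "y 0 = x"
    and ym: "\<And>i. i < N \<Longrightarrow> y i \<in> m \<and> y i \<noteq> 0"
    and chain: "\<And>i. Suc i < N \<Longrightarrow> y i / y (Suc i) \<in> m"
  shows False
proof -
  obtain \<phi> where \<phi>: "\<And>i. i < N \<Longrightarrow> \<phi> i \<in> polys_over F" "\<exists>i<N. coeff (\<phi> i) 0 \<noteq> 0"
    "(\<Sum>i<N. poly (\<phi> i) x * y i) = 0" using dep unfolding dependent_over_def by blast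
  have lt: "y i / y j \<in> m" if "i < j" "j < N" for i j
    using that
  proof (induction j)
    case (Suc j)
    show ?case
    proof (cases "i = j")
      case True thus ?thesis using chain Suc by simp
    next
      case False
      hence "y i / y j \<in> m" using Suc by simp
      moreover have "y j / y (Suc j) \<in> V" using chain[of j] Suc.prems ideal_subset by blast
      ultimately have "y i / y j * (y j / y (Suc j)) \<in> m" by (rule ideal_mult')
      moreover have "y i / y j * (y j / y (Suc j)) = y i / y (Suc j)" using ym[of j] Suc.prems by simp
      ultimately show ?thesis by metis
    qed
  qed simp
  define j where "j = Max {i. i < N \<and> coeff (\<phi> i) 0 \<noteq> 0}"
  have fin: "finite {i. i < N \<and> coeff (\<phi> i) 0 \<noteq> 0}" by simp
  have "j \<in> {i. i < N \<and> coeff (\<phi> i) 0 \<noteq> 0}" unfolding j_def using \<phi>(2) by (intro Max_in) auto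
  hence j: "j < N" "coeff (\<phi> j) 0 \<noteq> 0" by auto
  have gt: "coeff (\<phi> i) 0 = 0" if "j < i" "i < N" for i
    using Max_ge[OF fin, of i] that by (auto simp: j_def[symmetric])
  have x: "x \<in> V" "x \<in> m" using ym[of 0] y0 j ideal_subset by auto
  have xy: "x / y j \<in> V"
    using lt[of 0 j] j ym[of 0] y0 ideal_subset is_subring_1[OF V_subring] by (cases "j = 0") auto
  have other: "poly (\<phi> i) x * (y i / y j) \<in> m" if i: "i < N" "i \<noteq> j" for i
  proof (cases "i < j")
    case True
    thus ?thesis using lt[of i j] j poly_in_V[OF \<phi>(1) x(1)] i by (intro ideal_mult) auto
  next
    case False
    obtain r where r: "r \<in> V" "poly (\<phi> i) x = coeff (\<phi> i) 0 + x * r"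
      using poly_eq_coeff_0_plus[OF \<phi>(1)[OF i(1)] x(1)] by blast
    hence "poly (\<phi> i) x * (y i / y j) = (x / y j * r) * y i" using gt[of i] False i by simp
    moreover have "(x / y j * r) * y i \<in> m"
      using xy r ym[OF i(1)] by (intro ideal_mult is_subring_mult[OF V_subring]) auto
    ultimately show ?thesis by metis
  qed
  have "(\<Sum>i<N. poly (\<phi> i) x * (y i / y j)) = (\<Sum>i<N. poly (\<phi> i) x * y i) / y j"
    by (simp add: sum_divide_distrib)
  hence "0 = (\<Sum>i<N. poly (\<phi> i) x * (y i / y j))" using \<phi>(3) by simp
  also have "\<dots> = poly (\<phi> j) x * (y j / y j) + (\<Sum>i\<in>{..<N}-{j}. poly (\<phi> i) x * (y i / y j))"
    using j by (subst sum.remove[of _ j]) auto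
  finally have "poly (\<phi> j) x = - (\<Sum>i\<in>{..<N}-{j}. poly (\<phi> i) x * (y i / y j))"
    using ym[OF j(1)] by (simp add: eq_neg_iff_add_eq_0)
  moreover have "(\<Sum>i\<in>{..<N}-{j}. poly (\<phi> i) x * (y i / y j)) \<in> m"
    using other by (intro ideal_sum) auto
  ultimately have "poly (\<phi> j) x \<in> m" by (simp add: ideal_uminus)
  hence "poly (\<phi> j) x - (poly (\<phi> j) x - coeff (\<phi> j) 0) \<in> m"
    using poly_diff_coeff_0_in_ideal[OF \<phi>(1)[OF j(1)] x(2)] by (rule ideal_diff)
  hence "coeff (\<phi> j) 0 \<in> m" by simp
  thus False using F_Int_ideal j \<phi>(1)[OF j(1)] by (auto simp: polys_over_def)
qed

text \<open>If no element generates the ideal, each of its nonzero elements is a proper multiple of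
  another one, so a chain excluded by \<open>no_long_chain\<close> can be continued without end from
  a suitable x.\<close>

lemma exists_uniformizer: "\<exists>\<tau>. m = (\<lambda>x. \<tau> * x) ` V"
proof (rule ccontr)
  assume neg: "\<not> ?thesis"
  have step: "\<exists>y'. (y' \<in> m \<and> y' \<noteq> 0) \<and> y / y' \<in> m" if y: "y \<in> m \<and> y \<noteq> 0" for y
  proof -
    have "(\<lambda>x. y * x) ` V \<subseteq> m" using y by (auto intro: ideal_mult')
    then obtain y' where y': "y' \<in> m" "y' \<notin> (\<lambda>x. y * x) ` V" using neg by blast
    have "y' = y * (y' / y)" using y by simp
    hence "y' / y \<notin> V" using y'(2) by blast
    hence "y / y' \<in> m" by (simp add: ideal_iff)
    moreover have "y' \<noteq> 0" using y' is_subring_0[OF V_subring] by (auto simp: image_iff)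
    ultimately show ?thesis using y' by auto
  qed
  obtain z where z: "z \<in> m" "z \<noteq> 0" using ideal_nontrivial by auto
  obtain x N where x: "x \<in> m" "x \<noteq> 0" "dependent_over F x N"
    using exists_dependent_over[OF function_field z] by blast
  obtain y where y: "y 0 = x" "\<And>n. (y n \<in> m \<and> y n \<noteq> 0)" "\<And>n. y n / y (Suc n) \<in> m"
    using dependent_nat_choice[of "\<lambda>n y. (y \<in> m \<and> y \<noteq> 0) \<and> (n = 0 \<longrightarrow> y = x)" "\<lambda>n y y'. y / y' \<in> m"] x step
    by auto
  show False using no_long_chain[OF x(3), of y] y by auto
qed

lemma unit_mult: "u \<in> vr_units V \<Longrightarrow> v \<in> vr_units V \<Longrightarrow> u * v \<in> vr_units V"
  using V_subring by (auto simp: vr_units_def intro: is_subring_mult)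

lemma unit_inverse: "u \<in> vr_units V \<Longrightarrow> inverse u \<in> vr_units V"
  by (auto simp: vr_units_def)

lemma unit_power: "u \<in> vr_units V \<Longrightarrow> u ^ n \<in> vr_units V"
  using V_subring by (auto simp: vr_units_def is_subring_power power_inverse[symmetric])

lemma unit_powi: "u \<in> vr_units V \<Longrightarrow> u powi n \<in> vr_units V"
  by (auto simp: power_int_def intro: unit_power unit_inverse)

context
  fixes \<tau> assumes \<tau>: "m = (\<lambda>x. \<tau> * x) ` V"
begin

lemma uniformizer_in_ideal: "\<tau> \<in> m"
  using is_subring_1[OF V_subring] by (auto simp: \<tau> image_iff intro!: bexI[of _ 1])

lemma uniformizer_nonzero: "\<tau> \<noteq> 0"
  using ideal_nontrivial \<tau> by auto

lemma uniformizer_power_in_ideal: "n > 0 \<Longrightarrow> \<tau> ^ n \<in> m"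
proof (cases n)
  case (Suc k)
  have "\<tau> ^ k \<in> V" using V_subring uniformizer_in_ideal ideal_subset by (auto intro: is_subring_power)
  thus ?thesis using uniformizer_in_ideal Suc by (auto intro: ideal_mult')
qed simp

text \<open>If z were divisible by all powers of \<tau>, so would be a multiple x of z that
  satisfies \<open>dependent_over\<close>. Then x followed by \<tau>^(N-1), ..., \<tau> would be a
  chain excluded by \<open>no_long_chain\<close>.\<close>

lemma uniformizer_divides_finitely:
  assumes z: "z \<in> V" "z \<noteq> 0"
  shows "\<exists>n. z / \<tau> ^ n \<notin> V"
proof (rule ccontr)
  assume "\<not> ?thesis"
  hence all: "z / \<tau> ^ n \<in> V" for n by blast
  have zm: "z * \<tau> \<in> m" "z * \<tau> \<noteq> 0"
    using z uniformizer_in_ideal uniformizer_nonzero by (auto intro: ideal_mult)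
  obtain x N where x: "x \<in> m" "x \<noteq> 0" "x / (z * \<tau>) \<in> V" "dependent_over F x N"
    using exists_dependent_over[OF function_field zm] by blast
  have xall: "x / \<tau> ^ n \<in> V" for n
  proof -
    have "x / \<tau> ^ n = x / (z * \<tau>) * \<tau> * (z / \<tau> ^ n)" using zm by simp
    also have "\<dots> \<in> V" using x all uniformizer_in_ideal ideal_subset
      by (intro is_subring_mult V_subring) auto
    finally show ?thesis .
  qed
  define y where "y i = (if i = 0 then x else \<tau> ^ (N - i))" for i
  show False
  proof (rule no_long_chain[OF x(4), of y])
    show "y 0 = x" by (simp add: y_def)
    show "y i \<in> m \<and> y i \<noteq> 0" if "i < N" for i
      using that x uniformizer_power_in_ideal uniformizer_nonzero by (auto simp: y_def)
    show "y i / y (Suc i) \<in> m" if "Suc i < N" for i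
    proof (cases "i = 0")
      case True
      define k where "k = N - 1"
      have k: "N = Suc k" using that by (simp add: k_def)
      have "x / \<tau> ^ k = \<tau> * (x / \<tau> ^ Suc k)" using uniformizer_nonzero by simp
      also have "\<dots> \<in> m" using uniformizer_in_ideal xall by (intro ideal_mult')
      finally show ?thesis using True by (simp add: y_def k)
    next
      case False
      have "N - i = Suc (N - Suc i)" using that by simp
      thus ?thesis using False uniformizer_in_ideal uniformizer_nonzero by (simp add: y_def)
    qed
  qed
qed

lemma uniformizer_decomposition_V:
  assumes z: "z \<in> V" "z \<noteq> 0"
  shows "\<exists>n::nat. \<exists>u\<in>vr_units V. z = \<tau> ^ n * u"
proof -
  define n where "n = (LEAST n. z / \<tau> ^ n \<notin> V)"
  have n: "z / \<tau> ^ n \<notin> V" unfolding n_def using uniformizer_divides_finitely[OF z] by (rule LeastI_ex)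
  then obtain k where k: "n = Suc k" using z by (cases n) auto
  have u: "z / \<tau> ^ k \<in> V" using not_less_Least[of k "\<lambda>n. z / \<tau> ^ n \<notin> V"] k by (auto simp: n_def)
  have "z / \<tau> ^ k \<notin> m"
  proof
    assume "z / \<tau> ^ k \<in> m"
    then obtain v where v: "v \<in> V" "z / \<tau> ^ k = \<tau> * v" using \<tau> by auto
    have "z / \<tau> ^ n = z / \<tau> ^ k / \<tau>" by (simp add: k)
    also have "\<dots> = v" using uniformizer_nonzero by (simp add: v(2))
    finally show False using n v by simp
  qed
  hence "z / \<tau> ^ k \<in> vr_units V" using u by (simp add: unit_iff)
  thus ?thesis using uniformizer_nonzero by (intro exI[of _ k] bexI[of _ "z / \<tau> ^ k"]) auto
qed

lemma uniformizer_decomposition: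
  assumes "z \<noteq> 0"
  shows "\<exists>n. \<exists>u\<in>vr_units V. z = \<tau> powi n * u"
proof (cases "z \<in> V")
  case True
  obtain n u where "u \<in> vr_units V" "z = \<tau> ^ n * u"
    using uniformizer_decomposition_V[OF True assms] by blast
  thus ?thesis by (intro exI[of _ "int n"] bexI[of _ u]) auto
next
  case False
  hence "inverse z \<in> V" "inverse z \<noteq> 0" using V_cases assms by auto
  then obtain n u where nu: "u \<in> vr_units V" "inverse z = \<tau> ^ n * u"
    using uniformizer_decomposition_V by blast
  have "z = inverse (\<tau> ^ n * u)" by (simp flip: nu(2))
  hence "z = \<tau> powi (- int n) * inverse u" by (simp add: power_int_minus)
  thus ?thesis using unit_inverse[OF nu(1)] by blast
qed

lemma uniformizer_powi_unit:
  assumes "\<tau> powi k \<in> vr_units V"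
  shows "k = 0"
proof -
  have *: False if "k > 0" "\<tau> powi k \<in> vr_units V" for k
  proof -
    have "\<tau> powi k = \<tau> ^ nat k" using that by (simp add: power_int_def)
    thus False using uniformizer_power_in_ideal[of "nat k"] that by (simp add: unit_iff)
  qed
  have "\<not> k < 0" using *[of "- k"] unit_inverse[OF assms] by (auto simp: power_int_minus)
  moreover have "\<not> k > 0" using *[of k] assms by auto
  ultimately show ?thesis by linarith
qed

end

text \<open>Two generators of the ideal differ by a unit, so the exponent does not depend on the
  generator. This makes the description in \<open>place_val\<close> proper on nonzero
  elements.\<close>

lemma place_val_eqI:
  assumes \<tau>: "m = (\<lambda>x. \<tau> * x) ` V" and u: "u \<in> vr_units V"
  shows "place_val V (\<tau> powi n * u) = n"
  unfolding place_val_def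
proof (rule the_equality)
  show "\<exists>t v. m = (\<lambda>x. t * x) ` V \<and> v \<in> vr_units V \<and> \<tau> powi n * u = t powi n * v"
    using assms by blast
next
  fix k assume "\<exists>t v. m = (\<lambda>x. t * x) ` V \<and> v \<in> vr_units V \<and> \<tau> powi n * u = t powi k * v"
  then obtain t v where t: "m = (\<lambda>x. t * x) ` V" and v: "v \<in> vr_units V"
    and eq: "\<tau> powi n * u = t powi k * v" by blast
  note nz = uniformizer_nonzero[OF \<tau>] uniformizer_nonzero[OF t]
  obtain a where a: "a \<in> V" "t = \<tau> * a" using uniformizer_in_ideal[OF t] \<tau> by auto
  obtain b where b: "b \<in> V" "\<tau> = t * b" using uniformizer_in_ideal[OF \<tau>] t by auto
  have "a * b = 1" using a(2) b(2) nz by (metis mult.assoc mult_cancel_left2 mult.commute)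
  hence "inverse a = b" by (rule inverse_unique)
  hence aU: "a \<in> vr_units V" using a b nz by (auto simp: vr_units_def)
  have "u \<noteq> 0" using u by (simp add: vr_units_def)
  have "\<tau> powi (n - k) = \<tau> powi n * u * inverse u / \<tau> powi k"
    using nz \<open>u \<noteq> 0\<close> by (simp add: power_int_diff)
  also have "\<dots> = a powi k * v * inverse u"
    unfolding eq a(2) power_int_mult_distrib using nz by simp
  finally have "\<tau> powi (n - k) \<in> vr_units V" using aU v u by (auto intro: unit_mult unit_powi unit_inverse)
  thus "k = n" using uniformizer_powi_unit[OF \<tau>] by fastforce
qed

text \<open>These comparisons with 1 tie the absolute value to the valuation ring. Positivity of the
  degree makes the base \<open>card F ^ place_degree F V\<close> exceed 1.\<close>

lemma place_abs_dichotomy: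
  assumes d: "place_degree F V > 0"
  shows "z \<in> m \<Longrightarrow> place_abs F V z < 1"
    and "z \<in> vr_units V \<Longrightarrow> place_abs F V z = 1"
    and "z \<notin> V \<Longrightarrow> place_abs F V z > 1"
proof -
  obtain \<tau> where \<tau>: "m = (\<lambda>x. \<tau> * x) ` V" using exists_uniformizer by blast
  define c where "c = real (card F) ^ place_degree F V"
  have c: "c > 1" unfolding c_def using card_subfield_ge_2[OF F_subfield F_finite] d by (intro one_less_power) auto
  have abs: "place_abs F V (\<tau> powi n * u) = c powi (- n)" if "u \<in> vr_units V" for n u
    using that place_val_eqI[OF \<tau> that, of n] uniformizer_nonzero[OF \<tau>]
    by (auto simp: place_abs_def c_def vr_units_def)
  have unit0: "0 \<notin> vr_units V" by (simp add: vr_units_def)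
  have pos: "\<tau> powi n * u \<in> m" if "n > 0" "u \<in> vr_units V" for n u
  proof -
    have "\<tau> powi n \<in> m" using that uniformizer_power_in_ideal[OF \<tau>, of "nat n"] by (simp add: power_int_def)
    thus ?thesis using that by (intro ideal_mult') (auto simp: vr_units_def)
  qed
  have neg: "\<tau> powi n * u \<notin> V" if "n < 0" "u \<in> vr_units V" for n u
  proof -
    have "\<tau> powi (- n) * inverse u \<in> m" using that by (intro pos unit_inverse) auto
    moreover have "\<tau> powi (- n) * inverse u = inverse (\<tau> powi n * u)" by (simp add: power_int_minus)
    ultimately have "inverse (\<tau> powi n * u) \<in> m" by simp
    moreover have "\<tau> powi n * u \<noteq> 0" using uniformizer_nonzero[OF \<tau>] that unit0 by auto
    ultimately show ?thesis by (metis ideal_iff inverse_inverse_eq inverse_nonzero_iff_nonzero)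
  qed
  have trich: "(z \<in> m \<longrightarrow> place_abs F V z < 1) \<and> (z \<in> vr_units V \<longrightarrow> place_abs F V z = 1) \<and>
    (z \<notin> V \<longrightarrow> place_abs F V z > 1)"
  proof (cases "z = 0")
    case True
    thus ?thesis using unit0 is_subring_0[OF V_subring] by (auto simp: place_abs_def)
  next
    case False
    obtain n u where nu: "u \<in> vr_units V" "z = \<tau> powi n * u"
      using uniformizer_decomposition[OF \<tau> False] by blast
    consider "n > 0" | "n = 0" | "n < 0" by linarith
    thus ?thesis
    proof cases
      case 1
      have "1 < c powi n" using c 1 by (intro one_less_power_int) auto
      hence "place_abs F V z < 1" using abs[OF nu(1), of n] nu(2)
        by (simp add: power_int_minus inverse_less_1_iff)
      thus ?thesis using pos[OF 1 nu(1)] nu(2) ideal_subset by (auto simp: unit_iff)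
    next
      case 2
      thus ?thesis using nu abs[OF nu(1), of n] by (auto simp: unit_iff)
    next
      case 3
      have "1 < c powi (- n)" using c 3 by (intro one_less_power_int) auto
      thus ?thesis using neg[OF 3 nu(1)] nu abs[OF nu(1), of n] ideal_subset by (auto simp: unit_iff)
    qed
  qed
  show "z \<in> m \<Longrightarrow> place_abs F V z < 1" "z \<in> vr_units V \<Longrightarrow> place_abs F V z = 1"
    "z \<notin> V \<Longrightarrow> place_abs F V z > 1" using trich by auto
qed

section \<open>The residue field: bases over \<open>F\<close>, cardinality and Fermat's
  theorem\<close>

definition residue_basis :: "nat \<Rightarrow> (nat \<Rightarrow> 'a) \<Rightarrow> bool" where
  "residue_basis d b \<longleftrightarrow> (\<forall>i<d. b i \<in> V) \<and>
     (\<forall>x\<in>V. \<exists>!c. c \<in> {..<d} \<rightarrow>\<^sub>E F \<and> x - (\<Sum>i<d. c i * b i) \<in> m)"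

lemma lincomb_in_V:
  assumes "\<And>i. i < d \<Longrightarrow> b i \<in> V" "\<And>i. i < d \<Longrightarrow> c i \<in> F"
  shows "(\<Sum>i<d. c i * b i) \<in> V"
  using assms F_subset_V by (intro is_subring_sum is_subring_mult V_subring) auto

text \<open>A longest family that is independent modulo the ideal is a basis;
  \<open>residues_dependent\<close> bounds its length.\<close>

lemma exists_residue_basis: "\<exists>d b. residue_basis d b"
proof -
  define indep where "indep d b \<longleftrightarrow> (\<forall>i<d. b i \<in> V) \<and>
     (\<forall>c. (\<forall>i<d. c i \<in> F) \<longrightarrow> (\<Sum>i<d. c i * b i) \<in> m \<longrightarrow> (\<forall>i<d. c i = 0))" for d :: nat and b
  obtain z where z: "z \<in> m" "z \<noteq> 0" using ideal_nontrivial by auto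
  obtain x N where x: "x \<in> m" "dependent_over F x N"
    using exists_dependent_over[OF function_field z] by blast
  have bound: "d < N" if "indep d b" for d b
  proof (rule ccontr)
    assume "\<not> d < N"
    hence N: "N \<le> d" by simp
    have "\<exists>c. (\<forall>i<N. c i \<in> F) \<and> (\<exists>i<N. c i \<noteq> 0) \<and> (\<Sum>i<N. c i * b i) \<in> m"
      by (rule residues_dependent[OF x(2,1)]) (use that N in \<open>auto simp: indep_def\<close>)
    then obtain c where c: "\<And>i. i < N \<Longrightarrow> c i \<in> F" "\<exists>i<N. c i \<noteq> 0" "(\<Sum>i<N. c i * b i) \<in> m"
      by blast
    define c' where "c' i = (if i < N then c i else 0)" for i
    have "(\<Sum>i<d. c' i * b i) = (\<Sum>i<N. c i * b i)"
      using N by (intro sum.mono_neutral_cong_right) (auto simp: c'_def)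
    moreover have "\<forall>i<d. c' i \<in> F" using c(1) is_subring_0[OF F_subring] by (auto simp: c'_def)
    ultimately have c'0: "\<forall>i<d. c' i = 0" using that c(3) unfolding indep_def by metis
    obtain i where i: "i < N" "c i \<noteq> 0" using c(2) by blast
    thus False using c'0[rule_format, of i] N by (simp add: c'_def)
  qed
  define d where "d = (GREATEST d. \<exists>b. indep d b)"
  have "\<exists>b. indep 0 b" by (auto simp: indep_def)
  hence "\<exists>b. indep d b" unfolding d_def
    by (rule GreatestI_nat[where b = N]) (use bound in \<open>auto intro: less_imp_le\<close>)
  then obtain b where b: "indep d b" by blast
  have max: "\<not> indep (Suc d) b'" for b'
    using Greatest_le_nat[where P = "\<lambda>d. \<exists>b. indep d b" and b = N and k = "Suc d"] bound
    by (metis d_def less_imp_le not_less_eq_eq order_refl)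
  have bV: "\<And>i. i < d \<Longrightarrow> b i \<in> V" using b by (simp add: indep_def)
  have b_indep: "\<forall>i<d. c i = 0" if "\<forall>i<d. c i \<in> F" "(\<Sum>i<d. c i * b i) \<in> m" for c
    using b that by (simp add: indep_def)
  have "residue_basis d b"
    unfolding residue_basis_def
  proof (intro conjI ballI allI impI)
    fix x assume xV: "x \<in> V"
    define b' where "b' = b(d := x)"
    have sum_b': "(\<Sum>i<Suc d. c i * b' i) = (\<Sum>i<d. c i * b i) + c d * x" for c by (simp add: b'_def)
    have "\<forall>i<Suc d. b' i \<in> V" using bV xV by (auto simp: b'_def less_Suc_eq)
    then obtain c where c: "\<And>i. i < Suc d \<Longrightarrow> c i \<in> F" "(\<Sum>i<d. c i * b i) + c d * x \<in> m"
      "\<exists>i<Suc d. c i \<noteq> 0"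
      using max[of b'] unfolding indep_def sum_b' by blast
    \<comment> \<open>The relation for the family extended by x must involve x, because the family
      \<open>b\<close> is independent. Dividing by the coefficient of x then gives the coordinates
      of x.\<close>
    have cd: "c d \<noteq> 0"
    proof
      assume cd: "c d = 0"
      hence "(\<Sum>i<d. c i * b i) \<in> m" using c(2) by simp
      moreover have "\<forall>i<d. c i \<in> F" using c(1) by auto
      ultimately have "\<forall>i<d. c i = 0" using b unfolding indep_def by blast
      thus False using cd c(3) by (auto simp: less_Suc_eq)
    qed
    define a where "a = (\<lambda>i\<in>{..<d}. - c i / c d)"
    have a: "a \<in> {..<d} \<rightarrow>\<^sub>E F"
      using c(1) by (auto simp: a_def intro!: is_subfield_divide is_subfield_uminus F_subfield)
    have "inverse (c d) * ((\<Sum>i<d. c i * b i) + c d * x) \<in> m"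
      using c(1)[of d] F_subset_V c(2) by (intro ideal_mult) (auto intro!: is_subfield_inverse[OF F_subfield] subsetD[OF F_subset_V])
    also have "inverse (c d) * ((\<Sum>i<d. c i * b i) + c d * x) = x - (\<Sum>i<d. a i * b i)"
      using cd by (simp add: a_def distrib_left sum_negf sum_distrib_left field_simps)
    finally have xa: "x - (\<Sum>i<d. a i * b i) \<in> m" .
    show "\<exists>!c. c \<in> {..<d} \<rightarrow>\<^sub>E F \<and> x - (\<Sum>i<d. c i * b i) \<in> m"
    proof (rule ex1I[of _ a])
      show "a \<in> {..<d} \<rightarrow>\<^sub>E F \<and> x - (\<Sum>i<d. a i * b i) \<in> m" using a xa by simp
      fix e assume e: "e \<in> {..<d} \<rightarrow>\<^sub>E F \<and> x - (\<Sum>i<d. e i * b i) \<in> m"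
      have "(x - (\<Sum>i<d. e i * b i)) - (x - (\<Sum>i<d. a i * b i)) \<in> m" by (rule ideal_diff) (use e xa in auto)
      hence sum_m: "(\<Sum>i<d. (a i - e i) * b i) \<in> m" by (simp add: left_diff_distrib sum_subtractf)
      have diff_F: "\<forall>i<d. a i - e i \<in> F"
      proof (intro allI impI is_subfield_diff F_subfield)
        fix i assume i: "i < d"
        show "a i \<in> F" using PiE_mem[OF a, of i] i by simp
        show "e i \<in> F" using PiE_mem[OF conjunct1[OF e], of i] i by simp
      qed
      have "e i = a i" if "i \<in> {..<d}" for i
        using b_indep[OF diff_F sum_m] that by simp
      thus "e = a" by (rule PiE_ext[OF conjunct1[OF e] a])
    qed
  qed (use bV in auto)
  thus ?thesis by blast
qed

text \<open>Dimensions are compared by counting: the coordinate tuples of the first basis inject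
  into those of the second. Applied in both directions, this makes the description in
  \<open>place_degree\<close> proper.\<close>

lemma residue_basis_card_le:
  assumes "residue_basis d b" "residue_basis d' b'"
  shows "d \<le> d'"
proof -
  have ex: "\<exists>!e. e \<in> {..<d'} \<rightarrow>\<^sub>E F \<and> (\<Sum>i<d. c i * b i) - (\<Sum>i<d'. e i * b' i) \<in> m"
    if "c \<in> {..<d} \<rightarrow>\<^sub>E F" for c
  proof -
    have "(\<Sum>i<d. c i * b i) \<in> V" using assms that by (intro lincomb_in_V) (auto simp: residue_basis_def)
    thus ?thesis using assms(2) unfolding residue_basis_def by blast
  qed
  define g where "g c = (THE e. e \<in> {..<d'} \<rightarrow>\<^sub>E F \<and> (\<Sum>i<d. c i * b i) - (\<Sum>i<d'. e i * b' i) \<in> m)" for c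
  have g: "g c \<in> {..<d'} \<rightarrow>\<^sub>E F" "(\<Sum>i<d. c i * b i) - (\<Sum>i<d'. g c i * b' i) \<in> m"
    if "c \<in> {..<d} \<rightarrow>\<^sub>E F" for c
    using theI'[OF ex[OF that]] by (auto simp: g_def)
  have "inj_on g ({..<d} \<rightarrow>\<^sub>E F)"
  proof (rule inj_onI)
    fix c e assume ce: "c \<in> {..<d} \<rightarrow>\<^sub>E F" "e \<in> {..<d} \<rightarrow>\<^sub>E F" "g c = g e"
    have "(\<Sum>i<d. c i * b i) - (\<Sum>i<d'. g c i * b' i) - ((\<Sum>i<d. e i * b i) - (\<Sum>i<d'. g e i * b' i)) \<in> m"
      by (rule ideal_diff[OF g(2)[OF ce(1)] g(2)[OF ce(2)]])
    hence 1: "(\<Sum>i<d. c i * b i) - (\<Sum>i<d. e i * b i) \<in> m" using ce(3) by simp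
    have 2: "(\<Sum>i<d. c i * b i) - (\<Sum>i<d. c i * b i) \<in> m" by (simp add: ideal_0)
    have "(\<Sum>i<d. c i * b i) \<in> V" using assms ce by (intro lincomb_in_V) (auto simp: residue_basis_def)
    thus "c = e" using assms(1) 1 2 ce unfolding residue_basis_def by blast
  qed
  moreover have "g ` ({..<d} \<rightarrow>\<^sub>E F) \<subseteq> {..<d'} \<rightarrow>\<^sub>E F" using g by blast
  moreover have "finite ({..<d'} \<rightarrow>\<^sub>E F)" using F_finite by (intro finite_PiE) auto
  ultimately have "card ({..<d} \<rightarrow>\<^sub>E F) \<le> card ({..<d'} \<rightarrow>\<^sub>E F)" by (rule card_inj_on_le)
  hence "card F ^ d \<le> card F ^ d'" by (simp add: card_funcsetE)
  thus ?thesis using card_subfield_ge_2[OF F_subfield F_finite] by simp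
qed

lemma residue_basis_place_degree: "\<exists>b. residue_basis (place_degree F V) b"
proof -
  have def: "place_degree F V = (THE d. \<exists>b. residue_basis d b)"
    by (simp add: place_degree_def residue_basis_def)
  have "\<exists>!d. \<exists>b. residue_basis d b"
    using exists_residue_basis residue_basis_card_le by (meson le_antisym)
  thus ?thesis unfolding def by (rule theI')
qed

text \<open>The combinations of a residue basis form a transversal with q^d elements, where d is the
  degree of the place.\<close>

lemma residue_fermat:
  assumes "x \<in> V"
  shows "x ^ (card F ^ place_degree F V) - x \<in> m"
proof -
  define d where "d = place_degree F V"
  obtain b where b: "residue_basis d b" using residue_basis_place_degree by (auto simp: d_def)
  define R where "R = (\<lambda>c. \<Sum>i<d. c i * b i) ` ({..<d} \<rightarrow>\<^sub>E F)"
  have RV: "R \<subseteq> V" using b unfolding R_def residue_basis_def by (auto intro!: lincomb_in_V)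
  have ex: "\<exists>!c. c \<in> {..<d} \<rightarrow>\<^sub>E F \<and> x - (\<Sum>i<d. c i * b i) \<in> m" if "x \<in> V" for x
    using b that by (simp add: residue_basis_def)
  have inj: "inj_on (\<lambda>c. \<Sum>i<d. c i * b i) ({..<d} \<rightarrow>\<^sub>E F)"
  proof (rule inj_onI)
    fix c e assume ce: "c \<in> {..<d} \<rightarrow>\<^sub>E F" "e \<in> {..<d} \<rightarrow>\<^sub>E F" "(\<Sum>i<d. c i * b i) = (\<Sum>i<d. e i * b i)"
    have "(\<Sum>i<d. c i * b i) \<in> V" using RV ce by (auto simp: R_def)
    moreover have "(\<Sum>i<d. c i * b i) - (\<Sum>i<d. c i * b i) \<in> m" by (simp add: ideal_0)
    ultimately show "c = e" using ex[of "\<Sum>i<d. c i * b i"] ce by metis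
  qed
  have card: "card R = card F ^ d" unfolding R_def by (simp add: card_image[OF inj] card_funcsetE)
  have "x ^ card R - x \<in> m"
  proof (rule fermat_transversal[where S = V])
    show "finite R" unfolding R_def using F_finite by (intro finite_imageI finite_PiE) auto
    fix y assume "y \<in> V"
    from ex[OF this] obtain c where c: "c \<in> {..<d} \<rightarrow>\<^sub>E F \<and> y - (\<Sum>i<d. c i * b i) \<in> m"
      and uniq: "\<forall>e. e \<in> {..<d} \<rightarrow>\<^sub>E F \<and> y - (\<Sum>i<d. e i * b i) \<in> m \<longrightarrow> e = c"
      unfolding Ex1_def by blast
    show "\<exists>!r. r \<in> R \<and> y - r \<in> m"
    proof (rule ex1I[of _ "\<Sum>i<d. c i * b i"])
      fix r assume r: "r \<in> R \<and> y - r \<in> m"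
      then obtain e where e: "e \<in> {..<d} \<rightarrow>\<^sub>E F" "r = (\<Sum>i<d. e i * b i)" by (auto simp: R_def)
      thus "r = (\<Sum>i<d. c i * b i)" using uniq r by blast
    qed (use c in \<open>auto simp: R_def\<close>)
  qed (fact RV assms is_subring_1[OF V_subring] is_subring_mult[OF V_subring] one_notin_ideal
        is_subring_diff[OF V_subring] ideal_0 ideal_add ideal_diff ideal_mult ideal_subset ideal_prime)+
  thus ?thesis by (simp add: card d_def)
qed

text \<open>A root x modulo the ideal is not congruent to an element of \<open>F\<close>, so the
  q-th power map sends it to the other root s - x, and applying the map twice returns x. But x^(q^d)
  is congruent to x, and for odd d this makes x fixed by a single application.\<close>

lemma odd_degree_no_quadratic_residue_root:
  assumes odd: "odd (place_degree F V)" and sd: "s \<in> F" "d \<in> F"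
    and no_root: "\<And>a. a \<in> F \<Longrightarrow> a^2 - s * a + d \<noteq> 0"
    and x: "x \<in> V"
  shows "x^2 - s * x + d \<notin> m"
proof
  assume root: "x^2 - s * x + d \<in> m"
  define q where "q = card F"
  have V: "s \<in> V" "d \<in> V" using sd F_subset_V by auto
  \<comment> \<open>x^q - x is the product of the x - a, so one of these factors would lie in the
    prime ideal and a would be a root in \<open>F\<close>.\<close>
  have xF: "x ^ q - x \<notin> m"
  proof
    assume "x ^ q - x \<in> m"
    hence "(\<Prod>a\<in>F. x - a) \<in> m" by (simp add: q_def finite_subfield_prod_diff[OF F_subfield F_finite])
    then obtain a where a: "a \<in> F" "x - a \<in> m"
      using ideal_prime_prod[OF F_finite, of "\<lambda>a. x - a"] x F_subset_V by (auto intro: is_subring_diff[OF V_subring])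
    have "(x + a - s) * (x - a) \<in> m"
      using a x V F_subset_V
      by (intro ideal_mult is_subring_add[OF V_subring] is_subring_diff[OF V_subring, of _ s]) auto
    hence "x^2 - s * x + d - (x + a - s) * (x - a) \<in> m" using root by (intro ideal_diff)
    also have "x^2 - s * x + d - (x + a - s) * (x - a) = a^2 - s * a + d" by (simp add: power2_eq_square algebra_simps)
    finally have "a^2 - s * a + d \<in> m" .
    moreover have "a^2 - s * a + d \<in> F" using a sd F_subfield by (intro is_subfield_intros)
    ultimately show False using F_Int_ideal no_root[OF a(1)] by blast
  qed
  have cong_power: "u ^ n - v ^ n \<in> m" if "u - v \<in> m" "u \<in> V" "v \<in> V" for u v n
  proof (induction n)
    case (Suc n)
    have "u * (u ^ n - v ^ n) + (u - v) * v ^ n \<in> m"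
      using that Suc by (intro ideal_add ideal_mult ideal_mult' is_subring_power V_subring) auto
    thus ?case by (simp add: algebra_simps)
  qed (simp add: ideal_0)
  have frob_F: "a ^ q = a" if "a \<in> F" for a
    unfolding q_def by (rule finite_subfield_fermat[OF F_subfield F_finite that])
  have xqV: "x ^ n \<in> V" for n using x V_subring by (rule is_subring_power[rotated])
  text \<open>\<open>(s - X)\<^sup>q = s - X\<^sup>q\<close>, because \<open>a \<mapsto> s - a\<close> permutes \<open>F\<close>.\<close>
  have frob_refl: "(s - x) ^ q = s - x ^ q"
  proof -
    have bij: "bij_betw (\<lambda>a. s - a) F F"
      by (rule bij_betwI[where g = "\<lambda>a. s - a"]) (auto intro: is_subfield_diff F_subfield sd)
    have "(s - x) ^ q - (s - x) = (\<Prod>a\<in>F. (s - x) - a)"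
      by (simp add: q_def finite_subfield_prod_diff[OF F_subfield F_finite])
    also have "\<dots> = (\<Prod>a\<in>F. (s - x) - (s - a))" using prod.reindex_bij_betw[OF bij, of "\<lambda>a. (s - x) - a"] by simp
    also have "\<dots> = (\<Prod>a\<in>F. (-1) * (x - a))" by (intro prod.cong) auto
    also have "\<dots> = (-1) ^ q * (x ^ q - x)"
      by (simp only: prod.distrib prod_constant q_def finite_subfield_prod_diff[OF F_subfield F_finite])
    also have "(-1) ^ q = (-1::'a)" by (rule frob_F) (intro is_subfield_intros F_subfield)
    finally show ?thesis by (simp add: algebra_simps)
  qed
  have "(x ^ q)^2 - s * x ^ q + d \<in> m"
  proof -
    have "x * (s - x) - d \<in> m" using ideal_uminus[OF root] by (simp add: power2_eq_square algebra_simps)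
    hence "(x * (s - x)) ^ q - d ^ q \<in> m" 
      using x V by (intro cong_power is_subring_mult[OF V_subring] is_subring_diff[OF V_subring, of s x])
    hence "x ^ q * (s - x ^ q) - d \<in> m" using frob_F[OF sd(2)] by (simp add: power_mult_distrib frob_refl)
    from ideal_uminus[OF this] show ?thesis by (simp add: power2_eq_square algebra_simps)
  qed
  hence "((x ^ q)^2 - s * x ^ q + d) - (x^2 - s * x + d) \<in> m" using root by (rule ideal_diff)
  hence "(x ^ q - x) * (x ^ q - (s - x)) \<in> m" by (simp add: power2_eq_square algebra_simps)
  hence conj: "x ^ q - (s - x) \<in> m"
    using ideal_prime[of "x ^ q - x" "x ^ q - (s - x)"] xF xqV x V
    by (auto intro!: is_subring_diff[OF V_subring])
  have "(x ^ q) ^ q - (s - x) ^ q \<in> m"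
    using conj xqV x V by (intro cong_power is_subring_diff[OF V_subring, of s x])
  hence "(x ^ q) ^ q - (s - x ^ q) - (x ^ q - (s - x)) \<in> m"
    using conj unfolding frob_refl by (rule ideal_diff)
  hence "x ^ (q ^ 2) - x \<in> m"
    by (simp add: power_mult[symmetric] power2_eq_square algebra_simps)
  hence sq: "y ^ (q ^ 2) - x \<in> m" if "y - x \<in> m" "y \<in> V" for y
    using ideal_add[OF cong_power[OF that x, of "q^2"]] by fastforce
  have even: "x ^ (q ^ (2 * k)) - x \<in> m" for k
  proof (induction k)
    case (Suc k)
    have "(x ^ (q ^ (2 * k))) ^ (q ^ 2) - x \<in> m" using Suc xqV by (rule sq)
    also have "(x ^ (q ^ (2 * k))) ^ (q ^ 2) = x ^ (q ^ (2 * Suc k))"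
      by (simp add: power_mult[symmetric] power_add[symmetric])
    finally show ?case .
  qed (simp add: ideal_0)
  \<comment> \<open>As the power q^2 fixes x modulo the ideal, so does q^(2k); the power q^d
    therefore acts on x as a single q.\<close>
  obtain k where k: "place_degree F V = 2 * k + 1" using odd by (rule oddE)
  have "x ^ (q ^ place_degree F V) - x \<in> m" using residue_fermat[OF x] by (simp add: q_def)
  moreover have "x ^ (q ^ place_degree F V) = (x ^ (q ^ (2 * k))) ^ q"
    by (simp add: k power_mult[symmetric] mult.commute)
  moreover have "(x ^ (q ^ (2 * k))) ^ q - x ^ q \<in> m" using even xqV x by (intro cong_power)
  ultimately have "(x ^ (q ^ (2 * k))) ^ q - x - ((x ^ (q ^ (2 * k))) ^ q - x ^ q) \<in> m"
    by (metis ideal_diff)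
  thus False using xF by simp
qed

end

subsection \<open>The complete field\<close>

locale C_inf_place = function_field_place F V for F V :: "'k::field set" +
  fixes \<iota> :: "'k \<Rightarrow> 'c::{field,complete_space}"
  assumes odd_degree: "odd (place_degree F V)" and C_inf: "is_C_inf F V \<iota>"
begin

abbreviation av :: "'c \<Rightarrow> real" where "av x \<equiv> dist x 0"

abbreviation "K \<equiv> K_inf \<iota>"

lemma \<iota>_1: "\<iota> 1 = 1"
  and \<iota>_add: "\<iota> (x + y) = \<iota> x + \<iota> y"
  and \<iota>_mult: "\<iota> (x * y) = \<iota> x * \<iota> y"
  and dist_av: "dist u v = av (u - v)"
  and av_mult: "av (u * v) = av u * av v"
  and av_\<iota>: "av (\<iota> x) = place_abs F V x"
  using C_inf by (auto simp: is_C_inf_def)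

lemma \<iota>_0: "\<iota> 0 = 0"
  using \<iota>_add[of 0 0] by (metis add_0_right add_left_cancel)

lemma \<iota>_uminus: "\<iota> (- x) = - \<iota> x"
  using \<iota>_add[of x "- x"] \<iota>_0 by (simp add: eq_neg_iff_add_eq_0 add.commute)

lemma \<iota>_diff: "\<iota> (x - y) = \<iota> x - \<iota> y"
  using \<iota>_add[of x "- y"] by (simp add: \<iota>_uminus)

lemma \<iota>_eq_0: "\<iota> x = 0 \<longleftrightarrow> x = 0"
proof
  assume "\<iota> x = 0"
  show "x = 0"
  proof (rule ccontr)
    assume "x \<noteq> 0"
    hence "\<iota> x * \<iota> (inverse x) = 1" by (simp flip: \<iota>_mult add: \<iota>_1)
    thus False using \<open>\<iota> x = 0\<close> by simp
  qed
qed (simp add: \<iota>_0)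

lemma \<iota>_eq_iff: "\<iota> x = \<iota> y \<longleftrightarrow> x = y"
  using \<iota>_eq_0[of "x - y"] by (simp add: \<iota>_diff)

lemma \<iota>_inverse: "\<iota> (inverse x) = inverse (\<iota> x)"
proof (cases "x = 0")
  case False
  hence "\<iota> x * \<iota> (inverse x) = 1" by (simp flip: \<iota>_mult add: \<iota>_1)
  thus ?thesis by (metis inverse_unique)
qed (simp add: \<iota>_0)

lemma \<iota>_divide: "\<iota> (x / y) = \<iota> x / \<iota> y"
  by (simp add: divide_inverse \<iota>_mult \<iota>_inverse)

lemma \<iota>_power: "\<iota> (x ^ n) = \<iota> x ^ n"
  by (induction n) (auto simp: \<iota>_1 \<iota>_mult)

lemma \<iota>_of_nat: "\<iota> (of_nat n) = of_nat n"
  by (induction n) (auto simp: \<iota>_0 \<iota>_1 \<iota>_add)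

lemmas \<iota>_simps = \<iota>_0 \<iota>_1 \<iota>_add \<iota>_diff \<iota>_uminus \<iota>_mult \<iota>_inverse \<iota>_divide \<iota>_power

lemma av_1: "av 1 = 1"
  using av_mult[of 1 1] by simp

lemma av_power: "av (x ^ n) = av x ^ n"
  by (induction n) (auto simp: av_1 av_mult)

lemma av_uminus: "av (- x) = av x"
  using dist_av[of 0 x] by (simp add: dist_commute)

lemma av_triangle: "av (x + y) \<le> av x + av y"
  using dist_triangle[of x "- y" 0] dist_av[of x "- y"] av_uminus[of y] by (simp add: dist_commute)

lemma av_inverse: "av (inverse x) = inverse (av x)"
proof (cases "x = 0")
  case False
  hence "av x * av (inverse x) = 1" by (simp flip: av_mult add: av_1)
  thus ?thesis by (metis inverse_unique)
qed simp

lemma av_divide: "av (x / y) = av x / av y"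
  by (simp add: divide_inverse av_mult av_inverse)

text \<open>Translation by 1 permutes \<open>F\<close>; summing its elements shows that
  \<open>card F\<close> is zero in the field, so the characteristic is positive.\<close>

lemma prime_CHAR: "prime CHAR('c)"
proof -
  have bij: "bij_betw (\<lambda>a. a + 1) F F"
    by (rule bij_betwI[where g = "\<lambda>a. a - 1"])
       (auto intro: is_subfield_add is_subfield_diff is_subfield_1 F_subfield)
  have "(\<Sum>a\<in>F. a + 1) = (\<Sum>a\<in>F. a)" using sum.reindex_bij_betw[OF bij, of "\<lambda>a. a"] .
  hence "of_nat (card F) = (0::'k)" by (simp add: sum.distrib)
  hence "of_nat (card F) = (0::'c)" using \<iota>_of_nat[of "card F"] by (simp add: \<iota>_0)
  moreover have "card F > 0" using card_subfield_ge_2[OF F_subfield F_finite] by simp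
  ultimately have "CHAR('c) > 0" by (auto simp: CHAR_pos_iff)
  thus ?thesis by (rule prime_CHAR_semidom)
qed

text \<open>In characteristic \<open>p\<close> the triangle inequality for \<open>x ^ p ^ k + y ^ p ^ k = (x + y) ^ p ^ k\<close>
  loses only a factor \<open>2\<close>, which disappears after taking the root.\<close>

lemma av_ultrametric: "av (x + y) \<le> max (av x) (av y)"
proof (rule ccontr)
  define M where "M = max (av x) (av y)"
  define p where "p = CHAR('c)"
  assume "\<not> ?thesis"
  hence less: "M < av (x + y)" unfolding M_def not_le .
  have M: "M > 0"
  proof (rule ccontr)
    assume "\<not> M > 0"
    moreover have "av x \<le> M" "av y \<le> M" by (simp_all add: M_def)
    ultimately have "av x \<le> 0" "av y \<le> 0" by linarith+
    hence "x = 0" "y = 0" by auto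
    thus False using less M_def by simp
  qed
  have p: "p \<ge> 2" unfolding p_def using prime_CHAR by (rule prime_ge_2_nat)
  define r where "r = av (x + y) / M"
  have r: "r > 1" using less M by (simp add: r_def)
  have bound: "r ^ (p ^ k) \<le> 2" for k
  proof -
    define n where "n = p ^ k"
    have "(x + y) ^ n = x ^ n + y ^ n"
      by (rule freshmans_dream'[OF prime_CHAR]) (simp add: n_def p_def)
    hence "av (x + y) ^ n = av (x ^ n + y ^ n)" by (simp flip: av_power)
    also have "\<dots> \<le> av x ^ n + av y ^ n" using av_triangle by (simp flip: av_power)
    also have "\<dots> \<le> M ^ n + M ^ n" by (intro add_mono power_mono) (auto simp: M_def)
    finally have "av (x + y) ^ n \<le> 2 * M ^ n" by simp
    thus ?thesis using M by (simp add: r_def n_def[symmetric] power_divide divide_le_eq)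
  qed
  obtain k where "2 < r ^ k" using real_arch_pow[OF r] by blast
  also have "r ^ k \<le> r ^ (p ^ k)"
    using r p less_exp[of k] power_mono[of 2 p k] by (intro power_increasing) auto
  finally show False using bound[of k] by simp
qed

lemma av_diff_le: "av (x - y) \<le> max (av x) (av y)"
  using av_ultrametric[of x "- y"] by (simp add: av_uminus)

lemma av_diff_eq: assumes "av y < av x" shows "av (x - y) = av x"
proof -
  have "av x \<le> max (av (x - y)) (av y)" using av_ultrametric[of "x - y" y] by simp
  thus ?thesis using av_diff_le[of x y] assms by auto
qed

lemma degree_pos: "place_degree F V > 0"
  using odd_degree by (cases "place_degree F V") auto

lemma av_\<iota>_unit: "x \<in> vr_units V \<Longrightarrow> av (\<iota> x) = 1"
  and av_\<iota>_outside: "x \<notin> V \<Longrightarrow> av (\<iota> x) > 1"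
  using place_abs_dichotomy[OF degree_pos] by (simp_all add: av_\<iota>)

lemma av_\<iota>_le_1_D: "av (\<iota> x) \<le> 1 \<Longrightarrow> x \<in> V"
  using av_\<iota>_outside[of x] by (cases "x \<in> V") auto

lemma av_\<iota>_less_1_D: assumes "av (\<iota> x) < 1" shows "x \<in> m"
  using assms av_\<iota>_unit[of x] av_\<iota>_le_1_D[of x] by (cases "x \<in> m") (auto simp: unit_iff)

lemma av_\<iota>_F: assumes "x \<in> F" "x \<noteq> 0" shows "av (\<iota> x) = 1"
proof (rule av_\<iota>_unit)
  have "inverse x \<in> V" "x \<in> V" using assms F_subset_V is_subfield_inverse[OF F_subfield] by auto
  thus "x \<in> vr_units V" using assms by (simp add: vr_units_def)
qed

lemma av_\<iota>_F_le: "x \<in> F \<Longrightarrow> av (\<iota> x) \<le> 1"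
  using av_\<iota>_F[of x] by (cases "x = 0") (auto simp: \<iota>_0)

section \<open>The completion as the closure of the image of the function field\<close>

lemma K_inf_iff: "x \<in> K \<longleftrightarrow> (\<forall>e>0. \<exists>k. av (\<iota> k - x) < e)"
  by (simp add: K_inf_def closure_approachable flip: dist_av)

lemma \<iota>_in_K_inf: "\<iota> k \<in> K"
  using closure_subset[of "range \<iota>"] by (auto simp: K_inf_def)

lemma K_inf_add: assumes "x \<in> K" "y \<in> K" shows "x + y \<in> K"
  unfolding K_inf_iff
proof (intro allI impI)
  fix e :: real assume e: "e > 0"
  obtain k l where kl: "av (\<iota> k - x) < e / 2" "av (\<iota> l - y) < e / 2"
    using assms e unfolding K_inf_iff by (meson half_gt_zero)
  have "\<iota> (k + l) - (x + y) = (\<iota> k - x) + (\<iota> l - y)" by (simp add: \<iota>_simps)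
  hence "av (\<iota> (k + l) - (x + y)) \<le> av (\<iota> k - x) + av (\<iota> l - y)" by (metis av_triangle)
  hence "av (\<iota> (k + l) - (x + y)) < e" using kl by linarith
  thus "\<exists>k. av (\<iota> k - (x + y)) < e" by blast
qed

text \<open>Sums, inverses and scaling by elements of the image are the operations from which the
  Moebius maps are built in \<open>moebius_in_K_inf\<close>.\<close>

lemma K_inf_scale: assumes "x \<in> K" shows "\<iota> a * x \<in> K"
  unfolding K_inf_iff
proof (intro allI impI)
  fix e :: real assume e: "e > 0"
  have pos: "av (\<iota> a) + 1 > 0" by (simp add: add_nonneg_pos)
  obtain k where k: "av (\<iota> k - x) < e / (av (\<iota> a) + 1)"
    using assms divide_pos_pos[OF e pos] unfolding K_inf_iff by blast
  have "\<iota> (a * k) - \<iota> a * x = \<iota> a * (\<iota> k - x)" by (simp add: \<iota>_simps algebra_simps)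
  hence "av (\<iota> (a * k) - \<iota> a * x) = av (\<iota> a) * av (\<iota> k - x)" by (simp add: av_mult)
  also have "\<dots> \<le> (av (\<iota> a) + 1) * av (\<iota> k - x)" by (intro mult_right_mono) auto
  also have "\<dots> < e" using k pos by (simp add: pos_less_divide_eq mult.commute)
  finally show "\<exists>k. av (\<iota> k - \<iota> a * x) < e" by blast
qed

lemma K_inf_inverse: assumes "x \<in> K" shows "inverse x \<in> K"
proof (cases "x = 0")
  case True thus ?thesis using \<iota>_in_K_inf[of 0] by (simp add: \<iota>_0)
next
  case False
  hence ax: "av x > 0" by simp
  show ?thesis
    unfolding K_inf_iff
  proof (intro allI impI)
    fix e :: real assume e: "e > 0"
    \<comment> \<open>Closer to x than \<open>av x\<close>, the ultrametric inequality forces the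
      same absolute value, so \<open>\<iota> k\<close> is nonzero and the denominator in the
      difference of inverses has absolute value \<open>av x * av x\<close>.\<close>
    define d where "d = min (av x) (e * (av x * av x))"
    have "d > 0" using ax e by (simp add: d_def)
    then obtain k where k: "av (\<iota> k - x) < d" using assms unfolding K_inf_iff by blast
    have kx: "av (\<iota> k) = av x"
    proof -
      have "av (x - (x - \<iota> k)) = av x"
      proof (rule av_diff_eq)
        show "av (x - \<iota> k) < av x" using k av_uminus[of "\<iota> k - x"] by (simp add: d_def)
      qed
      thus ?thesis by simp
    qed
    hence k0: "\<iota> k \<noteq> 0" using ax by auto
    have "inverse (\<iota> k) - inverse x = - (\<iota> k - x) / (\<iota> k * x)" using k0 False by (simp add: field_simps)
    hence "av (\<iota> (inverse k) - inverse x) = av (\<iota> k - x) / (av x * av x)"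
      by (simp only: \<iota>_simps av_divide av_uminus av_mult kx)
    also have "\<dots> < e" using k ax by (simp add: d_def divide_less_eq)
    finally show "\<exists>k. av (\<iota> k - inverse x) < e" by blast
  qed
qed

lemma K_inf_diff_\<iota>: "x \<in> K \<Longrightarrow> \<iota> a - x \<in> K"
  using K_inf_add[OF \<iota>_in_K_inf[of a] K_inf_scale[of x "- 1"]] by (simp add: \<iota>_simps)

text \<open>The root of larger absolute value is the limit of the iteration \<open>x \<mapsto> t - d / x\<close>.\<close>

lemma large_trace_root_in_K_inf:
  assumes t: "av (\<iota> t) > 1" and d: "av (\<iota> d) \<le> 1" and root: "\<epsilon>^2 - \<iota> t * \<epsilon> + \<iota> d = 0"
  shows "\<epsilon> \<in> K"
proof -
  have big: "\<epsilon> \<in> K" if \<epsilon>: "av \<epsilon> > 1" and root: "\<epsilon>^2 - \<iota> t * \<epsilon> + \<iota> d = 0" for \<epsilon>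
  proof -
    have e0: "\<epsilon> \<noteq> 0" using \<epsilon> by auto
    have "\<epsilon> * (\<epsilon> - (\<iota> t - \<iota> d / \<epsilon>)) = \<epsilon>^2 - \<iota> t * \<epsilon> + \<iota> d"
      using e0 by (simp add: algebra_simps power2_eq_square)
    hence fix_eq: "\<epsilon> = \<iota> t - \<iota> d / \<epsilon>" using root e0 by simp
    define x where "x n = ((\<lambda>y. t - d / y) ^^ n) t" for n
    have x_Suc: "x (Suc n) = t - d / x n" for n by (simp add: x_def)
    have ax: "av (\<iota> (x n)) = av (\<iota> t)" for n
    proof (induction n)
      case (Suc n)
      have "av (\<iota> d / \<iota> (x n)) \<le> 1 / av (\<iota> t)" using d t by (simp add: av_divide Suc divide_right_mono)
      also have "\<dots> < 1" using t by (subst divide_less_eq_1_pos) linarith+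
      also note t
      finally show ?case by (simp add: x_Suc \<iota>_simps av_diff_eq)
    qed (simp add: x_def)
    have conv: "av (\<iota> (x n) - \<epsilon>) \<le> av (\<iota> t - \<epsilon>) * (1 / av (\<iota> t)) ^ n" for n
    proof (induction n)
      case (Suc n)
      have x0: "\<iota> (x n) \<noteq> 0" using ax[of n] t by auto
      have "\<iota> (x (Suc n)) - \<epsilon> = \<iota> d / \<epsilon> - \<iota> d / \<iota> (x n)" by (subst fix_eq) (simp add: x_Suc \<iota>_simps)
      also have "\<dots> = \<iota> d * (\<iota> (x n) - \<epsilon>) / (\<epsilon> * \<iota> (x n))" using x0 e0 by (simp add: field_simps)
      finally have "av (\<iota> (x (Suc n)) - \<epsilon>) = av (\<iota> d) * av (\<iota> (x n) - \<epsilon>) / (av \<epsilon> * av (\<iota> t))"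
        by (simp add: av_divide av_mult ax)
      also have "\<dots> \<le> 1 * av (\<iota> (x n) - \<epsilon>) / (1 * av (\<iota> t))"
        using d \<epsilon> t by (intro frac_le mult_mono) auto
      also have "\<dots> \<le> av (\<iota> t - \<epsilon>) * (1 / av (\<iota> t)) ^ n / av (\<iota> t)"
        using Suc t by (simp add: divide_right_mono)
      finally show ?case by simp
    qed (simp add: x_def)
    show ?thesis
      unfolding K_inf_iff
    proof (intro allI impI)
      fix e :: real assume e: "e > 0"
      define B where "B = av (\<iota> t - \<epsilon>) + 1"
      have B: "B > 0" by (simp add: B_def add_nonneg_pos)
      have "1 / av (\<iota> t) < 1" using t by (subst divide_less_eq_1_pos) linarith+
      then obtain n where n: "(1 / av (\<iota> t)) ^ n < e / B"
        using real_arch_pow_inv[OF divide_pos_pos[OF e B]] by blast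
      have "av (\<iota> (x n) - \<epsilon>) \<le> B * (1 / av (\<iota> t)) ^ n"
        by (rule order_trans[OF conv], rule mult_right_mono) (simp_all add: B_def)
      also have "\<dots> < e" using n B by (simp add: pos_less_divide_eq mult.commute)
      finally show "\<exists>k. av (\<iota> k - \<epsilon>) < e" by blast
    qed
  qed
  show ?thesis
  proof (cases "av \<epsilon> > 1")
    case True thus ?thesis using big root by blast
  next
    case False
    \<comment> \<open>The two roots add up to \<open>\<iota> t\<close>, so if this one is not large,
      the other one is.\<close>
    have "av (\<iota> t) \<le> max (av (\<iota> t - \<epsilon>)) (av \<epsilon>)" using av_ultrametric[of "\<iota> t - \<epsilon>" \<epsilon>] by simp
    hence "av (\<iota> t - \<epsilon>) > 1" using t False by linarith
    moreover have "(\<iota> t - \<epsilon>)^2 - \<iota> t * (\<iota> t - \<epsilon>) + \<iota> d = 0"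
      using root by (simp add: power2_eq_square algebra_simps)
    ultimately have "\<iota> t - \<epsilon> \<in> K" by (rule big)
    from K_inf_diff_\<iota>[OF this, of t] show ?thesis by simp
  qed
qed

text \<open>If t had a pole at the place, \<epsilon> would lie in the completion by
  \<open>large_trace_root_in_K_inf\<close>. So t has no poles at all.\<close>

lemma integral_trace_constant:
  assumes "t \<in> ring_outside F V" "d \<in> F" "\<epsilon> \<notin> K" "\<epsilon>^2 - \<iota> t * \<epsilon> + \<iota> d = 0"
  shows "t \<in> F"
proof -
  have "\<not> av (\<iota> t) > 1" using assms large_trace_root_in_K_inf[of t d \<epsilon>] av_\<iota>_F_le by blast
  hence "t \<in> V" by (intro av_\<iota>_le_1_D) simp
  thus ?thesis using ring_outside_Int_place[OF function_field V_place assms(1)] by simp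
qed

text \<open>An element of the function field at distance less than 1 from \<epsilon> would be a root
  of the polynomial in the residue field, which the odd degree excludes.\<close>

lemma quadratic_constant_notin_K_inf:
  assumes td: "t \<in> F" "d \<in> F" and no_root: "\<And>a. a \<in> F \<Longrightarrow> a^2 - t * a + d \<noteq> 0"
    and root: "\<epsilon>^2 - \<iota> t * \<epsilon> + \<iota> d = 0"
  shows "\<epsilon> \<notin> K"
proof
  assume "\<epsilon> \<in> K"
  then obtain x where x: "av (\<iota> x - \<epsilon>) < 1" unfolding K_inf_iff by (meson zero_less_one)
  have \<epsilon>1: "av \<epsilon> \<le> 1"
  proof (rule ccontr)
    assume "\<not> ?thesis"
    hence gt: "av \<epsilon> > 1" by simp
    have "\<epsilon> * \<epsilon> = \<iota> t * \<epsilon> - \<iota> d" using root by (simp add: power2_eq_square algebra_simps eq_neg_iff_add_eq_0)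
    hence "av \<epsilon> * av \<epsilon> \<le> max (av (\<iota> t) * av \<epsilon>) (av (\<iota> d))"
      using av_diff_le[of "\<iota> t * \<epsilon>" "\<iota> d"] by (simp flip: av_mult)
    also have "\<dots> \<le> max (1 * av \<epsilon>) 1" using td av_\<iota>_F_le by (intro max.mono mult_right_mono) auto
    also have "\<dots> = 1 * av \<epsilon>" using gt by simp
    finally have "av \<epsilon> * av \<epsilon> \<le> 1 * av \<epsilon>" .
    moreover have "1 * av \<epsilon> < av \<epsilon> * av \<epsilon>" using gt by (intro mult_strict_right_mono) auto
    ultimately show False by linarith
  qed
  have x1: "av (\<iota> x) \<le> 1" using av_ultrametric[of "\<iota> x - \<epsilon>" \<epsilon>] x \<epsilon>1 by simp
  hence xV: "x \<in> V" by (rule av_\<iota>_le_1_D)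
  have "\<iota> (x^2 - t * x + d) = (\<iota> x - \<epsilon>) * (\<iota> x + \<epsilon> - \<iota> t) + (\<epsilon>^2 - \<iota> t * \<epsilon> + \<iota> d)"
    by (simp add: \<iota>_simps power2_eq_square algebra_simps)
  hence "av (\<iota> (x^2 - t * x + d)) = av (\<iota> x - \<epsilon>) * av (\<iota> x + \<epsilon> - \<iota> t)" using root by (simp add: av_mult)
  moreover have "av (\<iota> x + \<epsilon> - \<iota> t) \<le> 1"
    using av_diff_le[of "\<iota> x + \<epsilon>" "\<iota> t"] av_ultrametric[of "\<iota> x" \<epsilon>] x1 \<epsilon>1 av_\<iota>_F_le[OF td(1)] by linarith
  ultimately have "av (\<iota> (x^2 - t * x + d)) < 1"
    using x by (metis mult_left_le order_le_less_trans zero_le_dist)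
  hence "x^2 - t * x + d \<in> m" by (rule av_\<iota>_less_1_D)
  thus False using odd_degree_no_quadratic_residue_root[OF odd_degree td no_root xV] by blast
qed

text \<open>For an irrational root \<epsilon> of a quadratic over \<open>F\<close>, the choice S =
  \<open>F\<close> gives the field of q^2 elements and S = \<open>UNIV\<close> gives
  \<open>K_tilde\<close>.\<close>

definition quad_ext :: "'k set \<Rightarrow> 'c \<Rightarrow> 'c set" where
  "quad_ext S \<epsilon> = {\<iota> a + \<iota> b * \<epsilon> | a b. a \<in> S \<and> b \<in> S}"

lemma quad_ext_unique:
  assumes "\<epsilon> \<notin> range \<iota>" "\<iota> a + \<iota> b * \<epsilon> = \<iota> a' + \<iota> b' * \<epsilon>"
  shows "a = a' \<and> b = b'"
proof -
  have "b = b'"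
  proof (rule ccontr)
    assume "b \<noteq> b'"
    hence "\<iota> (b - b') \<noteq> 0" by (simp add: \<iota>_eq_0)
    moreover have "\<iota> (b - b') * \<epsilon> = \<iota> (a' - a)" using assms(2) by (simp add: \<iota>_simps algebra_simps)
    ultimately have "\<epsilon> = \<iota> ((a' - a) / (b - b'))" by (simp add: \<iota>_divide field_simps)
    thus False using assms(1) by blast
  qed
  thus ?thesis using assms(2) by (simp add: \<iota>_eq_iff)
qed

lemma quad_ext_subfield:
  assumes S: "is_subfield S" "t \<in> S" "d \<in> S" and \<epsilon>: "\<epsilon> \<notin> range \<iota>" "\<epsilon>^2 = \<iota> t * \<epsilon> - \<iota> d"
  shows "is_subfield (quad_ext S \<epsilon>)"
proof -
  have I: "\<iota> a + \<iota> b * \<epsilon> \<in> quad_ext S \<epsilon>" if "a \<in> S" "b \<in> S" for a b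
    using that by (auto simp: quad_ext_def)
  have mult: "(\<iota> a + \<iota> b * \<epsilon>) * (\<iota> a' + \<iota> b' * \<epsilon>)
      = \<iota> (a * a' - b * b' * d) + \<iota> (a * b' + b * a' + b * b' * t) * \<epsilon>" for a b a' b'
  proof -
    have "(\<iota> a + \<iota> b * \<epsilon>) * (\<iota> a' + \<iota> b' * \<epsilon>)
       = \<iota> a * \<iota> a' + (\<iota> a * \<iota> b' + \<iota> b * \<iota> a') * \<epsilon> + \<iota> b * \<iota> b' * \<epsilon>^2"
      by (simp add: power2_eq_square algebra_simps)
    thus ?thesis by (simp add: \<epsilon>(2) \<iota>_simps algebra_simps)
  qed
  show ?thesis
    unfolding is_subfield_def
  proof (intro conjI ballI)
    show "0 \<in> quad_ext S \<epsilon>" using I[of 0 0] S by (simp add: \<iota>_0 is_subfield_0)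
    show "1 \<in> quad_ext S \<epsilon>" using I[of 1 0] S by (simp add: \<iota>_0 \<iota>_1 is_subfield_0 is_subfield_1)
  next
    fix x y assume "x \<in> quad_ext S \<epsilon>" "y \<in> quad_ext S \<epsilon>"
    then obtain a b a' b' where xy: "x = \<iota> a + \<iota> b * \<epsilon>" "y = \<iota> a' + \<iota> b' * \<epsilon>"
      and mem: "a \<in> S" "b \<in> S" "a' \<in> S" "b' \<in> S" by (auto simp: quad_ext_def)
    have "x + y = \<iota> (a + a') + \<iota> (b + b') * \<epsilon>" by (simp add: xy \<iota>_simps algebra_simps)
    thus "x + y \<in> quad_ext S \<epsilon>" using mem S by (auto intro!: I is_subfield_add)
    have "x - y = \<iota> (a - a') + \<iota> (b - b') * \<epsilon>" by (simp add: xy \<iota>_simps algebra_simps)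
    thus "x - y \<in> quad_ext S \<epsilon>" using mem S by (auto intro!: I is_subfield_diff)
    show "x * y \<in> quad_ext S \<epsilon>" unfolding xy mult using mem S
      by (intro I is_subfield_add is_subfield_diff is_subfield_mult)
  next
    fix x assume "x \<in> quad_ext S \<epsilon>"
    then obtain a b where x: "x = \<iota> a + \<iota> b * \<epsilon>" and mem: "a \<in> S" "b \<in> S" by (auto simp: quad_ext_def)
    \<comment> \<open>N is the norm of x, and a + b t - b \<epsilon> is the conjugate of x.\<close>
    define N where "N = a^2 + t * a * b + d * b^2"
    have N: "x * (\<iota> (a + b * t) + \<iota> (- b) * \<epsilon>) = \<iota> N"
      unfolding x mult by (simp add: N_def power2_eq_square \<iota>_simps algebra_simps)
    show "inverse x \<in> quad_ext S \<epsilon>"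
    proof (cases "x = 0")
      case True thus ?thesis using I[of 0 0] S by (simp add: \<iota>_0 is_subfield_0)
    next
      case False
      have "\<iota> (a + b * t) + \<iota> (- b) * \<epsilon> \<noteq> 0"
      proof
        assume "\<iota> (a + b * t) + \<iota> (- b) * \<epsilon> = 0"
        hence "\<iota> (a + b * t) + \<iota> (- b) * \<epsilon> = \<iota> 0 + \<iota> 0 * \<epsilon>" by (simp add: \<iota>_0)
        hence "a + b * t = 0 \<and> - b = 0" by (rule quad_ext_unique[OF \<epsilon>(1)])
        hence "a = 0" "b = 0" by auto
        thus False using False by (simp add: x \<iota>_0)
      qed
      hence N0: "\<iota> N \<noteq> 0" using N False by (metis mult_eq_0_iff)
      have "x * ((\<iota> (a + b * t) + \<iota> (- b) * \<epsilon>) / \<iota> N) = 1" using N N0 by (metis divide_self times_divide_eq_right)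
      hence "inverse x = (\<iota> (a + b * t) + \<iota> (- b) * \<epsilon>) / \<iota> N" by (rule inverse_unique)
      also have "\<dots> = \<iota> ((a + b * t) / N) + \<iota> (- b / N) * \<epsilon>" by (simp add: \<iota>_simps field_simps add_divide_distrib diff_divide_distrib)
      finally show ?thesis using mem S by (auto simp: N_def intro!: I is_subfield_intros)
    qed
  qed
qed

text \<open>The right side is a subfield with q^2 elements. The left side does not mention
  \<epsilon>, so any two such \<epsilon> generate the same extension of \<open>F\<close>; this is
  what transitivity uses.\<close>

lemma quad_ext_constants:
  assumes td: "t \<in> F" "d \<in> F" and \<epsilon>: "\<epsilon> \<notin> range \<iota>" "\<epsilon>^2 = \<iota> t * \<epsilon> - \<iota> d"
  shows "{x. x ^ ((card F)\<^sup>2) = x} = quad_ext F \<epsilon>"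
proof -
  have sub: "is_subfield (quad_ext F \<epsilon>)" using F_subfield td \<epsilon> by (rule quad_ext_subfield)
  have eq: "quad_ext F \<epsilon> = (\<lambda>(a, b). \<iota> a + \<iota> b * \<epsilon>) ` (F \<times> F)" by (auto simp: quad_ext_def image_iff)
  have inj: "inj_on (\<lambda>(a, b). \<iota> a + \<iota> b * \<epsilon>) (F \<times> F)"
    using quad_ext_unique[OF \<epsilon>(1)] by (auto intro!: inj_onI)
  have "card (quad_ext F \<epsilon>) = (card F)\<^sup>2"
    by (simp add: eq card_image[OF inj] card_cartesian_product power2_eq_square)
  moreover have "finite (quad_ext F \<epsilon>)" using F_finite by (simp add: eq)
  ultimately show ?thesis using finite_subfield_roots[OF sub] by simp
qed

lemma K_tilde_eq_quad_ext:
  assumes td: "t \<in> F" "d \<in> F" and \<epsilon>: "\<epsilon> \<notin> range \<iota>" "\<epsilon>^2 = \<iota> t * \<epsilon> - \<iota> d"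
  shows "K_tilde F \<iota> = quad_ext UNIV \<epsilon>"
proof
  have sub: "is_subfield (quad_ext UNIV \<epsilon>)"
    by (rule quad_ext_subfield[OF _ _ _ \<epsilon>]) (auto simp: is_subfield_def)
  have r: "range \<iota> \<subseteq> quad_ext UNIV \<epsilon>"
  proof
    fix x assume "x \<in> range \<iota>"
    then obtain a where "x = \<iota> a + \<iota> 0 * \<epsilon>" by (auto simp: \<iota>_0)
    thus "x \<in> quad_ext UNIV \<epsilon>" unfolding quad_ext_def by blast
  qed
  have e: "{x. x ^ ((card F)\<^sup>2) = x} \<subseteq> quad_ext UNIV \<epsilon>"
    unfolding quad_ext_constants[OF td \<epsilon>] by (auto simp: quad_ext_def)
  show "K_tilde F \<iota> \<subseteq> quad_ext UNIV \<epsilon>" using sub r e by (auto simp: K_tilde_def field_gen_def)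
  have \<epsilon>E: "\<epsilon> \<in> {x. x ^ ((card F)\<^sup>2) = x}"
  proof -
    have "\<epsilon> = \<iota> 0 + \<iota> 1 * \<epsilon>" by (simp add: \<iota>_0 \<iota>_1)
    moreover have "0 \<in> F" "1 \<in> F" using F_subfield by (auto intro: is_subfield_0 is_subfield_1)
    ultimately show ?thesis unfolding quad_ext_constants[OF td \<epsilon>] quad_ext_def by blast
  qed
  show "quad_ext UNIV \<epsilon> \<subseteq> K_tilde F \<iota>"
  proof
    fix x assume "x \<in> quad_ext UNIV \<epsilon>"
    then obtain a b where x: "x = \<iota> a + \<iota> b * \<epsilon>" by (auto simp: quad_ext_def)
    have "x \<in> L" if L: "is_subfield L" "range \<iota> \<union> {x. x ^ ((card F)\<^sup>2) = x} \<subseteq> L" for L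
      unfolding x using L(2) \<epsilon>E by (intro is_subfield_add is_subfield_mult L(1)) auto
    thus "x \<in> K_tilde F \<iota>" by (auto simp: K_tilde_def field_gen_def)
  qed
qed

lemma exists_quadratic_root:
  "\<exists>\<epsilon>. \<epsilon>^2 - \<iota> t * \<epsilon> + \<iota> d = 0"
proof -
  define p where "p = [:\<iota> d, - \<iota> t, 1:]"
  have "\<iota> a \<in> K_inf_bar \<iota>" for a
    unfolding K_inf_bar_def algebraic_over_def
  proof (intro CollectI exI[of _ "[:- \<iota> a, 1:]"] conjI allI)
    fix i
    show "coeff [:- \<iota> a, 1:] i \<in> K"
      using \<iota>_in_K_inf[of "- a"] \<iota>_in_K_inf[of 1] \<iota>_in_K_inf[of 0]
      by (auto simp: coeff_pCons \<iota>_simps split: nat.splits)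
  qed auto
  from this[of d] this[of "- t"] this[of 1] this[of 0]
  have "\<forall>i. coeff p i \<in> K_inf_bar \<iota>" by (auto simp: p_def coeff_pCons \<iota>_simps split: nat.splits)
  moreover have "degree p > 0" by (simp add: p_def)
  ultimately obtain \<epsilon> where "poly p \<epsilon> = 0" using C_inf unfolding is_C_inf_def by blast
  thus ?thesis by (intro exI[of _ \<epsilon>]) (simp add: p_def power2_eq_square algebra_simps)
qed

end

subsection \<open>Two by two matrices\<close>

definition mat2 :: "'a::zero \<Rightarrow> 'a \<Rightarrow> 'a \<Rightarrow> 'a \<Rightarrow> 'a^2^2" where
  "mat2 a b c d = vector [vector [a, b], vector [c, d]]"

definition inv2 :: "'a::field^2^2 \<Rightarrow> 'a^2^2" where
  "inv2 g = mat2 (g$2$2 / det g) (- g$1$2 / det g) (- g$2$1 / det g) (g$1$1 / det g)"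

definition mat_over :: "'a set \<Rightarrow> ('a^2^2) set" where
  "mat_over R = {M. \<forall>i j. M$i$j \<in> R}"

lemma mat2_nth [simp]:
  "mat2 a b c d $ 1 $ 1 = a" "mat2 a b c d $ 1 $ 2 = b"
  "mat2 a b c d $ 2 $ 1 = c" "mat2 a b c d $ 2 $ 2 = d"
  by (simp_all add: mat2_def)

lemma mat2_eq_iff:
  "M = N \<longleftrightarrow> M$1$1 = N$1$1 \<and> M$1$2 = N$1$2 \<and> M$2$1 = N$2$1 \<and> M$2$2 = N$2$2"
  for M N :: "'a^2^2"
  by (auto simp: vec_eq_iff forall_2)

lemma mult_nth [simp]:
  fixes M N :: "'a::comm_ring_1^2^2"
  shows "(M ** N)$i$j = M$i$1 * N$1$j + M$i$2 * N$2$j"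
  by (simp add: matrix_matrix_mult_def sum_2)

lemma mat_nth [simp]:
  "(mat c :: 'a::zero^2^2)$1$1 = c" "(mat c :: 'a^2^2)$1$2 = 0"
  "(mat c :: 'a^2^2)$2$1 = 0" "(mat c :: 'a^2^2)$2$2 = c"
  by (simp_all add: mat_def)

lemma mat_over_iff:
  "M \<in> mat_over R \<longleftrightarrow> M$1$1 \<in> R \<and> M$1$2 \<in> R \<and> M$2$1 \<in> R \<and> M$2$2 \<in> R"
  by (auto simp: mat_over_def forall_2)

lemma det2_mult: "det (M ** N) = det M * det N" for M N :: "'a::field^2^2"
  by (rule det_mul)

lemma det2_mat: "det (mat c :: 'a::field^2^2) = c * c"
  by (simp add: det_2)

lemma
  fixes g :: "'a::field^2^2"
  assumes "det g \<noteq> 0"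
  shows inv2_left: "inv2 g ** g = mat 1" and inv2_right: "g ** inv2 g = mat 1"
proof -
  have D: "g$1$1 * g$2$2 / det g - g$1$2 * g$2$1 / det g = 1"
    using assms by (simp add: det_2 diff_divide_distrib[symmetric])
  show "inv2 g ** g = mat 1" "g ** inv2 g = mat 1"
    using D by (simp_all add: mat2_eq_iff inv2_def mult.commute)
qed

lemma det_inv2: "det g \<noteq> 0 \<Longrightarrow> det (inv2 g) = 1 / det g" for g :: "'a::field^2^2"
  using inv2_left[of g] det2_mult[of "inv2 g" g] by (simp add: det2_mat field_simps)

lemma inv2_inv2: "det g \<noteq> 0 \<Longrightarrow> inv2 (inv2 g) = g" for g :: "'a::field^2^2"
  by (simp add: mat2_eq_iff det_inv2 inv2_def[of "inv2 g"]) (simp add: inv2_def)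

lemma mat_over_mult: "is_subring R \<Longrightarrow> M \<in> mat_over R \<Longrightarrow> N \<in> mat_over R \<Longrightarrow> M ** N \<in> mat_over R"
  by (simp add: mat_over_iff is_subring_add is_subring_mult)

lemma mat_over_diff: "is_subring R \<Longrightarrow> M \<in> mat_over R \<Longrightarrow> N \<in> mat_over R \<Longrightarrow> M - N \<in> mat_over R"
  by (simp add: mat_over_iff is_subring_diff)

lemma mat_over_mat: "is_subring R \<Longrightarrow> c \<in> R \<Longrightarrow> mat c \<in> mat_over R"
  by (simp add: mat_over_iff is_subring_0)

lemma det_in_subring: "is_subring R \<Longrightarrow> M \<in> mat_over R \<Longrightarrow> det M \<in> R"
  by (simp add: mat_over_iff det_2 is_subring_diff is_subring_mult)

lemma GL2_mult: "M \<otimes>\<^bsub>GL2 R\<^esub> N = M ** N"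
  by (simp add: GL2_def units_of_def)

lemma GL2_one: "\<one>\<^bsub>GL2 R\<^esub> = mat 1"
  by (simp add: GL2_def units_of_def)

lemma GL2_group:
  fixes R :: "'a::field set"
  assumes R: "is_subring R"
  shows "group (GL2 R)"
proof -
  have "Group.monoid \<lparr>carrier = {M :: 'a^2^2. \<forall>i j. M $ i $ j \<in> R}, monoid.mult = (**), one = mat 1\<rparr>"
    unfolding mat_over_def[symmetric]
    by unfold_locales (use mat_over_mult[OF R] mat_over_mat[OF R is_subring_1[OF R]]
      in \<open>auto simp: matrix_mul_assoc\<close>)
  thus ?thesis unfolding GL2_def by (rule monoid.units_group)
qed

lemma GL2_carrier:
  "M \<in> carrier (GL2 R) \<longleftrightarrow> M \<in> mat_over R \<and> (\<exists>N\<in>mat_over R. N ** M = mat 1 \<and> M ** N = mat 1)"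
  by (simp add: GL2_def units_of_def Units_def mat_over_def)

lemma GL2_UNIV_carrier: "g \<in> carrier (GL2 UNIV) \<longleftrightarrow> det g \<noteq> 0"
proof
  assume "g \<in> carrier (GL2 UNIV)"
  then obtain N where "N ** g = mat 1" by (auto simp: GL2_carrier)
  hence "det N * det g = 1" using det2_mult[of N g] by (simp add: det2_mat)
  thus "det g \<noteq> 0" by auto
next
  assume "det g \<noteq> 0"
  thus "g \<in> carrier (GL2 UNIV)" using inv2_left inv2_right by (auto simp: GL2_carrier mat_over_def)
qed

lemma UNIV_subring: "is_subring UNIV"
  by (simp add: is_subring_def)

lemma GL2_UNIV_group: "group (GL2 (UNIV :: 'a::field set))"
  by (rule GL2_group[OF UNIV_subring])

lemma GL2_UNIV_inv: "det g \<noteq> 0 \<Longrightarrow> inv\<^bsub>GL2 UNIV\<^esub> g = inv2 g"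
  by (rule group.inv_equality[OF GL2_UNIV_group])
     (auto simp: GL2_mult GL2_one inv2_left GL2_UNIV_carrier det_inv2)

section \<open>Conjugation and the normalizer of GL2 over a subring\<close>

definition mconj :: "'a::field^2^2 \<Rightarrow> 'a^2^2 \<Rightarrow> 'a^2^2" where
  "mconj g M = g ** M ** inv2 g"

lemma mconj_mult: "det g \<noteq> 0 \<Longrightarrow> mconj g (M ** N) = mconj g M ** mconj g N"
  unfolding mconj_def by (metis inv2_left matrix_mul_assoc matrix_mul_rid)

lemma mconj_diff: "mconj g (M - N) = mconj g M - mconj g N"
  by (simp add: mconj_def mat2_eq_iff algebra_simps)

lemma mconj_mat: "det g \<noteq> 0 \<Longrightarrow> mconj g (mat c) = mat c"
proof -
  assume g: "det g \<noteq> 0"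
  have "g ** mat c = mat c ** g" by (simp add: mat2_eq_iff)
  thus ?thesis using inv2_right[OF g] by (simp add: mconj_def matrix_mul_assoc[symmetric])
qed

lemma mconj_eqI: "det g \<noteq> 0 \<Longrightarrow> g ** M = P ** g \<Longrightarrow> mconj g M = P"
  by (simp add: mconj_def matrix_mul_assoc[symmetric] inv2_right)

lemma mconj_inv2: "det g \<noteq> 0 \<Longrightarrow> mconj g (mconj (inv2 g) M) = M"
  unfolding mconj_def by (metis inv2_inv2 inv2_right matrix_mul_assoc matrix_mul_lid matrix_mul_rid)

text \<open>For invertible g these quotients are, up to sign, the entries of g E g^(-1) for the
  elementary matrices E. So the condition says that conjugation by g maps the matrix ring over
  \<open>R\<close> into itself.\<close>

definition products_integral :: "'a::field set \<Rightarrow> 'a^2^2 \<Rightarrow> bool" where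
  "products_integral R g \<longleftrightarrow> (\<forall>i j k l. g$i$j * g$k$l / det g \<in> R)"

lemma products_integral_mconj:
  assumes R: "is_subring R" and g: "products_integral R g" and M: "M \<in> mat_over R"
  shows "mconj g M \<in> mat_over R"
proof -
  have P: "g$i$j * g$k$l / det g * x \<in> R" if "x \<in> R" for i j k l x
    using g that unfolding products_integral_def by (intro is_subring_mult[OF R]) auto
  have eq: "mconj g M $ 1 $ 1 = g$1$1 * g$2$2 / det g * M$1$1 + g$1$2 * g$2$2 / det g * M$2$1
      - g$1$1 * g$2$1 / det g * M$1$2 - g$1$2 * g$2$1 / det g * M$2$2"
    "mconj g M $ 1 $ 2 = g$1$1 * g$1$1 / det g * M$1$2 + g$1$2 * g$1$1 / det g * M$2$2
      - g$1$1 * g$1$2 / det g * M$1$1 - g$1$2 * g$1$2 / det g * M$2$1"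
    "mconj g M $ 2 $ 1 = g$2$1 * g$2$2 / det g * M$1$1 + g$2$2 * g$2$2 / det g * M$2$1
      - g$2$1 * g$2$1 / det g * M$1$2 - g$2$2 * g$2$1 / det g * M$2$2"
    "mconj g M $ 2 $ 2 = g$2$1 * g$1$1 / det g * M$1$2 + g$2$2 * g$1$1 / det g * M$2$2
      - g$2$1 * g$1$2 / det g * M$1$1 - g$2$2 * g$1$2 / det g * M$2$1"
    by (simp_all add: mconj_def inv2_def divide_inverse algebra_simps)
  show ?thesis using M unfolding mat_over_iff eq
    by (intro conjI is_subring_add[OF R] is_subring_diff[OF R] P) auto
qed

text \<open>The conjugate of (0,1; 0,0) has as entries the products within the first column of g,
  that of (0,0; 1,0) those within the second, and that of (1,0; 0,0) the mixed ones, all up to sign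
  and division by the determinant.\<close>

lemma products_integralI:
  assumes R: "is_subring R" and "mconj g (mat2 0 1 0 0) \<in> mat_over R"
    "mconj g (mat2 0 0 1 0) \<in> mat_over R" "mconj g (mat2 1 0 0 0) \<in> mat_over R"
  shows "products_integral R g"
proof -
  have neg: "- x \<in> R \<longleftrightarrow> x \<in> R" for x using is_subring_uminus[OF R, of x] is_subring_uminus[OF R, of "- x"] by auto
  show ?thesis
    using assms(2-) unfolding products_integral_def forall_2
    by (simp add: mconj_def inv2_def mat_over_iff neg mult.commute)
qed

lemma products_integral_inv2:
  assumes "is_subring R" "products_integral R g" "det g \<noteq> 0"
  shows "products_integral R (inv2 g)"
proof -
  have neg: "- x \<in> R \<longleftrightarrow> x \<in> R" for x
    using is_subring_uminus[OF assms(1), of x] is_subring_uminus[OF assms(1), of "- x"] by auto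
  show ?thesis using assms(2,3) unfolding products_integral_def forall_2 det_inv2[OF assms(3)]
    by (simp add: inv2_def neg mult.commute)
qed

text \<open>A matrix ring containing the scalars of \<open>F\<close> and the two matrices
  \<open>(0, -d; 1, t)\<close> and \<open>(1, t; 0, -1)\<close> contains all elementary matrices if \<open>t\<^sup>2 - 4d\<close> is
  invertible.\<close>

lemma products_integral_of_generators:
  fixes g :: "'a::field^2^2"
  assumes R: "is_subring R" and g: "det g \<noteq> 0" and tdD: "t \<in> R" "d \<in> R" "1 / (t^2 - 4 * d) \<in> R" "t^2 - 4 * d \<noteq> 0"
    and X: "mconj g (mat2 0 (- d) 1 t) \<in> mat_over R" and Y: "mconj g (mat2 1 t 0 (- 1)) \<in> mat_over R"
  shows "products_integral R g"
proof -
  define C where "C = {M. mconj g M \<in> mat_over R}"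
  have Cdiff: "M - N \<in> C" if "M \<in> C" "N \<in> C" for M N
    using that R by (simp add: C_def mconj_diff mat_over_diff)
  have Cmult: "M ** N \<in> C" if "M \<in> C" "N \<in> C" for M N
    using that R g by (simp add: C_def mconj_mult mat_over_mult)
  have Cmat: "mat c \<in> C" if "c \<in> R" for c using that R g by (simp add: C_def mconj_mat mat_over_mat)
  define X where "X = mat2 0 (- d) 1 t"
  define Y where "Y = mat2 1 t 0 (- 1)"
  define D where "D = t^2 - 4 * d"
  have XY: "X \<in> C" "Y \<in> C" using assms by (auto simp: C_def X_def Y_def)
  have two: "2 \<in> R" using is_subring_add[OF R is_subring_1[OF R] is_subring_1[OF R]] by simp
  \<comment> \<open>\<open>P\<close> and \<open>Q\<close> have zero first column and second columns
    (-2d, t) and (-t, 2). These columns have determinant D = t^2 - 4d, so D times an elementary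
    matrix supported on the second column is a combination of \<open>P\<close> and
    \<open>Q\<close>.\<close>
  define P where "P = X - X ** Y"
  define Q where "Q = mat 1 - Y"
  have PQ: "P \<in> C" "Q \<in> C" using XY R by (auto simp: P_def Q_def intro!: Cdiff Cmult Cmat is_subring_1)
  have D0: "D \<noteq> 0" using tdD by (simp add: D_def)
  have E12: "mat2 0 1 0 0 = mat (1 / D) ** (mat 2 ** P - mat t ** Q)"
    using D0 by (simp add: mat2_eq_iff P_def Q_def X_def Y_def) (simp add: D_def power2_eq_square algebra_simps)
  have E22: "mat2 0 0 0 1 = mat (1 / D) ** (mat t ** P - mat 2 ** (mat d ** Q))"
    using D0 by (simp add: mat2_eq_iff P_def Q_def X_def Y_def) (simp add: D_def power2_eq_square algebra_simps)
  have E11: "mat2 1 0 0 0 = mat 1 - mat2 0 0 0 (1::'a)" by (simp add: mat2_eq_iff)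
  have E21: "mat2 0 0 1 0 = X ** Y - mat d ** mat2 0 1 0 0" by (simp add: mat2_eq_iff X_def Y_def)
  have C12: "mat2 0 1 0 0 \<in> C" unfolding E12 using PQ tdD two by (intro Cmult Cdiff Cmat) (auto simp: D_def)
  have C22: "mat2 0 0 0 1 \<in> C" unfolding E22 using PQ tdD two by (intro Cmult Cdiff Cmat) (auto simp: D_def)
  have C11: "mat2 1 0 0 0 \<in> C" unfolding E11 using C22 R by (intro Cdiff Cmat is_subring_1)
  have C21: "mat2 0 0 1 0 \<in> C" unfolding E21 using C12 XY tdD by (intro Cdiff Cmult Cmat)
  show ?thesis by (rule products_integralI[OF R]) (use C12 C11 C21 in \<open>auto simp: C_def\<close>)
qed

lemma normGL2_iff:
  assumes R: "is_subring R"
  shows "g \<in> normGL2 R \<longleftrightarrow> det g \<noteq> 0 \<and> mconj g ` carrier (GL2 R) = carrier (GL2 R)"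
proof -
  have sub: "carrier (GL2 R) \<subseteq> carrier (GL2 UNIV)"
    by (auto simp: GL2_carrier mat_over_def)
  have "g <#\<^bsub>GL2 UNIV\<^esub> carrier (GL2 R) #>\<^bsub>GL2 UNIV\<^esub> (inv\<^bsub>GL2 UNIV\<^esub> g) = mconj g ` carrier (GL2 R)"
    if "det g \<noteq> 0"
    using that by (auto simp: r_coset_def l_coset_def GL2_mult GL2_UNIV_inv mconj_def)
  thus ?thesis using sub unfolding normalizer_def stabilizer_def by (auto simp: GL2_UNIV_carrier)
qed

text \<open>Elementary matrices are differences of these matrices, or of one of them and the
  identity. A normalizing element is controlled only on invertible matrices, but conjugation is
  additive.\<close>

lemma GL2_elementary:
  assumes R: "is_subring R"
  shows "mat2 1 1 0 1 \<in> carrier (GL2 R)" "mat2 1 0 1 1 \<in> carrier (GL2 R)"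
    "mat2 1 1 1 0 \<in> carrier (GL2 R)" "mat2 0 1 1 0 \<in> carrier (GL2 R)"
proof -
  note mem = is_subring_0[OF R] is_subring_1[OF R] is_subring_uminus[OF R is_subring_1[OF R]]
  show "mat2 1 1 0 1 \<in> carrier (GL2 R)" unfolding GL2_carrier
    by (intro conjI bexI[of _ "mat2 1 (-1) 0 1"]) (simp_all add: mem mat_over_iff mat2_eq_iff)
  show "mat2 1 0 1 1 \<in> carrier (GL2 R)" unfolding GL2_carrier
    by (intro conjI bexI[of _ "mat2 1 0 (-1) 1"]) (simp_all add: mem mat_over_iff mat2_eq_iff)
  show "mat2 1 1 1 0 \<in> carrier (GL2 R)" unfolding GL2_carrier
    by (intro conjI bexI[of _ "mat2 0 1 1 (-1)"]) (simp_all add: mem mat_over_iff mat2_eq_iff)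
  show "mat2 0 1 1 0 \<in> carrier (GL2 R)" unfolding GL2_carrier
    by (intro conjI bexI[of _ "mat2 0 1 1 0"]) (simp_all add: mem mat_over_iff mat2_eq_iff)
qed

text \<open>The criterion follows from the normalizer condition through elementary matrices.
  Conversely it passes to the inverse of g, so conjugation maps the group onto itself and not merely
  into itself.\<close>

lemma normGL2_iff_products_integral:
  fixes g :: "'a::field^2^2"
  assumes R: "is_subring R"
  shows "g \<in> normGL2 R \<longleftrightarrow> det g \<noteq> 0 \<and> products_integral R g"
proof
  assume "g \<in> normGL2 R"
  hence g: "det g \<noteq> 0" "mconj g ` carrier (GL2 R) = carrier (GL2 R)" using normGL2_iff[OF R] by auto
  have over: "mconj g M \<in> mat_over R" if "M \<in> carrier (GL2 R)" for M
    using g(2) that GL2_carrier by blast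
  have diff: "mconj g (M - N) \<in> mat_over R" if "M \<in> carrier (GL2 R)" "N \<in> carrier (GL2 R)" for M N
    using over that R by (simp add: mconj_diff mat_over_diff)
  have one: "mat 1 \<in> carrier (GL2 R)"
    unfolding GL2_carrier using is_subring_1[OF R]
    by (intro conjI bexI[of _ "mat 1"]) (auto intro: mat_over_mat[OF R])
  have e: "mat2 0 1 0 0 = mat2 1 1 0 1 - mat (1::'a)" "mat2 0 0 1 0 = mat2 1 0 1 1 - mat (1::'a)"
    "mat2 1 0 0 0 = mat2 1 1 1 0 - mat2 0 1 1 (0::'a)" by (simp_all add: mat2_eq_iff)
  have "products_integral R g"
    by (rule products_integralI[OF R]; unfold e; rule diff; rule GL2_elementary[OF R] one)
  thus "det g \<noteq> 0 \<and> products_integral R g" using g by simp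
next
  assume g: "det g \<noteq> 0 \<and> products_integral R g"
  have closed: "mconj g M \<in> carrier (GL2 R)"
    if g: "det g \<noteq> 0" "products_integral R g" and M: "M \<in> carrier (GL2 R)" for g M
  proof -
    obtain N where N: "N \<in> mat_over R" "N ** M = mat 1" "M ** N = mat 1" using M by (auto simp: GL2_carrier)
    have "mconj g N ** mconj g M = mat 1" "mconj g M ** mconj g N = mat 1"
      using N g by (auto simp flip: mconj_mult simp: mconj_mat)
    thus ?thesis using products_integral_mconj[OF R g(2)] N(1) M unfolding GL2_carrier by blast
  qed
  have "mconj g ` carrier (GL2 R) = carrier (GL2 R)"
  proof
    show "mconj g ` carrier (GL2 R) \<subseteq> carrier (GL2 R)" using closed g by blast
    show "carrier (GL2 R) \<subseteq> mconj g ` carrier (GL2 R)"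
    proof
      fix M assume "M \<in> carrier (GL2 R)"
      hence "mconj (inv2 g) M \<in> carrier (GL2 R)"
        using g products_integral_inv2[OF R] by (intro closed) (auto simp: det_inv2)
      thus "M \<in> mconj g ` carrier (GL2 R)" using g by (metis image_eqI mconj_inv2)
    qed
  qed
  thus "g \<in> normGL2 R" using g normGL2_iff[OF R] by blast
qed

text \<open>Dividing by the determinant of M is multiplying by the determinant of its inverse, which
  lies in \<open>R\<close>.\<close>

lemma GL2_subset_normGL2:
  assumes R: "is_subring R" and M: "M \<in> carrier (GL2 R)"
  shows "M \<in> normGL2 R"
proof -
  obtain N where N: "N \<in> mat_over R" "N ** M = mat 1" using M by (auto simp: GL2_carrier)
  have "det N * det M = 1" using det2_mult[of N M] N by (simp add: det2_mat)
  hence nz: "det M \<noteq> 0" by auto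
  hence inv: "1 / det M = det N" using \<open>det N * det M = 1\<close> by (metis nonzero_eq_divide_eq)
  have "M $ i $ j * M $ k $ l * det N \<in> R" for i j k l
    using M N by (intro is_subring_mult[OF R] det_in_subring[OF R]) (auto simp: GL2_carrier mat_over_def)
  hence "products_integral R M"
    unfolding products_integral_def using inv by (metis mult.right_neutral times_divide_eq_right)
  thus ?thesis using nz normGL2_iff_products_integral[OF R] by blast
qed

subsection \<open>Elliptic points\<close>

context C_inf_place
begin

abbreviation "A \<equiv> ring_outside F V"

lemma A_subring: "is_subring A"
  by (rule ring_outside_subring[OF F_subfield])

lemma F_subset_A: "F \<subseteq> A"
  by (rule F_subset_ring_outside)

text \<open>Units of \<open>A\<close> are constants, so the determinant is a nonzero element of
  \<open>F\<close>; conversely the formula for the inverse divides only by such an element.\<close>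

lemma GL2_A_iff: "M \<in> carrier (GL2 A) \<longleftrightarrow> M \<in> mat_over A \<and> det M \<in> F \<and> det M \<noteq> 0"
proof
  assume M: "M \<in> carrier (GL2 A)"
  then obtain N where N: "M \<in> mat_over A" "N \<in> mat_over A" "M ** N = mat 1" by (auto simp: GL2_carrier)
  have "det M * det N = 1" using det2_mult[of M N] N by (simp add: det2_mat)
  hence "inverse (det M) = det N" "det M \<noteq> 0" by (auto intro: inverse_unique)
  moreover have "det M \<in> A" "det N \<in> A" using N det_in_subring[OF A_subring] by auto
  ultimately show "M \<in> mat_over A \<and> det M \<in> F \<and> det M \<noteq> 0"
    using N ring_outside_unit[OF function_field V_place, of "det M"] by simp
next
  assume M: "M \<in> mat_over A \<and> det M \<in> F \<and> det M \<noteq> 0"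
  have "1 / det M \<in> A"
    using M by (intro subsetD[OF F_subset_A] is_subfield_divide is_subfield_1 F_subfield) auto
  hence "x / det M \<in> A" "- x / det M \<in> A" if "x \<in> A" for x
    using is_subring_mult[OF A_subring that] is_subring_mult[OF A_subring is_subring_uminus[OF A_subring that]]
    by (metis mult.right_neutral times_divide_eq_right)+
  hence "inv2 M \<in> mat_over A" using M by (simp add: mat_over_iff inv2_def)
  thus "M \<in> carrier (GL2 A)" using M inv2_left[of M] inv2_right[of M] unfolding GL2_carrier by blast
qed

text \<open>\<open>num M w\<close> and \<open>den M w\<close> are the coordinates of M applied to
  the vector (w, 1); keeping them apart avoids division. If M fixes w, then \<open>den M w\<close>
  is the eigenvalue belonging to this vector.\<close>

definition num :: "'k^2^2 \<Rightarrow> 'c \<Rightarrow> 'c" where "num M w = \<iota> (M$1$1) * w + \<iota> (M$1$2)"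
definition den :: "'k^2^2 \<Rightarrow> 'c \<Rightarrow> 'c" where "den M w = \<iota> (M$2$1) * w + \<iota> (M$2$2)"

lemma moebius_num_den: "moebius_act \<iota> M w = num M w / den M w"
  by (simp add: moebius_act_def num_def den_def)

lemma linear_unique:
  assumes "w \<notin> range \<iota>" "\<iota> a * w + \<iota> b = \<iota> a' * w + \<iota> b'"
  shows "a = a'" "b = b'"
  using quad_ext_unique[OF assms(1), of b a b' a'] assms(2) by (auto simp: add.commute)

lemma num_den_unique:
  assumes "w \<notin> range \<iota>" "num M w = num N w" "den M w = den N w"
  shows "M = N"
  using linear_unique[OF assms(1) assms(2)[unfolded num_def]] linear_unique[OF assms(1) assms(3)[unfolded den_def]]
  by (simp add: mat2_eq_iff)

lemma den_nonzero: assumes "det M \<noteq> 0" "w \<notin> range \<iota>" shows "den M w \<noteq> 0"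
proof
  assume "den M w = 0"
  hence "\<iota> (M$2$1) * w + \<iota> (M$2$2) = \<iota> 0 * w + \<iota> 0" by (simp add: den_def \<iota>_0)
  hence "M$2$1 = 0" "M$2$2 = 0" using linear_unique[OF assms(2)] by blast+
  thus False using assms(1) by (simp add: det_2)
qed

lemma moebius_eq_iff:
  assumes "det M \<noteq> 0" "w \<notin> range \<iota>"
  shows "moebius_act \<iota> M w = z \<longleftrightarrow> num M w = z * den M w"
  using den_nonzero[OF assms] by (simp add: moebius_num_den divide_eq_eq)

lemma moebius_notin_range: assumes "det M \<noteq> 0" "w \<notin> range \<iota>" shows "moebius_act \<iota> M w \<notin> range \<iota>"
proof
  assume "moebius_act \<iota> M w \<in> range \<iota>"
  then obtain z where "moebius_act \<iota> M w = \<iota> z" by auto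
  hence "num M w = \<iota> z * den M w" using moebius_eq_iff[OF assms] by simp
  hence "\<iota> (M$1$1) * w + \<iota> (M$1$2) = \<iota> (z * M$2$1) * w + \<iota> (z * M$2$2)"
    by (simp add: num_def den_def \<iota>_simps algebra_simps)
  hence "M$1$1 = z * M$2$1" "M$1$2 = z * M$2$2" using linear_unique[OF assms(2)] by blast+
  thus False using assms(1) by (simp add: det_2)
qed

lemma num_den_mult:
  "num (M ** N) w = \<iota> (M$1$1) * num N w + \<iota> (M$1$2) * den N w"
  "den (M ** N) w = \<iota> (M$2$1) * num N w + \<iota> (M$2$2) * den N w"
  by (simp_all add: num_def den_def \<iota>_simps algebra_simps)

lemma moebius_mult:
  assumes "det M \<noteq> 0" "det N \<noteq> 0" "w \<notin> range \<iota>"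
  shows "moebius_act \<iota> (M ** N) w = moebius_act \<iota> M (moebius_act \<iota> N w)"
proof -
  have "den N w \<noteq> 0" using den_nonzero assms by simp
  hence "num N w = moebius_act \<iota> N w * den N w" by (simp add: moebius_num_den)
  hence "num (M ** N) w = num M (moebius_act \<iota> N w) * den N w" "den (M ** N) w = den M (moebius_act \<iota> N w) * den N w"
    unfolding num_den_mult by (simp_all add: num_def[of M] den_def[of M] algebra_simps)
  thus ?thesis using \<open>den N w \<noteq> 0\<close> by (simp add: moebius_num_den)
qed

lemma moebius_mat: assumes "c \<noteq> 0" shows "moebius_act \<iota> (mat c) w = w"
  using assms by (simp add: moebius_act_def \<iota>_0 \<iota>_eq_0)

lemma moebius_inv2:
  assumes "det g \<noteq> 0" "w \<notin> range \<iota>"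
  shows "moebius_act \<iota> (inv2 g) (moebius_act \<iota> g w) = w"
  using moebius_mult[of "inv2 g" g w] assms by (simp add: det_inv2 inv2_left moebius_mat)

text \<open>Splitting off the constant r = M11 / M21 leaves a constant times the inverse of an
  affine expression.\<close>

lemma moebius_in_K_inf: assumes "z \<in> K" shows "moebius_act \<iota> M z \<in> K"
proof (cases "den M z = 0")
  \<comment> \<open>Division by zero yields 0, which lies in the completion.\<close>
  case True thus ?thesis using \<iota>_in_K_inf[of 0] by (simp add: moebius_num_den \<iota>_0)
next
  case den: False
  have denK: "den M z \<in> K" unfolding den_def using assms by (intro K_inf_add K_inf_scale \<iota>_in_K_inf)
  show ?thesis
  proof (cases "M$2$1 = 0")
    case True
    hence "moebius_act \<iota> M z = \<iota> (1 / M$2$2) * num M z" by (simp add: moebius_num_den den_def \<iota>_simps)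
    thus ?thesis unfolding num_def using assms by (auto intro!: K_inf_add K_inf_scale \<iota>_in_K_inf)
  next
    case False
    define r where "r = M$1$1 / M$2$1"
    have "num M z = \<iota> r * den M z + \<iota> (M$1$2 - r * M$2$2)"
    proof -
      have "M$1$1 = r * M$2$1" using False by (simp add: r_def)
      thus ?thesis by (simp add: num_def den_def \<iota>_simps algebra_simps)
    qed
    hence "moebius_act \<iota> M z = \<iota> r + \<iota> (M$1$2 - r * M$2$2) * inverse (den M z)"
      using den by (simp add: moebius_num_den field_simps)
    thus ?thesis using denK by (auto intro!: K_inf_add K_inf_scale \<iota>_in_K_inf K_inf_inverse)
  qed
qed

lemma Omega_iff: "w \<in> Omega \<iota> \<longleftrightarrow> w \<notin> K"
  by (simp add: Omega_def)

lemma Omega_notin_range: "w \<in> Omega \<iota> \<Longrightarrow> w \<notin> range \<iota>"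
  using \<iota>_in_K_inf by (auto simp: Omega_iff)

lemma moebius_in_Omega:
  assumes "det g \<noteq> 0" "w \<in> Omega \<iota>" shows "moebius_act \<iota> g w \<in> Omega \<iota>"
  using assms moebius_in_K_inf[of "moebius_act \<iota> g w" "inv2 g"] moebius_inv2[OF assms(1) Omega_notin_range]
  by (auto simp: Omega_iff)

section \<open>Matrices over \<open>A\<close> with a fixed point in the upper half plane\<close>

lemma eigenvalue_quadratic:
  assumes "num M w = w * den M w"
  shows "(den M w)^2 = \<iota> (M$1$1 + M$2$2) * den M w - \<iota> (det M)"
proof -
  have "(den M w)^2 - (\<iota> (M$1$1 + M$2$2) * den M w - \<iota> (det M)) = \<iota> (M$2$1) * (w * den M w - num M w)"
    by (simp add: num_def den_def det_2 \<iota>_simps power2_eq_square algebra_simps)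
  thus ?thesis using assms by simp
qed

lemma fixing_nonscalar:
  assumes "det M \<noteq> 0" "M \<notin> scalars" "w \<notin> range \<iota>" "moebius_act \<iota> M w = w"
  shows "M$2$1 \<noteq> 0"
proof
  assume c: "M$2$1 = 0"
  have "num M w = w * den M w" using assms moebius_eq_iff by simp
  hence "\<iota> (M$1$1) * w + \<iota> (M$1$2) = \<iota> (M$2$2) * w + \<iota> 0" using c by (simp add: num_def den_def \<iota>_0 mult.commute)
  hence "M$1$1 = M$2$2" "M$1$2 = 0" using linear_unique[OF assms(3)] by blast+
  hence "M = mat (M$1$1)" using c by (simp add: mat2_eq_iff)
  moreover have "M$1$1 \<noteq> 0" using assms(1) c by (auto simp: det_2)
  ultimately show False using assms(2) by (auto simp: scalars_def)
qed

lemma den_notin_K_inf: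
  assumes "M$2$1 \<noteq> 0" "w \<in> Omega \<iota>" shows "den M w \<notin> K"
proof
  assume "den M w \<in> K"
  hence "\<iota> (M$2$2) - den M w \<in> K" by (rule K_inf_diff_\<iota>)
  hence "\<iota> (- 1 / M$2$1) * (\<iota> (M$2$2) - den M w) \<in> K" by (rule K_inf_scale)
  also have "\<iota> (- 1 / M$2$1) * (\<iota> (M$2$2) - den M w) = w"
    using assms(1) by (simp add: den_def \<iota>_simps \<iota>_eq_0)
  finally show False using assms(2) by (simp add: Omega_iff)
qed

text \<open>For a non-scalar M the eigenvalue lies outside the completion, and
  \<open>integral_trace_constant\<close> applies. For a scalar c, the determinant c^2 is a unit of
  \<open>A\<close>, hence so is c.\<close>

lemma fixing_trace:
  assumes M: "M \<in> carrier (GL2 A)" and w: "w \<in> Omega \<iota>" "moebius_act \<iota> M w = w"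
  shows "M$1$1 + M$2$2 \<in> F"
proof (cases "M \<in> scalars")
  case True
  then obtain c where c: "M = mat c" "c \<noteq> 0" by (auto simp: scalars_def)
  have M': "c \<in> A" "c * c \<in> F" using M c by (auto simp: GL2_A_iff mat_over_iff det2_mat)
  have "1 / (c * c) \<in> A"
    using M' by (intro subsetD[OF F_subset_A] is_subfield_divide is_subfield_1 F_subfield) auto
  hence "c * (1 / (c * c)) \<in> A" using M' A_subring by (blast intro: is_subring_mult)
  hence "inverse c \<in> A" using c by (simp add: field_simps)
  hence "c \<in> F" using M' ring_outside_unit[OF function_field V_place] by blast
  thus ?thesis unfolding c(1) mat_nth by (intro is_subfield_add F_subfield)
next
  case False
  have M': "M \<in> mat_over A" "det M \<in> F" "det M \<noteq> 0" using M by (auto simp: GL2_A_iff)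
  have c: "M$2$1 \<noteq> 0" using fixing_nonscalar[OF M'(3) False Omega_notin_range[OF w(1)] w(2)] .
  have "num M w = w * den M w" using moebius_eq_iff[OF M'(3) Omega_notin_range[OF w(1)], of w] w(2) by blast
  from eigenvalue_quadratic[OF this]
  have "(den M w)^2 - \<iota> (M$1$1 + M$2$2) * den M w + \<iota> (det M) = 0" by simp
  moreover have "M$1$1 + M$2$2 \<in> A" using M' A_subring by (auto simp: mat_over_iff intro: is_subring_add)
  ultimately show ?thesis using integral_trace_constant M'(2) den_notin_K_inf[OF c w(1)] by blast
qed

text \<open>A witness that w is elliptic, stored in the form used below: being non-scalar becomes a
  nonzero lower left entry, the fixed point equation is free of division, and the constant trace is
  included.\<close>

definition elliptic_matrix :: "'k^2^2 \<Rightarrow> 'c \<Rightarrow> bool" where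
  "elliptic_matrix M w \<longleftrightarrow> w \<in> Omega \<iota> \<and> M \<in> carrier (GL2 A) \<and> M$2$1 \<noteq> 0 \<and> num M w = w * den M w \<and>
     M$1$1 + M$2$2 \<in> F"

lemma elliptic_points_iff: "w \<in> elliptic_points A \<iota> \<longleftrightarrow> (\<exists>M. elliptic_matrix M w)"
proof
  assume "w \<in> elliptic_points A \<iota>"
  then obtain M where M: "w \<in> Omega \<iota>" "M \<in> carrier (GL2 A)" "M \<notin> scalars" "moebius_act \<iota> M w = w"
    by (auto simp: elliptic_points_def)
  have "det M \<noteq> 0" using M by (simp add: GL2_A_iff)
  thus "\<exists>M. elliptic_matrix M w"
    using M fixing_trace[OF M(2,1,4)] fixing_nonscalar[OF _ M(3) Omega_notin_range[OF M(1)] M(4)]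
      moebius_eq_iff[OF _ Omega_notin_range[OF M(1)], of M w]
    by (auto simp: elliptic_matrix_def)
next
  assume "\<exists>M. elliptic_matrix M w"
  then obtain M where M: "elliptic_matrix M w" ..
  hence "det M \<noteq> 0" by (simp add: elliptic_matrix_def GL2_A_iff)
  hence "moebius_act \<iota> M w = w" using M moebius_eq_iff[OF _ Omega_notin_range, of M w w] by (simp add: elliptic_matrix_def)
  moreover have "M \<notin> scalars" using M by (auto simp: elliptic_matrix_def scalars_def)
  ultimately show "w \<in> elliptic_points A \<iota>" using M by (auto simp: elliptic_matrix_def elliptic_points_def)
qed

lemma elliptic_point_Omega: "w \<in> elliptic_points A \<iota> \<Longrightarrow> w \<in> Omega \<iota>"
  by (simp add: elliptic_points_def)

text \<open>The roots of the characteristic polynomial are \<epsilon> and t - \<epsilon>, both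
  outside the image of the function field. Having no root in \<open>F\<close>, it has a nonzero
  discriminant, in characteristic two as well.\<close>

lemma elliptic_matrix_facts:
  assumes "elliptic_matrix M w"
  defines "t \<equiv> M$1$1 + M$2$2" and "d \<equiv> det M" and "\<epsilon> \<equiv> den M w"
  shows "w \<in> Omega \<iota>" "w \<notin> range \<iota>" "M \<in> mat_over A" "t \<in> F" "d \<in> F" "d \<noteq> 0" "\<epsilon> \<notin> K" "\<epsilon> \<notin> range \<iota>"
    "\<epsilon>^2 = \<iota> t * \<epsilon> - \<iota> d" "\<And>k. k^2 - t * k + d \<noteq> 0" "t^2 - 4 * d \<noteq> 0"
proof -
  show *: "w \<in> Omega \<iota>" "w \<notin> range \<iota>" "M \<in> mat_over A" "t \<in> F" "d \<in> F" "d \<noteq> 0"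
    using assms(1) by (auto simp: elliptic_matrix_def GL2_A_iff t_def d_def dest: Omega_notin_range)
  show e: "\<epsilon> \<notin> K" using assms(1) den_notin_K_inf by (simp add: elliptic_matrix_def \<epsilon>_def)
  thus er: "\<epsilon> \<notin> range \<iota>" using \<iota>_in_K_inf by auto
  show e2: "\<epsilon>^2 = \<iota> t * \<epsilon> - \<iota> d"
    using eigenvalue_quadratic assms(1) by (simp add: elliptic_matrix_def \<epsilon>_def t_def d_def)
  show nr: "k^2 - t * k + d \<noteq> 0" for k
  proof
    assume k: "k^2 - t * k + d = 0"
    have "(\<epsilon> - \<iota> k) * (\<epsilon> - \<iota> (t - k)) = \<epsilon>^2 - \<iota> t * \<epsilon> + \<iota> d - \<iota> (k^2 - t * k + d)"
      by (simp add: \<iota>_simps power2_eq_square algebra_simps)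
    hence "(\<epsilon> - \<iota> k) * (\<epsilon> - \<iota> (t - k)) = 0" by (simp add: e2 k \<iota>_0)
    hence "\<epsilon> = \<iota> k \<or> \<epsilon> = \<iota> (t - k)" by auto
    thus False using er by auto
  qed
  show "t^2 - 4 * d \<noteq> 0"
    using finite_subfield_no_root_discriminant[OF F_subfield F_finite *(4,5)] nr by blast
qed

subsection \<open>Freeness\<close>

lemma GL2_A_scalar_multiple_in_ZG:
  assumes "N \<in> carrier (GL2 A)" "c \<noteq> 0" "g = mat c ** N"
  shows "g \<in> ZG A"
  using assms by (auto simp: set_mult_def scalars_def GL2_mult)

lemma normGL2_stabilizer:
  assumes g: "g \<in> normGL2 A" and w: "w \<in> elliptic_points A \<iota>" "moebius_act \<iota> g w = w"
  shows "g \<in> ZG A"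
proof -
  define D where "D = det g"
  define T where "T = g$1$1 + g$2$2"
  have gD: "D \<noteq> 0" and gp: "products_integral A g"
    using g normGL2_iff_products_integral[OF A_subring] by (auto simp: D_def)
  have prods: "g$i$j * g$k$l / D \<in> A" for i j k l using gp by (simp add: products_integral_def D_def)
  have D2: "D = g$1$1 * g$2$2 - g$1$2 * g$2$1" by (simp add: D_def det_2)
  define h where "h = mat (1 / D) ** (g ** g)"
  have h_nth: "h$i$j = g$i$1 * g$1$j / D + g$i$2 * g$2$j / D" for i j
  proof -
    have "h$i$j = 1 / D * (g ** g)$i$j"
      by (cases i rule: exhaust_2[THEN disjE]) (auto simp: h_def)
    thus ?thesis by (simp add: add_divide_distrib)
  qed
  have hD: "h$i$j * D = g$i$1 * g$1$j + g$i$2 * g$2$j" for i j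
    using gD by (simp add: h_nth distrib_right)
  have hA: "h \<in> mat_over A" unfolding mat_over_def using prods by (auto simp: h_nth intro!: is_subring_add[OF A_subring])
  have dh: "det h = 1" using gD by (simp add: h_def det2_mult det2_mat D_def)
  have hG: "h \<in> carrier (GL2 A)" using hA dh F_subfield by (simp add: GL2_A_iff is_subfield_1)
  have wO: "w \<in> Omega \<iota>" and wr: "w \<notin> range \<iota>" using w elliptic_point_Omega Omega_notin_range by auto
  have "moebius_act \<iota> h w = w"
    unfolding h_def using gD wr w(2)
    by (simp add: moebius_mult det2_mat det2_mult D_def[symmetric] moebius_notin_range moebius_mat)
  hence trh: "h$1$1 + h$2$2 \<in> F" using fixing_trace[OF hG wO] by simp
  \<comment> \<open>By Cayley-Hamilton h + 1 = (T / D) g, so both tr h + 2 and det (h + 1) are equal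
    to T^2 / D.\<close>
  have trh_eq: "h$1$1 + h$2$2 + 2 = T^2 / D"
  proof -
    have "(h$1$1 + h$2$2 + 2) * D = h$1$1 * D + h$2$2 * D + 2 * D" by (simp only: distrib_right)
    also have "\<dots> = T^2" unfolding hD by (simp add: D2 T_def power2_eq_square algebra_simps)
    finally have "(h$1$1 + h$2$2 + 2) * D = T^2" .
    thus ?thesis using gD by (simp add: nonzero_eq_divide_eq)
  qed
  show ?thesis
  proof (cases "T = 0")
    case False
    define N where "N = mat2 (h$1$1 + 1) (h$1$2) (h$2$1) (h$2$2 + 1)"
    have N_eq: "N = mat (T / D) ** g"
    proof -
      have "N$1$1 * D = T * g$1$1" "N$1$2 * D = T * g$1$2" "N$2$1 * D = T * g$2$1" "N$2$2 * D = T * g$2$2"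
        unfolding N_def mat2_nth distrib_right hD by (simp_all add: D2 T_def algebra_simps)
      hence "N$1$1 = T * g$1$1 / D" "N$1$2 = T * g$1$2 / D" "N$2$1 = T * g$2$1 / D" "N$2$2 = T * g$2$2 / D"
        using gD by (simp_all add: nonzero_eq_divide_eq)
      thus ?thesis by (simp add: mat2_eq_iff)
    qed
    have "det N = T^2 / D" using gD by (simp add: N_eq det2_mult det2_mat power2_eq_square D_def[symmetric])
    hence "det N \<in> F" "det N \<noteq> 0"
      using trh trh_eq[symmetric] F_subfield False gD by (auto intro: is_subfield_add is_subfield_numeral)
    moreover have "N \<in> mat_over A"
      using hA A_subring by (auto simp: mat_over_iff N_def intro: is_subring_add is_subring_1)
    ultimately have "N \<in> carrier (GL2 A)" by (simp add: GL2_A_iff)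
    moreover have "g = mat (D / T) ** N" using gD False by (simp add: N_eq mat2_eq_iff)
    ultimately show ?thesis using gD False by (intro GL2_A_scalar_multiple_in_ZG[of N "D / T"]) auto
  next
    case T0: True
    obtain M where M: "elliptic_matrix M w" using w elliptic_points_iff by auto
    define t where "t = M$1$1 + M$2$2"
    define d where "d = det M"
    note facts = elliptic_matrix_facts[OF M, folded t_def d_def]
    have c0: "M$2$1 \<noteq> 0" and Mw: "num M w = w * den M w" using M by (auto simp: elliptic_matrix_def)
    have gw: "num g w = w * den g w" using moebius_eq_iff[of g w w] wr w(2) gD by (simp add: D_def)
    \<comment> \<open>\<alpha> and \<beta> match the bottom row of g with that of \<alpha> + \<beta>
      M. As both matrices have (w, 1) as an eigenvector, the top rows agree as well.\<close>
    define \<beta> where "\<beta> = g$2$1 / M$2$1"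
    define \<alpha> where "\<alpha> = g$2$2 - \<beta> * M$2$2"
    define g' where "g' = mat2 (\<alpha> + \<beta> * M$1$1) (\<beta> * M$1$2) (\<beta> * M$2$1) (\<alpha> + \<beta> * M$2$2)"
    have row2: "g$2$1 = \<beta> * M$2$1" "g$2$2 = \<alpha> + \<beta> * M$2$2" using c0 by (auto simp: \<beta>_def \<alpha>_def)
    have den_eq: "den g' w = den g w" by (simp add: g'_def den_def row2)
    have "num g' w = \<iota> \<alpha> * w + \<iota> \<beta> * num M w" by (simp add: g'_def num_def \<iota>_simps algebra_simps)
    also have "\<dots> = w * (\<iota> \<alpha> + \<iota> \<beta> * den M w)" by (simp add: Mw algebra_simps)
    also have "\<iota> \<alpha> + \<iota> \<beta> * den M w = den g w" by (simp add: den_def row2 \<iota>_simps algebra_simps)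
    finally have "num g' w = num g w" using gw by simp
    hence g_eq: "g = g'" using num_den_unique[OF wr] den_eq by metis
    have tr: "2 * \<alpha> + \<beta> * t = 0" using T0 by (simp add: T_def g_eq g'_def t_def algebra_simps)
    show ?thesis
    proof (cases "(2::'k) = 0")
      case True
      \<comment> \<open>In characteristic two the discriminant is t^2, so t is nonzero; the
        vanishing trace then forces \<beta> = 0, and g is scalar.\<close>
      hence "(4::'k) = 0" by (metis mult_zero_left mult_2 numeral_Bit0)
      hence "t \<noteq> 0" using facts(11) by auto
      hence "\<beta> = 0" using tr True by simp
      hence "g = mat \<alpha> ** mat 1" by (simp add: g_eq g'_def mat2_eq_iff)
      moreover have "\<alpha> \<noteq> 0" using gD \<open>\<beta> = 0\<close> by (auto simp: D_def g_eq g'_def det_2)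
      moreover have "mat 1 \<in> carrier (GL2 A)"
        using F_subfield A_subring by (auto simp: GL2_A_iff det2_mat is_subfield_1 intro: mat_over_mat is_subring_1)
      ultimately show ?thesis by (intro GL2_A_scalar_multiple_in_ZG[of "mat 1" \<alpha>]) auto
    next
      case two: False
      \<comment> \<open>The trace zero element 2 M - t; its determinant is minus the discriminant, a
        nonzero constant.\<close>
      define N where "N = mat2 (2 * M$1$1 - t) (2 * M$1$2) (2 * M$2$1) (2 * M$2$2 - t)"
      have "2 \<in> F" using F_subfield by (rule is_subfield_numeral)
      hence "N \<in> mat_over A" using facts(3,4) A_subring F_subset_A
        by (auto simp: mat_over_iff N_def intro!: is_subring_diff is_subring_mult)
      moreover have "det N = - (t^2 - 4 * d)"
        by (simp add: N_def det_2 t_def d_def power2_eq_square algebra_simps)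
      ultimately have NG: "N \<in> carrier (GL2 A)"
        using facts(4,5,11) F_subfield by (auto simp: GL2_A_iff intro!: is_subfield_intros)
      have \<alpha>: "\<alpha> = - (\<beta> * t) / 2" using tr two by (simp add: field_simps eq_neg_iff_add_eq_0)
      have g_N: "g = mat (\<beta> / 2) ** N"
        using two by (simp add: g_eq g'_def N_def mat2_eq_iff \<alpha> field_simps)
      moreover have "\<beta> \<noteq> 0" using gD by (auto simp: D_def g_N det2_mult det2_mat)
      ultimately show ?thesis using NG two by (intro GL2_A_scalar_multiple_in_ZG[of N "\<beta> / 2"]) auto
    qed
  qed
qed

subsection \<open>Transitivity\<close>

text \<open>The matrices \<open>M\<close> and \<open>h\<close> generate a quaternion algebra over \<open>F\<close>, which is split since \<open>F\<close>
  is finite: multiplying \<open>h\<close> by an element of \<open>F[M]\<close> of norm \<open>- 1 / det h\<close> gives an involution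
  \<open>h'\<close>. For a fixed vector \<open>u\<close> of \<open>h'\<close> the basis \<open>u, M u\<close> conjugates the algebra to the
  matrix algebra over \<open>F\<close>.\<close>

lemma exists_normalizer_of_conjugation:
  assumes M: "elliptic_matrix M w" and h: "h \<in> carrier (GL2 A)"
    and conj: "h ** M = (mat (M$1$1 + M$2$2) - M) ** h"
  defines "t \<equiv> M$1$1 + M$2$2" and "d \<equiv> det M"
  shows "\<exists>g\<in>normGL2 A. g ** mat2 0 (- d) 1 t = M ** g"
proof -
  note facts = elliptic_matrix_facts[OF M, folded t_def d_def]
  define a b c e where "a = M$1$1" and "b = M$1$2" and "c = M$2$1" and "e = M$2$2"
  have c0: "c \<noteq> 0" using M by (simp add: elliptic_matrix_def c_def)
  have td: "t = a + e" "d = a * e - b * c" by (simp_all add: t_def d_def det_2 a_def b_def c_def e_def)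
  have MA: "a \<in> A" "b \<in> A" "c \<in> A" "e \<in> A"
    using facts(3) by (auto simp: mat_over_iff a_def b_def c_def e_def)
  have FA: "t \<in> A" "d \<in> A" using facts F_subset_A by auto
  define p r s v where "p = h$1$1" and "r = h$1$2" and "s = h$2$1" and "v = h$2$2"
  have hA: "p \<in> A" "r \<in> A" "s \<in> A" "v \<in> A"
    and dh: "p * v - r * s \<in> F" "p * v - r * s \<noteq> 0"
    using h by (auto simp: GL2_A_iff mat_over_iff det_2 p_def r_def s_def v_def)
  have rel: "p * a + r * c = e * p - b * s" "s * a + v * c = - c * p + a * s"
    using conj by (auto simp: mat2_eq_iff a_def b_def c_def e_def p_def r_def s_def v_def algebra_simps)
  \<comment> \<open>The lower left entry of the conjugation relation makes h traceless.\<close>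
  have "c * (p + v) = 0" using rel(2) by (simp add: algebra_simps)
  hence v: "v = - p" using c0 by (simp add: eq_neg_iff_add_eq_0 add.commute)
  have rel1: "p * (a - e) + r * c + b * s = 0" using rel(1) by (simp add: algebra_simps)
  define \<Delta> where "\<Delta> = - (p * p) - r * s"
  have \<Delta>: "\<Delta> \<in> F" "\<Delta> \<noteq> 0" using dh by (auto simp: \<Delta>_def v)
  have "- 1 / \<Delta> \<in> F" using \<Delta> F_subfield by (intro is_subfield_intros)
  then obtain \<alpha> \<beta> where ab: "\<alpha> \<in> F" "\<beta> \<in> F" and norm: "\<alpha>^2 + t * \<alpha> * \<beta> + d * \<beta>^2 = - 1 / \<Delta>"
    using finite_subfield_norm_form_surj[OF F_subfield F_finite facts(4,5,11)] by blast
  have abA: "\<alpha> \<in> A" "\<beta> \<in> A" using ab F_subset_A by auto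
  \<comment> \<open>These are entries of h' = h (\<alpha> + \<beta> M), whose lower right entry is
    -p'. Its determinant is \<Delta>, the determinant of h, times the norm -1 / \<Delta>; a
    traceless matrix of determinant -1 squares to 1.\<close>
  define p' r' s' where "p' = \<alpha> * p + \<beta> * (p * a + r * c)"
    and "r' = \<alpha> * r + \<beta> * (p * b + r * e)" and "s' = \<alpha> * s + \<beta> * (s * a - p * c)"
  have h'A: "p' \<in> A" "r' \<in> A" "s' \<in> A"
    unfolding p'_def r'_def s'_def using abA hA MA
    by (auto intro!: is_subring_add[OF A_subring] is_subring_diff[OF A_subring] is_subring_mult[OF A_subring])
  have p'_alt: "- p' = - \<alpha> * p + \<beta> * (s * b - p * e)"
  proof -
    have "p' + (- \<alpha> * p + \<beta> * (s * b - p * e)) = \<beta> * (p * (a - e) + r * c + b * s)"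
      by (simp add: p'_def algebra_simps)
    also have "\<dots> = 0" by (simp only: rel1 mult_zero_right)
    finally show ?thesis by (rule minus_unique)
  qed
  have invol: "p' * p' + r' * s' = 1"
  proof -
    have "- (p' * p') - r' * s' = p' * (- p') - r' * s'" by simp
    also have "\<dots> = \<Delta> * (\<alpha>^2 + t * \<alpha> * \<beta> + d * \<beta>^2)"
      unfolding p'_alt unfolding p'_def r'_def s'_def \<Delta>_def td by (simp add: power2_eq_square algebra_simps)
    also have "\<dots> = - 1" using \<Delta> by (simp add: norm)
    finally show ?thesis by (simp add: algebra_simps)
  qed
  have rel': "p' * (a - e) + r' * c + b * s' = 0"
  proof -
    have "p' * (a - e) + r' * c + b * s' = (\<alpha> + \<beta> * a) * (p * (a - e) + r * c + b * s)"
      by (simp add: p'_def r'_def s'_def algebra_simps)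
    thus ?thesis using rel1 by simp
  qed
  \<comment> \<open>(1 + p', s') and (r', 1 - p') are the columns of 1 + h', and h' fixes both. If
    both vanished, the characteristic would be two with a = e, so t and the discriminant would be
    zero.\<close>
  obtain x y where xy: "x \<noteq> 0 \<or> y \<noteq> 0" and fixed: "p' * x + r' * y = x" "s' * x - p' * y = y"
  proof (cases "r' = 0 \<and> p' = 1")
    case False
    have "p' * r' + r' * (1 - p') = r'" "s' * r' - p' * (1 - p') = 1 - p'"
      using invol by (simp_all add: algebra_simps)
    thus thesis using that[of r' "1 - p'"] False by auto
  next
    case True
    have "1 + p' \<noteq> 0 \<or> s' \<noteq> 0"
    proof (rule ccontr)
      assume neg: "\<not> ?thesis"
      hence "(2::'k) = 0" using True by auto
      moreover have "a = e" using rel' True neg by simp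
      ultimately have "t = 0" by (simp add: td flip: mult_2)
      moreover have "(4::'k) = 0" using \<open>2 = 0\<close> by (metis mult_zero_left mult_2 numeral_Bit0)
      ultimately show False using facts(11) by simp
    qed
    moreover have "p' * (1 + p') + r' * s' = 1 + p'" "s' * (1 + p') - p' * s' = s'"
      using invol by (simp_all add: algebra_simps)
    ultimately show thesis using that[of "1 + p'" s'] by blast
  qed
  define g where "g = mat2 x (a * x + b * y) y (c * x + e * y)"
  have detg: "det g = x * (c * x + e * y) - y * (a * x + b * y)"
    by (simp add: g_def det_2 mult.commute)
  \<comment> \<open>If g were singular, u = (x, y) would be an eigenvector of M, with an eigenvalue
    k in the function field.\<close>
  have g0: "det g \<noteq> 0"
  proof
    assume z: "det g = 0"
    show False
    proof (cases "y = 0")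
      case True thus False using z xy c0 by (simp add: detg)
    next
      case False
      define k where "k = (c * x + e * y) / y"
      have ky: "k * y = c * x + e * y" using False by (simp add: k_def)
      have kx: "k * x = a * x + b * y"
      proof -
        have "y * (k * x) = x * (k * y)" by (simp add: mult_ac)
        also have "\<dots> = y * (a * x + b * y)" using z unfolding ky detg by simp
        finally have "y * (k * x) = y * (a * x + b * y)" .
        thus ?thesis using False by simp
      qed
      have "y * (k^2 - t * k + d) = 0"
      proof -
        have "y * (k^2 - t * k + d) = k * (k * y) - t * (k * y) + d * y" by (simp add: power2_eq_square algebra_simps)
        also have "k * (k * y) = k * (c * x + e * y)" by (simp only: ky)
        also have "\<dots> = c * (k * x) + e * (k * y)" by (simp add: algebra_simps)
        also have "c * (k * x) + e * (k * y) - t * (k * y) + d * y = 0"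
          by (simp only: kx ky td) (simp add: algebra_simps)
        finally show ?thesis .
      qed
      thus False using False facts(10)[of k] by simp
    qed
  qed
  define X where "X = mat2 0 (- d) 1 t"
  define Y where "Y = mat2 1 t 0 (- 1)"
  define h' where "h' = mat2 p' r' s' (- p')"
  have gX: "g ** X = M ** g"
    by (simp add: mat2_eq_iff X_def g_def td a_def[symmetric] b_def[symmetric] c_def[symmetric] e_def[symmetric])
       (simp add: algebra_simps)
  \<comment> \<open>h' fixes u and h' M u = (t - M) h' u = t u - M u; these are the columns of
    \<open>g ** Y\<close>.\<close>
  have gY: "g ** Y = h' ** g"
  proof -
    have h1: "p' * (a * x + b * y) + r' * (c * x + e * y) = t * x - (a * x + b * y)"
    proof -
      have "p' * (a * x + b * y) + r' * (c * x + e * y) - (t * x - (a * x + b * y))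
        = e * (p' * x + r' * y - x) + b * (y - (s' * x - p' * y)) + x * (p' * (a - e) + r' * c + b * s')"
        by (simp add: td algebra_simps)
      thus ?thesis using fixed rel' by simp
    qed
    have h2: "s' * (a * x + b * y) - p' * (c * x + e * y) = t * y - (c * x + e * y)"
    proof -
      have "s' * (a * x + b * y) - p' * (c * x + e * y) - (t * y - (c * x + e * y))
        = a * (s' * x - p' * y - y) + c * (x - (p' * x + r' * y)) + y * (p' * (a - e) + r' * c + b * s')"
        by (simp add: td algebra_simps)
      thus ?thesis using fixed rel' by simp
    qed
    show ?thesis using fixed h1 h2
      by (simp add: mat2_eq_iff Y_def h'_def g_def)
  qed
  have "products_integral A g"
  proof (rule products_integral_of_generators[OF A_subring g0 FA])
    show "1 / (t^2 - 4 * d) \<in> A"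
      using facts(4,5) F_subset_A F_subfield by (intro subsetD[OF F_subset_A] is_subfield_intros)
    show "t^2 - 4 * d \<noteq> 0" by (rule facts(11))
    show "mconj g (mat2 0 (- d) 1 t) \<in> mat_over A"
      using mconj_eqI[OF g0 gX] facts(3) by (simp add: X_def)
    have "h' \<in> mat_over A" using h'A is_subring_uminus[OF A_subring] by (simp add: h'_def mat_over_iff)
    thus "mconj g (mat2 1 t 0 (- 1)) \<in> mat_over A"
      using mconj_eqI[OF g0 gY] by (simp add: Y_def)
  qed
  hence "g \<in> normGL2 A" using g0 normGL2_iff_products_integral[OF A_subring] by blast
  thus ?thesis using gX unfolding X_def by blast
qed

end

subsection \<open>The action of the Quinn group\<close>

locale quinn_setting = C_inf_place F V \<iota> for F V :: "'k::field set" and \<iota> :: "'k \<Rightarrow> 'c::{field,complete_space}" +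
  fixes \<sigma> :: "'c \<Rightarrow> 'c"
  assumes \<sigma>: "nontrivial_aut F \<iota> \<sigma>"
begin

abbreviation "G \<equiv> carrier (GL2 A)"
abbreviation "N \<equiv> normGL2 A"
abbreviation "act \<equiv> moebius_act \<iota>"
abbreviation "orb \<equiv> G_orbit A \<iota>"
abbreviation "Kt \<equiv> K_tilde F \<iota>"
abbreviation "EP \<equiv> elliptic_points A \<iota>"
abbreviation "Ell \<equiv> Ell_eq A \<iota> \<sigma>"
abbreviation "qact \<equiv> Quinn_act A \<iota> \<sigma>"

section \<open>The nontrivial automorphism of \<open>K_tilde\<close> and elliptic points\<close>

lemma \<sigma>_\<iota>: "\<sigma> (\<iota> a) = \<iota> a"
  and \<sigma>_add: "x \<in> Kt \<Longrightarrow> y \<in> Kt \<Longrightarrow> \<sigma> (x + y) = \<sigma> x + \<sigma> y"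
  and \<sigma>_mult: "x \<in> Kt \<Longrightarrow> y \<in> Kt \<Longrightarrow> \<sigma> (x * y) = \<sigma> x * \<sigma> y"
  using \<sigma> by (auto simp: nontrivial_aut_def)

lemma \<iota>_in_K_tilde: "\<iota> x \<in> Kt"
  by (auto simp: K_tilde_def field_gen_def)

lemma K_tilde_subfield: "is_subfield (Kt)"
  unfolding K_tilde_def field_gen_def is_subfield_def by auto

lemma \<sigma>_affine:
  assumes "x \<in> Kt"
  shows "\<sigma> (\<iota> a * x + \<iota> b) = \<iota> a * \<sigma> x + \<iota> b"
  using assms \<iota>_in_K_tilde is_subfield_mult[OF K_tilde_subfield \<iota>_in_K_tilde assms]
  by (simp add: \<sigma>_add \<sigma>_mult \<sigma>_\<iota>)

lemma \<sigma>_num_den: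
  assumes "w \<in> Kt"
  shows "\<sigma> (num M w) = num M (\<sigma> w)" "\<sigma> (den M w) = den M (\<sigma> w)"
  using assms by (auto simp: num_def den_def \<sigma>_affine)

lemma num_den_in_K_tilde:
  assumes "w \<in> Kt"
  shows "num M w \<in> Kt" "den M w \<in> Kt"
  using assms unfolding num_def den_def
  by (auto intro!: is_subfield_add[OF K_tilde_subfield] is_subfield_mult[OF K_tilde_subfield] \<iota>_in_K_tilde)

lemma moebius_in_K_tilde: "w \<in> Kt \<Longrightarrow> act M w \<in> Kt"
  unfolding moebius_num_den using num_den_in_K_tilde is_subfield_divide[OF K_tilde_subfield] by blast

text \<open>\<open>\<sigma> \<epsilon>\<close> is again a root of the quadratic. It differs from
  \<epsilon>, since \<epsilon> generates \<open>K_tilde\<close> over the function field and \<sigma>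
  is not the identity there.\<close>

lemma \<sigma>_generator:
  assumes td: "t \<in> F" "d \<in> F" and \<epsilon>: "\<epsilon> \<notin> range \<iota>" "\<epsilon>^2 = \<iota> t * \<epsilon> - \<iota> d"
  shows "\<epsilon> \<in> Kt" "\<sigma> \<epsilon> = \<iota> t - \<epsilon>"
proof -
  note Kt_eq = K_tilde_eq_quad_ext[OF td \<epsilon>]
  have "\<epsilon> = \<iota> 0 + \<iota> 1 * \<epsilon>" by (simp add: \<iota>_0 \<iota>_1)
  thus mem: "\<epsilon> \<in> Kt" unfolding Kt_eq quad_ext_def by blast
  have "\<epsilon> * \<epsilon> = \<iota> t * \<epsilon> + \<iota> (- d)" using \<epsilon>(2) by (simp add: power2_eq_square \<iota>_uminus)
  hence "\<sigma> \<epsilon> * \<sigma> \<epsilon> = \<iota> t * \<sigma> \<epsilon> + \<iota> (- d)" using \<sigma>_mult[OF mem mem] \<sigma>_affine[OF mem, of t "- d"] by simp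
  hence s2: "\<sigma> \<epsilon> * \<sigma> \<epsilon> = \<iota> t * \<sigma> \<epsilon> - \<iota> d" by (simp add: \<iota>_uminus)
  have "(\<sigma> \<epsilon> - \<epsilon>) * (\<sigma> \<epsilon> - (\<iota> t - \<epsilon>)) = (\<sigma> \<epsilon> * \<sigma> \<epsilon> - \<iota> t * \<sigma> \<epsilon>) - (\<epsilon>^2 - \<iota> t * \<epsilon>)"
    by (simp add: power2_eq_square algebra_simps)
  also have "\<dots> = 0" by (simp add: s2 \<epsilon>(2))
  finally have "(\<sigma> \<epsilon> - \<epsilon>) * (\<sigma> \<epsilon> - (\<iota> t - \<epsilon>)) = 0" .
  moreover have "\<sigma> \<epsilon> \<noteq> \<epsilon>"
  proof
    assume fixed: "\<sigma> \<epsilon> = \<epsilon>"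
    obtain x where x: "x \<in> Kt" "\<sigma> x \<noteq> x" using \<sigma> by (auto simp: nontrivial_aut_def)
    then obtain a b where "x = \<iota> b * \<epsilon> + \<iota> a" unfolding Kt_eq quad_ext_def by (auto simp: add.commute)
    thus False using x(2) \<sigma>_affine[OF mem, of b a] fixed by simp
  qed
  ultimately show "\<sigma> \<epsilon> = \<iota> t - \<epsilon>" by auto
qed

text \<open>w is an affine function of its eigenvalue \<open>den M w\<close>, hence lies in
  \<open>K_tilde\<close>. Applying \<sigma> to the fixed point equation shows that M also fixes
  \<open>\<sigma> w\<close>, with the conjugate eigenvalue.\<close>

lemma elliptic_point_conjugate:
  assumes M: "elliptic_matrix M w"
  shows "w \<in> Kt" "\<sigma> w \<notin> range \<iota>"
    "num M (\<sigma> w) = \<sigma> w * den M (\<sigma> w)" "den M (\<sigma> w) = \<iota> (M$1$1 + M$2$2) - den M w"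
proof -
  note facts = elliptic_matrix_facts[OF M]
  note \<epsilon> = \<sigma>_generator[OF facts(4,5,8,9)]
  have c: "M$2$1 \<noteq> 0" and Mw: "num M w = w * den M w" using M by (auto simp: elliptic_matrix_def)
  have "w = \<iota> (1 / M$2$1) * den M w + \<iota> (- M$2$2 / M$2$1)"
    using c by (simp add: den_def \<iota>_simps \<iota>_eq_0 field_simps)
  thus mem: "w \<in> Kt"
    using \<epsilon>(1) is_subfield_add[OF K_tilde_subfield is_subfield_mult[OF K_tilde_subfield \<iota>_in_K_tilde] \<iota>_in_K_tilde]
    by metis
  show "den M (\<sigma> w) = \<iota> (M$1$1 + M$2$2) - den M w" using \<epsilon>(2) \<sigma>_num_den[OF mem] by simp
  show "num M (\<sigma> w) = \<sigma> w * den M (\<sigma> w)"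
    using Mw \<sigma>_num_den[OF mem, of M] \<sigma>_mult[OF mem num_den_in_K_tilde(2)[OF mem, of M]] by simp
  show "\<sigma> w \<notin> range \<iota>"
  proof
    assume "\<sigma> w \<in> range \<iota>"
    then obtain z where "\<sigma> w = \<sigma> (\<iota> z)" by (auto simp: \<sigma>_\<iota>)
    moreover have "inj_on \<sigma> (Kt)" using \<sigma> by (simp add: nontrivial_aut_def bij_betw_def)
    ultimately have "w = \<iota> z" using mem \<iota>_in_K_tilde by (meson inj_onD)
    thus False using facts(2) by blast
  qed
qed

lemma \<sigma>_moebius:
  assumes "w \<in> Kt" "w \<notin> range \<iota>" "\<sigma> w \<notin> range \<iota>" "det g \<noteq> 0"
  shows "\<sigma> (act g w) = act g (\<sigma> w)"
proof -
  have "num g w = act g w * den g w" using moebius_eq_iff[OF assms(4,2)] by blast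
  hence "num g (\<sigma> w) = \<sigma> (act g w) * den g (\<sigma> w)"
    using \<sigma>_num_den[OF assms(1)] \<sigma>_mult[OF moebius_in_K_tilde num_den_in_K_tilde(2)] assms(1) by metis
  thus ?thesis using moebius_eq_iff[OF assms(4,3)] by metis
qed

section \<open>Orbits of \<open>G\<close> and the normalizer acting on points\<close>

lemma G_nonsingular: "h \<in> G \<Longrightarrow> det h \<noteq> 0"
  by (simp add: GL2_A_iff)

lemma G_mult: "g \<in> G \<Longrightarrow> h \<in> G \<Longrightarrow> g ** h \<in> G"
  using A_subring F_subfield by (auto simp: GL2_A_iff det2_mult intro: mat_over_mult is_subfield_mult)

lemma G_one: "mat 1 \<in> G"
  using F_subfield A_subring by (auto simp: GL2_A_iff det2_mat is_subfield_1 intro: mat_over_mat is_subring_1)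

lemma N_subgroup: "subgroup N (GL2 UNIV)"
  by (rule group.normalizer_imp_subgroup[OF GL2_UNIV_group]) (auto simp: GL2_carrier mat_over_def)

lemma N_nonsingular: "g \<in> N \<Longrightarrow> det g \<noteq> 0"
  using normGL2_iff[OF A_subring] by blast

lemma N_mult: "g \<in> N \<Longrightarrow> h \<in> N \<Longrightarrow> g ** h \<in> N"
  using subgroup.m_closed[OF N_subgroup] by (simp add: GL2_mult)

lemma N_inv: "g \<in> N \<Longrightarrow> inv2 g \<in> N"
  using subgroup.m_inv_closed[OF N_subgroup] N_nonsingular by (metis GL2_UNIV_inv)

lemma G_subset_N: "h \<in> G \<Longrightarrow> h \<in> N"
  by (rule GL2_subset_normGL2[OF A_subring])

lemma N_conj: "g \<in> N \<Longrightarrow> h \<in> G \<Longrightarrow> mconj g h \<in> G"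
  using normGL2_iff[OF A_subring] by blast

lemma mconj_mult_self: "det g \<noteq> 0 \<Longrightarrow> mconj g h ** g = g ** h"
  by (simp add: mconj_def inv2_left flip: matrix_mul_assoc)

lemma G_inv: assumes "h \<in> G" shows "inv2 h \<in> G"
proof -
  obtain k where k: "k \<in> G" "k ** h = mat 1" using assms unfolding GL2_carrier by metis
  have "inv2 h = k ** h ** inv2 h" by (simp add: k)
  also have "\<dots> = k" using assms by (simp add: G_nonsingular inv2_right flip: matrix_mul_assoc)
  finally show ?thesis using k by simp
qed

lemma act_mult:
  "g \<in> N \<Longrightarrow> h \<in> N \<Longrightarrow> w \<notin> range \<iota> \<Longrightarrow> act (g ** h) w = act g (act h w)"
  using moebius_mult N_nonsingular by blast

lemma act_notin_range: "g \<in> N \<Longrightarrow> w \<notin> range \<iota> \<Longrightarrow> act g w \<notin> range \<iota>"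
  using moebius_notin_range N_nonsingular by blast

lemma act_inv: "g \<in> N \<Longrightarrow> w \<notin> range \<iota> \<Longrightarrow> act (inv2 g) (act g w) = w"
  using moebius_inv2 N_nonsingular by blast

lemma act_inv': "g \<in> N \<Longrightarrow> w \<notin> range \<iota> \<Longrightarrow> act g (act (inv2 g) w) = w"
  using act_inv[OF N_inv] inv2_inv2 N_nonsingular by metis

lemma act_conj: "g \<in> N \<Longrightarrow> h \<in> G \<Longrightarrow> w \<notin> range \<iota> \<Longrightarrow> act g (act h w) = act (mconj g h) (act g w)"
  using act_mult[of "mconj g h" g w] act_mult[of g h w] mconj_mult_self[of g h] N_conj G_subset_N N_nonsingular
  by metis

lemma G_orbit_iff: "x \<in> orb w \<longleftrightarrow> (\<exists>h\<in>G. x = act h w)"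
  by (auto simp: orbit_def)

lemma G_orbit_self: "w \<in> orb w"
  unfolding G_orbit_iff using G_one moebius_mat[of 1 w] by (metis one_neq_zero)

text \<open>Composition of Moebius maps is available off the image of the function field, where
  denominators do not vanish; the orbits are therefore compared directly under that
  assumption.\<close>

lemma G_orbit_eq_iff:
  assumes "w \<notin> range \<iota>"
  shows "orb w = orb w' \<longleftrightarrow> (\<exists>h\<in>G. w' = act h w)"
proof
  assume "orb w = orb w'"
  thus "\<exists>h\<in>G. w' = act h w" using G_orbit_self[of w'] G_orbit_iff by blast
next
  assume "\<exists>h\<in>G. w' = act h w"
  then obtain h where h: "h \<in> G" "w' = act h w" by blast
  have w: "w = act (inv2 h) w'" using h assms by (simp add: act_inv G_subset_N)
  have w': "w' \<notin> range \<iota>" using h assms by (simp add: act_notin_range G_subset_N)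
  show "orb w = orb w'"
  proof (intro Set.set_eqI iffI)
    fix x assume "x \<in> orb w"
    then obtain k where k: "k \<in> G" "x = act k w" by (auto simp: G_orbit_iff)
    have "act (k ** inv2 h) w' = act k (act (inv2 h) w')"
      using k(1) h(1) w' by (intro act_mult G_subset_N G_inv)
    hence "x = act (k ** inv2 h) w'" by (simp only: k(2) w[symmetric])
    thus "x \<in> orb w'" using k h G_mult G_inv by (auto simp: G_orbit_iff)
  next
    fix x assume "x \<in> orb w'"
    then obtain k where k: "k \<in> G" "x = act k w'" by (auto simp: G_orbit_iff)
    have "x = act (k ** h) w" using k h assms act_mult[of k h w] by (simp add: G_subset_N)
    thus "x \<in> orb w" using k h G_mult by (auto simp: G_orbit_iff)
  qed
qed

text \<open>The condition on orbits in \<open>Ell_eq\<close>, expressed for a point of the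
  orbit.\<close>

definition self_conjugate :: "'c \<Rightarrow> bool" where
  "self_conjugate w \<longleftrightarrow> w \<in> EP \<and> (\<exists>h\<in>G. \<sigma> w = act h w)"

lemma elliptic_notin_range: "w \<in> EP \<Longrightarrow> w \<notin> range \<iota>"
  using elliptic_point_Omega Omega_notin_range by blast

lemma self_conjugate_notin_range: "self_conjugate w \<Longrightarrow> w \<notin> range \<iota>"
  using elliptic_notin_range by (simp add: self_conjugate_def)

lemma Ell_eq_iff: "X \<in> Ell \<longleftrightarrow> (\<exists>w. self_conjugate w \<and> X = orb w)"
  using G_orbit_eq_iff[OF elliptic_notin_range] by (auto simp: Ell_eq_def self_conjugate_def)

lemma elliptic_act:
  assumes g: "g \<in> N" and w: "w \<in> EP"
  shows "act g w \<in> EP"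
proof -
  obtain M where M: "w \<in> Omega \<iota>" "M \<in> G" "M \<notin> scalars" "act M w = w"
    using w by (auto simp: elliptic_points_def)
  have g0: "det g \<noteq> 0" using g by (rule N_nonsingular)
  have "act (mconj g M) (act g w) = act g w" using act_conj[OF g M(2), of w] M Omega_notin_range by simp
  moreover have "mconj g M \<notin> scalars"
  proof
    assume "mconj g M \<in> scalars"
    then obtain c where c: "mconj g M = mat c" "c \<noteq> 0" by (auto simp: scalars_def)
    have "g ** M = g ** mat c" using mconj_mult_self[OF g0, of M] c by (simp add: mat2_eq_iff mult.commute)
    hence "inv2 g ** g ** M = inv2 g ** g ** mat c" by (simp flip: matrix_mul_assoc)
    hence "M = mat c" by (simp add: inv2_left[OF g0])
    thus False using M c by (auto simp: scalars_def)
  qed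
  ultimately show ?thesis
    using moebius_in_Omega[OF g0 M(1)] N_conj[OF g M(2)] by (auto simp: elliptic_points_def)
qed

text \<open>\<sigma> commutes with g, whose entries lie in the function field, and g normalizes
  \<open>G\<close>: if h takes w to its conjugate, then g h g^(-1) takes g(w) to its
  conjugate.\<close>

lemma self_conjugate_act:
  assumes g: "g \<in> N" and w: "self_conjugate w"
  shows "self_conjugate (act g w)"
proof -
  obtain h where h: "h \<in> G" "\<sigma> w = act h w" using w by (auto simp: self_conjugate_def)
  have we: "w \<in> EP" using w by (simp add: self_conjugate_def)
  obtain M where "elliptic_matrix M w" using we elliptic_points_iff by blast
  note conj = elliptic_point_conjugate[OF this]
  have "\<sigma> (act g w) = act g (\<sigma> w)"
    using \<sigma>_moebius conj elliptic_notin_range[OF we] N_nonsingular[OF g] by blast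
  also have "\<dots> = act (mconj g h) (act g w)" using act_conj[OF g h(1) elliptic_notin_range[OF we]] h(2) by simp
  finally show ?thesis using elliptic_act[OF g we] N_conj[OF g h(1)] by (auto simp: self_conjugate_def)
qed

section \<open>The normal subgroup Z(K) G and its quotient\<close>

lemma ZG_iff: "x \<in> ZG A \<longleftrightarrow> (\<exists>c h. c \<noteq> 0 \<and> h \<in> G \<and> x = mat c ** h)"
  by (auto simp: set_mult_def scalars_def GL2_mult)

lemma mat_commute: "mat c ** M = M ** mat c" for M :: "'k^2^2"
  by (simp add: mat2_eq_iff mult.commute)

lemma mat_mult_mat: "(mat c :: 'k^2^2) ** mat d = mat (c * d)"
  by (simp add: mat2_eq_iff)

lemma scalar_in_N: "c \<noteq> 0 \<Longrightarrow> mat c \<in> N"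
proof -
  assume c: "c \<noteq> 0"
  hence "mconj (mat c) M = M" for M by (intro mconj_eqI mat_commute) (simp add: det2_mat)
  thus ?thesis using c by (simp add: normGL2_iff[OF A_subring] det2_mat)
qed

lemma ZG_subset_N: "ZG A \<subseteq> N"
proof
  fix x assume "x \<in> ZG A"
  then obtain c h where "c \<noteq> 0" "h \<in> G" "x = mat c ** h" by (auto simp: ZG_iff)
  thus "x \<in> N" using N_mult[OF scalar_in_N G_subset_N] by simp
qed

lemma G_subset_ZG: "h \<in> G \<Longrightarrow> h \<in> ZG A"
  unfolding ZG_iff by (intro exI[of _ 1] exI[of _ h]) simp

lemma ZG_mult: "x \<in> ZG A \<Longrightarrow> y \<in> ZG A \<Longrightarrow> x ** y \<in> ZG A"
proof -
  assume "x \<in> ZG A" "y \<in> ZG A"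
  then obtain c h d k where x: "c \<noteq> 0" "h \<in> G" "x = mat c ** h" and y: "d \<noteq> 0" "k \<in> G" "y = mat d ** k"
    by (auto simp: ZG_iff)
  have "x ** y = mat (c * d) ** (h ** k)"
    unfolding x y by (simp add: mat2_eq_iff algebra_simps)
  thus ?thesis using x y G_mult unfolding ZG_iff by (metis mult_eq_0_iff)
qed

lemma ZG_inv: assumes "x \<in> ZG A" shows "inv2 x \<in> ZG A"
proof -
  obtain c h where x: "c \<noteq> 0" "h \<in> G" "x = mat c ** h" using assms by (auto simp: ZG_iff)
  have x0: "det x \<noteq> 0" using assms ZG_subset_N N_nonsingular by blast
  have "mat (1 / c) ** inv2 h ** x = mat (1 / c) ** mat c ** (inv2 h ** h)"
    unfolding x by (metis mat_commute matrix_mul_assoc)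
  also have "\<dots> = mat 1" using x by (simp add: mat_mult_mat inv2_left G_nonsingular)
  finally have "mat (1 / c) ** inv2 h ** x ** inv2 x = inv2 x" by simp
  hence "inv2 x = mat (1 / c) ** inv2 h" using x0 by (simp add: inv2_right flip: matrix_mul_assoc)
  thus ?thesis using x G_inv unfolding ZG_iff by (metis divide_eq_0_iff one_neq_zero)
qed

lemma ZG_conj: assumes "g \<in> N" "x \<in> ZG A" shows "mconj g x \<in> ZG A"
proof -
  obtain c h where x: "c \<noteq> 0" "h \<in> G" "x = mat c ** h" using assms by (auto simp: ZG_iff)
  have "mconj g x = mat c ** mconj g h" using N_nonsingular[OF assms(1)] by (simp add: x mconj_mult mconj_mat)
  thus ?thesis using x N_conj[OF assms(1)] unfolding ZG_iff by blast
qed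

abbreviation "NG \<equiv> (GL2 (UNIV :: 'k set))\<lparr>carrier := N\<rparr>"

lemma NG_group: "group NG"
  by (rule subgroup.subgroup_is_group[OF N_subgroup GL2_UNIV_group])

lemma NG_inv: "g \<in> N \<Longrightarrow> inv\<^bsub>NG\<^esub> g = inv2 g"
  using group.m_inv_consistent[OF GL2_UNIV_group N_subgroup, of g] GL2_UNIV_inv[OF N_nonsingular, of g] by simp

lemma ZG_normal: "ZG A \<lhd> NG"
  unfolding group.normal_inv_iff[OF NG_group]
proof (intro conjI ballI)
  show "subgroup (ZG A) NG"
  proof (rule group.subgroupI[OF NG_group])
    show "ZG A \<subseteq> carrier NG" using ZG_subset_N by simp
    show "ZG A \<noteq> {}" using G_subset_ZG[OF G_one] by blast
    show "inv\<^bsub>NG\<^esub> x \<in> ZG A" if "x \<in> ZG A" for x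
    proof -
      have "x \<in> N" using that ZG_subset_N by blast
      thus ?thesis using ZG_inv[OF that] NG_inv by simp
    qed
    show "x \<otimes>\<^bsub>NG\<^esub> y \<in> ZG A" if "x \<in> ZG A" "y \<in> ZG A" for x y
      using ZG_mult[OF that] by (simp add: GL2_mult)
  qed
  fix g x assume "g \<in> carrier NG" "x \<in> ZG A"
  thus "g \<otimes>\<^bsub>NG\<^esub> x \<otimes>\<^bsub>NG\<^esub> inv\<^bsub>NG\<^esub> g \<in> ZG A"
    using ZG_conj[of g x] NG_inv[of g] by (simp add: GL2_mult mconj_def)
qed

abbreviation coset :: "'k^2^2 \<Rightarrow> ('k^2^2) set" where "coset g \<equiv> ZG A #>\<^bsub>GL2 UNIV\<^esub> g"

lemma coset_NG: "ZG A #>\<^bsub>NG\<^esub> g = coset g"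
  by (simp add: r_coset_def)

lemma Quinn_group: "group (Quinn A)"
  unfolding Quinn_def by (rule normal.factorgroup_is_group[OF ZG_normal])

lemma Quinn_carrier: "carrier (Quinn A) = coset ` N"
  by (simp add: Quinn_def carrier_FactGroup coset_NG)

lemma Quinn_mult:
  assumes "g \<in> N" "h \<in> N"
  shows "coset g \<otimes>\<^bsub>Quinn A\<^esub> coset h = coset (g ** h)"
  using normal.rcos_sum[OF ZG_normal, of g h] assms by (simp add: Quinn_def coset_NG GL2_mult)

lemma Quinn_one: "\<one>\<^bsub>Quinn A\<^esub> = ZG A"
  by (simp add: Quinn_def)

lemma coset_iff: "x \<in> coset g \<longleftrightarrow> (\<exists>c h. c \<noteq> 0 \<and> h \<in> G \<and> x = mat c ** h ** g)"
proof -
  have "x \<in> coset g \<longleftrightarrow> (\<exists>z. z \<in> ZG A \<and> x = z ** g)" by (auto simp: r_coset_def GL2_mult)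
  thus ?thesis unfolding ZG_iff by blast
qed

lemma coset_of_ZG: assumes "g \<in> ZG A" shows "coset g = ZG A"
  using group.coset_join2[OF NG_group, of g "ZG A"] normal_imp_subgroup[OF ZG_normal] assms ZG_subset_N
  by (auto simp: coset_NG)

text \<open>Scalars act trivially and g carries \<open>G\<close>-orbits to \<open>G\<close>-orbits,
  so the union over the coset is a single orbit.\<close>

lemma coset_action:
  assumes g: "g \<in> N" and w: "w \<notin> range \<iota>"
  shows "(\<Union>x\<in>coset g. act x ` orb w) = orb (act g w)"
proof (intro Set.set_eqI iffI)
  fix z assume "z \<in> (\<Union>x\<in>coset g. act x ` orb w)"
  then obtain c h k where c: "c \<noteq> 0" and h: "h \<in> G" and k: "k \<in> G" and z: "z = act (mat c ** h ** g) (act k w)"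
    by (auto simp: coset_iff G_orbit_iff)
  have kw: "act k w \<notin> range \<iota>" using k w by (simp add: act_notin_range G_subset_N)
  have N: "mat c \<in> N" "h \<in> N" "mat c ** h \<in> N" using c h by (auto intro: scalar_in_N G_subset_N N_mult)
  have "z = act (mat c) (act h (act g (act k w)))"
    unfolding z using N g kw by (simp add: act_mult act_notin_range)
  also have "\<dots> = act h (act (mconj g k) (act g w))" using c act_conj[OF g k w] by (simp add: moebius_mat)
  also have "\<dots> = act (h ** mconj g k) (act g w)"
    using h N_conj[OF g k] act_notin_range[OF g w] by (simp add: act_mult G_subset_N)
  finally show "z \<in> orb (act g w)" using h N_conj[OF g k] G_mult by (auto simp: G_orbit_iff)
next
  fix z assume "z \<in> orb (act g w)"
  then obtain h where h: "h \<in> G" "z = act h (act g w)" by (auto simp: G_orbit_iff)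
  hence "z = act (mat 1 ** h ** g) w" using g w by (simp add: act_mult G_subset_N)
  moreover have "mat 1 ** h ** g \<in> coset g" unfolding coset_iff using h by (metis one_neq_zero)
  ultimately show "z \<in> (\<Union>x\<in>coset g. act x ` orb w)" using G_orbit_self[of w] by blast
qed

section \<open>The induced action on orbits\<close>

lemma Quinn_act_coset:
  assumes "g \<in> N" "w \<notin> range \<iota>" "orb w \<in> Ell"
  shows "qact (coset g) (orb w) = orb (act g w)"
  using assms coset_action by (simp add: Quinn_act_def)

lemma Quinn_act_coset':
  assumes "g \<in> N" "self_conjugate w"
  shows "qact (coset g) (orb w) = orb (act g w)"
  using Quinn_act_coset[OF assms(1) self_conjugate_notin_range[OF assms(2)]] assms(2) Ell_eq_iff by blast

lemma Quinn_act_in_Ell_eq: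
  assumes "g \<in> N" "X \<in> Ell"
  shows "qact (coset g) X \<in> Ell"
  using assms Quinn_act_coset' self_conjugate_act by (metis Ell_eq_iff)

lemma Quinn_act_mult:
  assumes "g \<in> N" "h \<in> N" "X \<in> Ell"
  shows "qact (coset (g ** h)) X = qact (coset g) (qact (coset h) X)"
proof -
  obtain w where w: "self_conjugate w" "X = orb w" using assms Ell_eq_iff by blast
  show ?thesis using assms w by (simp add: Quinn_act_coset' self_conjugate_act N_mult act_mult self_conjugate_notin_range)
qed

lemma Quinn_act_one:
  assumes "X \<in> Ell"
  shows "qact (coset (mat 1)) X = X"
proof -
  obtain w where w: "self_conjugate w" "X = orb w" using assms Ell_eq_iff by blast
  thus ?thesis using Quinn_act_coset'[OF scalar_in_N[of 1] w(1)] by (simp add: moebius_mat)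
qed

lemma Quinn_act_Bij:
  assumes g: "g \<in> N"
  shows "qact (coset g) \<in> Bij (Ell)"
proof -
  have "bij_betw (qact (coset g)) (Ell) (Ell)"
  proof (rule bij_betwI[where g = "qact (coset (inv2 g))"])
    fix X assume X: "X \<in> Ell"
    show "qact (coset (inv2 g)) (qact (coset g) X) = X"
      using Quinn_act_mult[OF N_inv[OF g] g X] Quinn_act_one[OF X] by (simp add: inv2_left N_nonsingular g)
    show "qact (coset g) (qact (coset (inv2 g)) X) = X"
      using Quinn_act_mult[OF g N_inv[OF g] X] Quinn_act_one[OF X] by (simp add: inv2_right N_nonsingular g)
  qed (use g N_inv Quinn_act_in_Ell_eq in auto)
  thus ?thesis by (simp add: Bij_def Quinn_act_def)
qed

lemma Quinn_group_action: "group_action (Quinn A) (Ell) (qact)"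
proof (unfold group_action_def, rule group_hom.intro[OF Quinn_group group_BijGroup], unfold group_hom_axioms_def, rule homI)
  fix C assume "C \<in> carrier (Quinn A)"
  thus "qact C \<in> carrier (BijGroup (Ell))"
    using Quinn_act_Bij by (auto simp: Quinn_carrier BijGroup_def)
next
  fix C D assume "C \<in> carrier (Quinn A)" "D \<in> carrier (Quinn A)"
  then obtain g h where gh: "g \<in> N" "h \<in> N" "C = coset g" "D = coset h" by (auto simp: Quinn_carrier)
  have "qact (coset (g ** h)) = compose (Ell) (qact C) (qact D)"
  proof (rule extensionalityI[of _ "Ell"])
    fix X assume "X \<in> Ell"
    thus "qact (coset (g ** h)) X = compose (Ell) (qact C) (qact D) X"
      using Quinn_act_mult gh by (simp add: compose_eq)
  qed (simp_all add: Quinn_act_def)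
  thus "qact (C \<otimes>\<^bsub>Quinn A\<^esub> D) = qact C \<otimes>\<^bsub>BijGroup (Ell)\<^esub> qact D"
    using gh Quinn_act_Bij by (simp add: Quinn_mult BijGroup_def)
qed

text \<open>A root \<epsilon> of X^2 - X - c, irreducible over \<open>F\<close>, is fixed by the
  matrix with rows (1, c) and (1, 0), and its conjugate is its image under z to 1 - z. This point
  shows that there are such orbits and is the one with which all others are compared.\<close>

lemma exists_base_point:
  "\<exists>t d \<epsilon>. t \<in> F \<and> d \<in> F \<and> \<epsilon>^2 = \<iota> t * \<epsilon> - \<iota> d \<and> self_conjugate \<epsilon>"
proof -
  obtain c where c: "c \<in> F" and no_root: "\<And>a. a \<in> F \<Longrightarrow> a^2 - a - c \<noteq> 0"
    using finite_subfield_artin_schreier_no_root[OF F_subfield F_finite] by blast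
  have F01: "0 \<in> F" "1 \<in> F" "- 1 \<in> F" "- c \<in> F"
    using F_subfield c by (auto intro: is_subfield_0 is_subfield_1 is_subfield_uminus)
  have A01: "0 \<in> A" "1 \<in> A" "- 1 \<in> A" "c \<in> A" using F01 c F_subset_A by auto
  have c0: "c \<noteq> 0" using no_root[OF F01(1)] by simp
  obtain \<epsilon> where \<epsilon>: "\<epsilon>^2 - \<iota> 1 * \<epsilon> + \<iota> (- c) = 0" using exists_quadratic_root by blast
  have \<epsilon>K: "\<epsilon> \<notin> K" by (rule quadratic_constant_notin_K_inf[OF F01(2,4) _ \<epsilon>]) (use no_root in auto)
  have \<epsilon>2: "\<epsilon>^2 = \<iota> 1 * \<epsilon> - \<iota> (- c)" using \<epsilon> by (simp add: algebra_simps)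
  have "elliptic_matrix (mat2 1 c 1 0) \<epsilon>"
    unfolding elliptic_matrix_def
  proof (intro conjI)
    show "\<epsilon> \<in> Omega \<iota>" using \<epsilon>K by (simp add: Omega_iff)
    show "mat2 1 c 1 0 \<in> G" using A01 F01 c0 by (simp add: GL2_A_iff mat_over_iff det_2)
    show "num (mat2 1 c 1 0) \<epsilon> = \<epsilon> * den (mat2 1 c 1 0) \<epsilon>"
      using \<epsilon>2 by (simp add: num_def den_def \<iota>_simps power2_eq_square)
  qed (use F01 in auto)
  hence ell: "\<epsilon> \<in> EP" using elliptic_points_iff by blast
  have r: "\<epsilon> \<notin> range \<iota>" by (rule elliptic_notin_range[OF ell])
  have "\<sigma> \<epsilon> = 1 - \<epsilon>" using \<sigma>_generator(2)[OF F01(2,4) r \<epsilon>2] by (simp add: \<iota>_1)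
  moreover have "act (mat2 (- 1) 1 0 1) \<epsilon> = 1 - \<epsilon>" by (simp add: moebius_act_def \<iota>_simps)
  moreover have "mat2 (- 1) 1 0 1 \<in> G" using A01 F01 by (simp add: GL2_A_iff mat_over_iff det_2)
  ultimately have "self_conjugate \<epsilon>" using ell by (metis self_conjugate_def)
  thus ?thesis using F01 \<epsilon>2 by blast
qed

text \<open>h maps (w, 1) to a multiple of (\<open>\<sigma> w\<close>, 1). This is an eigenvector of
  M for the conjugate eigenvalue t - \<epsilon>, hence of t - M for \<epsilon>, the eigenvalue of M
  at w. So both sides take the same value at (w, 1).\<close>

lemma self_conjugate_conjugation:
  assumes M: "elliptic_matrix M w" and h: "h \<in> G" "\<sigma> w = act h w"
  shows "h ** M = (mat (M$1$1 + M$2$2) - M) ** h"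
proof -
  define t where "t = M$1$1 + M$2$2"
  note conj = elliptic_point_conjugate[OF M, folded t_def]
  have wr: "w \<notin> range \<iota>" and Mw: "num M w = w * den M w"
    using elliptic_matrix_facts(2)[OF M] M by (auto simp: elliptic_matrix_def)
  have hw: "num h w = \<sigma> w * den h w" using moebius_eq_iff[OF G_nonsingular[OF h(1)] wr] h(2) by metis
  have L: "num (h ** M) w = den M w * num h w" "den (h ** M) w = den M w * den h w"
    unfolding num_den_mult Mw by (simp_all add: num_def[of h] den_def[of h] algebra_simps)
  have "num ((mat t - M) ** h) w = den h w * (\<iota> t * \<sigma> w - num M (\<sigma> w))"
    unfolding num_den_mult hw by (simp add: num_def[of M] \<iota>_simps algebra_simps)
  also have "\<dots> = num h w * (\<iota> t - den M (\<sigma> w))" by (simp add: conj(3) hw algebra_simps)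
  finally have "num ((mat t - M) ** h) w = num (h ** M) w" by (simp add: conj(4) L)
  moreover have "den ((mat t - M) ** h) w = den h w * (\<iota> t - den M (\<sigma> w))"
    unfolding num_den_mult hw by (simp add: den_def[of M] \<iota>_simps algebra_simps)
  hence "den ((mat t - M) ** h) w = den (h ** M) w" by (simp add: conj(4) L)
  ultimately show ?thesis unfolding t_def[symmetric] using num_den_unique[OF wr] by metis
qed

text \<open>The normalizing g turns M into a companion matrix over \<open>F\<close>, so w' =
  g^(-1)(w) is fixed by a matrix over \<open>F\<close> and lies in the field of q^2 elements. This
  field is also F + F \<epsilon>, so an affine map over \<open>F\<close> takes \<epsilon> to
  w'.\<close>

lemma self_conjugate_transitive:
  assumes t0: "t0 \<in> F" "d0 \<in> F" and \<epsilon>: "\<epsilon>^2 = \<iota> t0 * \<epsilon> - \<iota> d0" "\<epsilon> \<notin> range \<iota>" and w: "self_conjugate w"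
  shows "\<exists>g\<in>N. w = act g \<epsilon>"
proof -
  obtain h where h: "h \<in> G" "\<sigma> w = act h w" using w by (auto simp: self_conjugate_def)
  obtain M where M: "elliptic_matrix M w" using w elliptic_points_iff by (auto simp: self_conjugate_def)
  define t where "t = M$1$1 + M$2$2"
  define d where "d = det M"
  note facts = elliptic_matrix_facts[OF M, folded t_def d_def]
  define X where "X = mat2 0 (- d) 1 t"
  obtain g where g: "g \<in> N" "g ** X = M ** g"
    using exists_normalizer_of_conjugation[OF M h(1) self_conjugate_conjugation[OF M h]]
    by (auto simp: X_def t_def d_def)
  have detX: "det X \<noteq> 0" using facts(6) by (simp add: X_def det_2)
  have MN: "M \<in> N" using M G_subset_N by (simp add: elliptic_matrix_def)
  define w' where "w' = act (inv2 g) w"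
  have w'r: "w' \<notin> range \<iota>" unfolding w'_def using act_notin_range N_inv g facts(2) by blast
  have gw': "act g w' = w" unfolding w'_def using act_inv' g facts(2) by blast
  have "act g (act X w') = act M (act g w')"
    using moebius_mult[OF N_nonsingular[OF g(1)] detX w'r] act_mult[OF MN g(1) w'r] g(2) by simp
  also have "\<dots> = w" using gw' moebius_eq_iff[OF N_nonsingular[OF MN] facts(2)] M by (simp add: elliptic_matrix_def)
  finally have "act (inv2 g) (act g (act X w')) = w'" by (simp add: w'_def)
  hence "act X w' = w'" using act_inv[OF g(1) moebius_notin_range[OF detX w'r]] by simp
  hence "num X w' = w' * den X w'" using moebius_eq_iff[OF detX w'r] by blast
  hence eq: "- \<iota> d = w' * w' + \<iota> t * w'"
    by (simp add: num_def den_def X_def \<iota>_simps algebra_simps)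
  have "w'^2 = (w' * w' + \<iota> t * w') - \<iota> t * w'" by (simp add: power2_eq_square)
  hence "w'^2 = \<iota> (- t) * w' - \<iota> d" by (simp add: eq[symmetric] \<iota>_uminus)
  moreover have "- t \<in> F" using facts(4) F_subfield by (rule is_subfield_uminus[rotated])
  ultimately have "quad_ext F w' = quad_ext F \<epsilon>"
    using quad_ext_constants[OF _ facts(5) w'r] quad_ext_constants[OF t0 \<epsilon>(2,1)] by metis
  moreover have "w' = \<iota> 0 + \<iota> 1 * w'" by (simp add: \<iota>_0 \<iota>_1)
  hence "w' \<in> quad_ext F w'" unfolding quad_ext_def using is_subfield_0 is_subfield_1 F_subfield by blast
  ultimately obtain a b where ab: "a \<in> F" "b \<in> F" "w' = \<iota> a + \<iota> b * \<epsilon>" by (auto simp: quad_ext_def)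
  have b0: "b \<noteq> 0" using w'r ab by (auto simp: \<iota>_0)
  define k where "k = mat2 b a 0 1"
  have k: "k \<in> G" using ab b0 F_subset_A is_subfield_0[OF F_subfield] is_subfield_1[OF F_subfield]
    by (auto simp: k_def GL2_A_iff mat_over_iff det_2)
  have "act k \<epsilon> = w'" by (simp add: k_def moebius_act_def ab \<iota>_simps)
  hence "w = act (g ** k) \<epsilon>" using act_mult[OF g(1) G_subset_N[OF k] \<epsilon>(2)] gw' by simp
  thus ?thesis using N_mult[OF g(1) G_subset_N[OF k]] by blast
qed

lemma Quinn_transitive_action: "transitive_action (Quinn A) (Ell) (qact)"
proof (rule transitive_action.intro[OF Quinn_group_action], unfold_locales)
  fix X Y assume XY: "X \<in> Ell" "Y \<in> Ell"
  then obtain w z where w: "self_conjugate w" "X = orb w" and z: "self_conjugate z" "Y = orb z"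
    by (auto simp: Ell_eq_iff)
  obtain t d \<epsilon> where \<epsilon>: "t \<in> F" "d \<in> F" "\<epsilon>^2 = \<iota> t * \<epsilon> - \<iota> d" "self_conjugate \<epsilon>"
    using exists_base_point by blast
  note r = self_conjugate_notin_range[OF \<epsilon>(4)]
  obtain g h where g: "g \<in> N" "w = act g \<epsilon>" and h: "h \<in> N" "z = act h \<epsilon>"
    using self_conjugate_transitive[OF \<epsilon>(1-3) r] w z by metis
  have "act (h ** inv2 g) w = z"
    using act_mult[OF h(1) N_inv[OF g(1)] self_conjugate_notin_range[OF w(1)]] act_inv[OF g(1) r] g h by simp
  hence "qact (coset (h ** inv2 g)) X = Y"
    using Quinn_act_coset'[OF N_mult[OF h(1) N_inv[OF g(1)]] w(1)] w z by simp
  thus "\<exists>C\<in>carrier (Quinn A). qact C X = Y"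
    using N_mult[OF h(1) N_inv[OF g(1)]] unfolding Quinn_carrier by blast
qed

text \<open>If g fixes the orbit of w, then h g fixes w itself for some h in \<open>G\<close>, and
  \<open>normGL2_stabilizer\<close> applies. Multiplying by h does not change the class of
  g.\<close>

lemma Quinn_stabilizer:
  assumes X: "X \<in> Ell"
  shows "stabilizer (Quinn A) (qact) X = {\<one>\<^bsub>Quinn A\<^esub>}"
proof
  obtain w where w: "self_conjugate w" "X = orb w" using X Ell_eq_iff by blast
  note r = self_conjugate_notin_range[OF w(1)]
  have one: "coset (mat 1) = ZG A" using coset_of_ZG[OF G_subset_ZG[OF G_one]] .
  show "{\<one>\<^bsub>Quinn A\<^esub>} \<subseteq> stabilizer (Quinn A) (qact) X"
    using Quinn_act_one[OF X] monoid.one_closed[OF group.is_monoid[OF Quinn_group]]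
    by (simp add: stabilizer_def Quinn_one one)
  show "stabilizer (Quinn A) (qact) X \<subseteq> {\<one>\<^bsub>Quinn A\<^esub>}"
  proof
    fix C assume "C \<in> stabilizer (Quinn A) (qact) X"
    then obtain g where g: "g \<in> N" "C = coset g" and stab: "qact (coset g) X = X"
      by (auto simp: stabilizer_def Quinn_carrier)
    have "orb (act g w) = orb w" using stab Quinn_act_coset'[OF g(1) w(1)] w(2) by simp
    then obtain h where h: "h \<in> G" "w = act h (act g w)"
      using G_orbit_eq_iff[OF act_notin_range[OF g(1) r]] by blast
    have "act (h ** g) w = w" using act_mult[OF G_subset_N[OF h(1)] g(1) r] h(2) by simp
    hence "h ** g \<in> ZG A"
      using normGL2_stabilizer[OF N_mult[OF G_subset_N[OF h(1)] g(1)], of w] w(1)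
      unfolding self_conjugate_def by blast
    hence "inv2 h ** (h ** g) \<in> ZG A" by (rule ZG_mult[OF G_subset_ZG[OF G_inv[OF h(1)]]])
    hence "g \<in> ZG A" using inv2_left[OF G_nonsingular[OF h(1)]] by (simp add: matrix_mul_assoc)
    thus "C \<in> {\<one>\<^bsub>Quinn A\<^esub>}" using coset_of_ZG g(2) by (simp add: Quinn_one)
  qed
qed

lemma Ell_eq_nonempty: "Ell \<noteq> {}"
  using exists_base_point Ell_eq_iff by blast

end

theorem theorem4p9:
  fixes F V A :: "'k::field set"
    and \<iota> :: "'k \<Rightarrow> 'c::{field,complete_space}"
    and \<sigma> :: "'c \<Rightarrow> 'c"
  assumes "function_field F"
    and "is_place F V"
    and "odd (place_degree F V)"
    and "A = ring_outside F V"
    and "is_C_inf F V \<iota>"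
    and "nontrivial_aut F \<iota> \<sigma>"
  shows "(\<forall>g \<in> normGL2 A. \<forall>w \<in> elliptic_points A \<iota>. G_orbit A \<iota> w \<in> Ell_eq A \<iota> \<sigma> \<longrightarrow>
            Quinn_act A \<iota> \<sigma> (ZG A #>\<^bsub>GL2 UNIV\<^esub> g) (G_orbit A \<iota> w) = G_orbit A \<iota> (moebius_act \<iota> g w))
       \<and> Ell_eq A \<iota> \<sigma> \<noteq> {}
       \<and> transitive_action (Quinn A) (Ell_eq A \<iota> \<sigma>) (Quinn_act A \<iota> \<sigma>)
       \<and> (\<forall>X \<in> Ell_eq A \<iota> \<sigma>. stabilizer (Quinn A) (Quinn_act A \<iota> \<sigma>) X = {\<one>\<^bsub>Quinn A\<^esub>})"
proof -
  interpret quinn_setting F V \<iota> \<sigma>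
    by unfold_locales (use assms in \<open>auto simp: function_field_def\<close>)
  show ?thesis
    unfolding assms(4)
    using Quinn_act_coset elliptic_notin_range Ell_eq_nonempty Quinn_transitive_action Quinn_stabilizer
    by blast
qed

end
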